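(* Let $\nu_{12}(z)$ and $\nu_{21}(z)$ be the modified operators (defined in the context) for the spin chain with arbitrary positive (half)-integer spins $s_1,\dots,s_N$, and put $S=\sum_{i=1}^N2s_i$. Let $\bar u=\{u_1,\dots,u_S\}$ and $\bar v=\{v_1,\dots,v_S\}$ be sets of $S$ pairwise distinct complex numbers and let $z\in\mathbb{C}$ with $z\notin\bar u\cup\bar v$. Then, as operators on $\bigotimes_{i=1}^N\mathbb{C}^{2s_i+1}$, $$\frac{\kappa^-}{\mu}\nu_{12}(z)\nu_{12}(\bar u)=(\rho_1+\rho_2)\left(F(z)g(z,\bar u)\nu_{12}(\bar u)+\sum_{i=1}^S g(u_i,z)F(u_i)g(u_i,\bar u_i)\nu_{12}(z)\nu_{12}(\bar u_i)\right)$$ and $$\frac{\kappa^+}{\mu}\nu_{21}(z)\nu_{21}(\bar v)=(\rho_1+\rho_2)\left(F(z)g(z,\bar v)\nu_{21}(\bar v)+\sum_{i=1}^S g(v_i,z)F(v_i)g(v_i,\bar v_i)\nu_{21}(z)\nu_{21}(\bar v_i)\right),$$ where $F(z)=\prod_{i=1}^N\prod_{k=0}^{2s_i}\frac{z-\theta_i+c(s_i-k+\frac12)}{c}$.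
   Context: Fix a nonzero constant $c\in\mathbb{C}$, an integer $N\ge1$, spins $s_1,\dots,s_N\in\{\tfrac12,1,\tfrac32,\dots\}$ and $\theta_1,\dots,\theta_N\in\mathbb{C}$. Spin representations: for each $i$, $S_i^{3},S_i^{+},S_i^{-}$ act on the $i$-th tensor factor $\mathbb{C}^{2s_i+1}$ as the irreducible spin-$s_i$ representation, with $[S^+,S^-]=2S^3$, $[S^3,S^\pm]=\pm S^\pm$; operators with different indices commute. Lax operator: $\mathcal{L}_{ai}(u)=\begin{pmatrix}\frac uc+\frac12+S_i^3 & S_i^-\\ S_i^+ & \frac uc+\frac12-S_i^3\end{pmatrix}_a$. Monodromy matrix: $T_a(u)=\mathcal{L}_{a1}(u-\theta_1)\cdots\mathcal{L}_{aN}(u-\theta_N)=\begin{pmatrix}t_{11}(u)&t_{12}(u)\\t_{21}(u)&t_{22}(u)\end{pmatrix}$, a $2\times 2$ matrix with entries operators on $\bigotimes_{i=1}^N\mathbb{C}^{2s_i+1}$. Modified operators: let $\tilde\kappa,\kappa,\kappa^+,\kappa^-\in\mathbb{C}$ with $\kappa^+\neq0$, $\kappa^-\ne0$ (twist parameters), and let $\rho_1,\rho_2\in\mathbb{C}$ satisfy $\kappa^+\kappa^--(\rho_1\kappa+\rho_2\tilde\kappa)+\rho_1\rho_2=0$ and $\rho_1\rho_2\neq\kappa^+\kappa^-$. Put $\mu=\big(1-\frac{\rho_1\rho_2}{\kappa^+\kappa^-}\big)^{-1}$. Then $$\nu_{12}(z)=\mu\Big(t_{12}(z)+\tfrac{\rho_1}{\kappa^-}t_{11}(z)+\tfrac{\rho_2}{\kappa^-}t_{22}(z)+\tfrac{\rho_1\rho_2}{(\kappa^-)^2}t_{21}(z)\Big),$$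 $$\nu_{21}(z)=\mu\Big(t_{21}(z)+\tfrac{\rho_1}{\kappa^+}t_{11}(z)+\tfrac{\rho_2}{\kappa^+}t_{22}(z)+\tfrac{\rho_1\rho_2}{(\kappa^+)^2}t_{12}(z)\Big).$$ The operators $\nu_{12}(z)$ at different values of $z$ commute with each other, and likewise for $\nu_{21}$. Notation: $g(u,v)=\frac{c}{u-v}$; $\bar u_i=\bar u\setminus\{u_i\}$; $g(z,\bar u)=\prod_{j}g(z,u_j)$, $g(u_i,\bar u_i)=\prod_{j\neq i}g(u_i,u_j)$, $\nu_{kl}(\bar u)=\prod_j\nu_{kl}(u_j)$, $\nu_{kl}(\bar u_i)=\prod_{j\ne i}\nu_{kl}(u_j)$ (empty products equal $1$); similarly for $\bar v$. *)

theory Defs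
  imports Complex_Main "Jordan_Normal_Form.VS_Connect"
begin

subsection \<open>Spin representations\<close>

text \<open>The spin is recorded by the natural number \<open>d = 2s\<close>; the representation
  space is \<open>\<complex>\<^sup>d\<^sup>+\<^sup>1\<close>.  Every irreducible triple is allowed, not only the standard
  matrices in the weight basis.\<close>

definition invariant_under :: "complex mat \<Rightarrow> complex vec set \<Rightarrow> bool" where
  "invariant_under A W \<longleftrightarrow> (\<forall>w\<in>W. A *\<^sub>v w \<in> W)"

definition spin_rep :: "nat \<Rightarrow> complex mat \<Rightarrow> complex mat \<Rightarrow> complex mat \<Rightarrow> bool" where
  "spin_rep d S3 Sp Sm \<longleftrightarrow>
     S3 \<in> carrier_mat (d + 1) (d + 1) \<and>
     Sp \<in> carrier_mat (d + 1) (d + 1) \<and>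
     Sm \<in> carrier_mat (d + 1) (d + 1) \<and>
     Sp * Sm - Sm * Sp = 2 \<cdot>\<^sub>m S3 \<and>
     S3 * Sp - Sp * S3 = Sp \<and>
     S3 * Sm - Sm * S3 = - Sm \<and>
     (\<forall>W. VectorSpace.subspace class_ring W (module_vec TYPE(complex) (d + 1)) \<longrightarrow>
        invariant_under S3 W \<longrightarrow> invariant_under Sp W \<longrightarrow> invariant_under Sm W \<longrightarrow>
        W = {0\<^sub>v (d + 1)} \<or> W = carrier_vec (d + 1))"

subsection \<open>Operators on the tensor product\<close>

definition kron :: "complex mat \<Rightarrow> complex mat \<Rightarrow> complex mat" where
  "kron A B = mat (dim_row A * dim_row B) (dim_col A * dim_col B)
     (\<lambda>(i, j). A $$ (i div dim_row B, j div dim_col B) * B $$ (i mod dim_row B, j mod dim_col B))"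

text \<open>The sites are \<open>1, \<dots>, N\<close>, and \<open>d i = 2s\<^sub>i\<close>.\<close>

definition chain_dim :: "nat \<Rightarrow> (nat \<Rightarrow> nat) \<Rightarrow> nat" where
  "chain_dim N d = (\<Prod>i = 1..N. d i + 1)"

definition at_site :: "nat \<Rightarrow> (nat \<Rightarrow> nat) \<Rightarrow> nat \<Rightarrow> complex mat \<Rightarrow> complex mat" where
  "at_site N d i A =
     kron (1\<^sub>m (\<Prod>j = 1..<i. d j + 1)) (kron A (1\<^sub>m (\<Prod>j = i + 1..N. d j + 1)))"

text \<open>Product of operators in the order of the list.  It is applied to the modified
  operators at various points, which commute, so any enumeration of a set of points
  gives the product over that set.\<close>

definition op_prod :: "nat \<Rightarrow> ('a \<Rightarrow> complex mat) \<Rightarrow> 'a list \<Rightarrow> complex mat" where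
  "op_prod D f xs = foldr (\<lambda>x A. f x * A) xs (1\<^sub>m D)"

definition op_sum :: "nat \<Rightarrow> ('a \<Rightarrow> complex mat) \<Rightarrow> 'a set \<Rightarrow> complex mat" where
  "op_sum D f X = finsum (module_mat TYPE(complex) D D) f X"

subsection \<open>Lax operator and monodromy matrix\<close>

text \<open>A \<open>2 \<times> 2\<close> matrix with operator entries is a function of the two auxiliary
  indices, of which only the values 1 and 2 are meaningful.\<close>

type_synonym aux_mat = "nat \<Rightarrow> nat \<Rightarrow> complex mat"

definition lax ::
  "complex \<Rightarrow> nat \<Rightarrow> (nat \<Rightarrow> nat) \<Rightarrow> (nat \<Rightarrow> complex mat) \<Rightarrow> (nat \<Rightarrow> complex mat) \<Rightarrow>
   (nat \<Rightarrow> complex mat) \<Rightarrow> nat \<Rightarrow> complex \<Rightarrow> aux_mat" where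
  "lax c N d S3 Sp Sm i u a b =
     (let I = 1\<^sub>m (chain_dim N d) in
      if a = 1 \<and> b = 1 then (u / c + 1 / 2) \<cdot>\<^sub>m I + at_site N d i (S3 i)
      else if a = 1 \<and> b = 2 then at_site N d i (Sm i)
      else if a = 2 \<and> b = 1 then at_site N d i (Sp i)
      else (u / c + 1 / 2) \<cdot>\<^sub>m I - at_site N d i (S3 i))"

definition aux_one :: "nat \<Rightarrow> aux_mat" where
  "aux_one D a b = (if a = b then 1\<^sub>m D else 0\<^sub>m D D)"

definition aux_mult :: "aux_mat \<Rightarrow> aux_mat \<Rightarrow> aux_mat" where
  "aux_mult A B a b = A a 1 * B 1 b + A a 2 * B 2 b"

definition monodromy ::
  "complex \<Rightarrow> nat \<Rightarrow> (nat \<Rightarrow> nat) \<Rightarrow> (nat \<Rightarrow> complex) \<Rightarrow> (nat \<Rightarrow> complex mat) \<Rightarrow>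
   (nat \<Rightarrow> complex mat) \<Rightarrow> (nat \<Rightarrow> complex mat) \<Rightarrow> complex \<Rightarrow> aux_mat" where
  "monodromy c N d \<theta> S3 Sp Sm u =
     foldr (\<lambda>i. aux_mult (lax c N d S3 Sp Sm i (u - \<theta> i))) [1..<N + 1] (aux_one (chain_dim N d))"

subsection \<open>Modified operators\<close>

definition twist_mu :: "complex \<Rightarrow> complex \<Rightarrow> complex \<Rightarrow> complex \<Rightarrow> complex" where
  "twist_mu \<rho>1 \<rho>2 \<kappa>p \<kappa>m = inverse (1 - \<rho>1 * \<rho>2 / (\<kappa>p * \<kappa>m))"

definition nu12 ::
  "complex \<Rightarrow> complex \<Rightarrow> complex \<Rightarrow> complex \<Rightarrow> (complex \<Rightarrow> aux_mat) \<Rightarrow> complex \<Rightarrow> complex mat" where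
  "nu12 \<rho>1 \<rho>2 \<kappa>p \<kappa>m t z = twist_mu \<rho>1 \<rho>2 \<kappa>p \<kappa>m \<cdot>\<^sub>m
     (t z 1 2 + (\<rho>1 / \<kappa>m) \<cdot>\<^sub>m t z 1 1 + (\<rho>2 / \<kappa>m) \<cdot>\<^sub>m t z 2 2 + (\<rho>1 * \<rho>2 / \<kappa>m\<^sup>2) \<cdot>\<^sub>m t z 2 1)"

definition nu21 ::
  "complex \<Rightarrow> complex \<Rightarrow> complex \<Rightarrow> complex \<Rightarrow> (complex \<Rightarrow> aux_mat) \<Rightarrow> complex \<Rightarrow> complex mat" where
  "nu21 \<rho>1 \<rho>2 \<kappa>p \<kappa>m t z = twist_mu \<rho>1 \<rho>2 \<kappa>p \<kappa>m \<cdot>\<^sub>m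
     (t z 2 1 + (\<rho>1 / \<kappa>p) \<cdot>\<^sub>m t z 1 1 + (\<rho>2 / \<kappa>p) \<cdot>\<^sub>m t z 2 2 + (\<rho>1 * \<rho>2 / \<kappa>p\<^sup>2) \<cdot>\<^sub>m t z 1 2)"

subsection \<open>Scalar functions\<close>

definition g :: "complex \<Rightarrow> complex \<Rightarrow> complex \<Rightarrow> complex" where
  "g c u v = c / (u - v)"

definition F :: "complex \<Rightarrow> nat \<Rightarrow> (nat \<Rightarrow> nat) \<Rightarrow> (nat \<Rightarrow> complex) \<Rightarrow> complex \<Rightarrow> complex" where
  "F c N d \<theta> z =
     (\<Prod>i = 1..N. \<Prod>k = 0..d i. (z - \<theta> i + c * (of_nat (d i) / 2 - of_nat k + 1 / 2)) / c)"

end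

theory Submission
  imports Defs "Jordan_Normal_Form.Spectral_Radius"
begin

text \<open>
  Each \<open>\<nu>(x)\<close> is, up to the factor \<open>\<mu>\<close>, of the form \<open>B(x) = a T(x) b\<close> with a row vector \<open>a\<close> and a
  column vector \<open>b\<close> that do not depend on \<open>x\<close>.  If \<open>\<delta> = a \<cdot> b \<noteq> 0\<close>, then \<open>B(x)\<close> is \<open>\<delta>\<close> times the entry
  \<open>t\<^sub>1\<^sub>1(x)\<close> of \<open>G T(x) G\<^sup>-\<^sup>1\<close> for a suitable \<open>G\<close>, and this is the monodromy matrix of rotated
  spin operators, which again form irreducible representations.  So it suffices to treat \<open>t\<^sub>1\<^sub>1\<close>.

  In the weight basis \<open>t\<^sub>1\<^sub>1(x)\<close> is triangular, and its diagonal entries \<open>p(x)\<close> are products of one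
  factor of \<open>F(x)\<close> for each site.  Hence \<open>F/p\<close> is a polynomial of degree \<open>S\<close> with known leading
  coefficient, and Lagrange interpolation in the \<open>S + 1\<close> points \<open>z, u\<^sub>1, \<dots>, u\<^sub>S\<close> gives the relation on
  the diagonal.  The difference of the two sides is therefore strictly triangular, and by the RTT
  relation it commutes with all \<open>t\<^sub>1\<^sub>1(x)\<close>.  For generic \<open>\<theta>\<close> the functions \<open>p\<close> are pairwise distinct,
  and this forces the difference to vanish.

  Both sides are polynomial in \<open>\<theta>\<close> and \<open>b\<close>, so the genericity of \<open>\<theta>\<close> and the condition \<open>\<delta> \<noteq> 0\<close>
  can be removed by a perturbation.
\<close>

subsection \<open>Operators\<close>

text \<open>Up to normalisation \<open>\<delta>\<close> is \<open>\<rho>1 + \<rho>2\<close>, which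
  may vanish; then no rotation turns \<open>B\<close> into a multiple of an entry
  \<open>1 1\<close>, and \<open>b\<close> has to be moved. Special \<open>\<theta>\<close> are an
  obstacle of another kind: different weights may give the same function \<open>p\<close>, and
  commuting with every \<open>t11\<close> no longer isolates single blocks. What the chain argument
  takes from irreducibility is the identity
  \<open>(S3 - d/2) * (S3 - (d/2 - 1)) * ... * (S3 + d/2) = 0\<close> at each site, from which
  projections onto joint eigenspaces are built. No weight basis is chosen, so the argument applies
  unchanged to the rotated triple. The order for triangularity cannot be the total weight: in every
  path of \<open>t11\<close> the lowering and raising steps balance. Weighting a site by its
  position breaks this balance. Matrices of a fixed size satisfy the ring laws only under carrier
  conditions. All algebra is therefore done in one ring type, the linear maps on complex sequences,
  into which the matrices of size \<open>D > 0\<close> embed injectively; only the last step returns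
  to matrices.\<close>

typedef operator = "{f :: (nat \<Rightarrow> complex) \<Rightarrow> nat \<Rightarrow> complex.
    \<forall>x y a. f (\<lambda>n. x n + a * y n) = (\<lambda>n. f x n + a * f y n)}"
  morphisms app Operator
  by (rule exI[of _ "\<lambda>x. x"]) simp

setup_lifting type_definition_operator

lemma app_lin: "app A (\<lambda>n. x n + a * y n) = (\<lambda>n. app A x n + a * app A y n)"
  using app[of A] by blast

lemma app_zero: "app A (\<lambda>n. 0) = (\<lambda>n. 0)"
  using app_lin[of A "\<lambda>n. 0" "-1" "\<lambda>n. 0"] by (simp add: fun_eq_iff)

lemma app_add: "app A (\<lambda>n. x n + y n) = (\<lambda>n. app A x n + app A y n)"
  using app_lin[of A x 1 y] by simp

lemma app_scale: "app A (\<lambda>n. a * y n) = (\<lambda>n. a * app A y n)"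
  using app_lin[of A "\<lambda>n. 0" a y] by (simp add: app_zero)

instantiation operator :: ring_1
begin

lift_definition zero_operator :: operator is "\<lambda>x n. 0" by simp
lift_definition one_operator :: operator is "\<lambda>x. x" by simp
lift_definition plus_operator :: "operator \<Rightarrow> operator \<Rightarrow> operator"
  is "\<lambda>f h x n. f x n + h x n" by (simp add: algebra_simps)
lift_definition uminus_operator :: "operator \<Rightarrow> operator"
  is "\<lambda>f x n. - f x n" by simp
lift_definition minus_operator :: "operator \<Rightarrow> operator \<Rightarrow> operator"
  is "\<lambda>f h x n. f x n - h x n" by (simp add: algebra_simps)
lift_definition times_operator :: "operator \<Rightarrow> operator \<Rightarrow> operator"
  is "\<lambda>f h x. f (h x)" by simp

instance
proof
  show "(0 :: operator) \<noteq> 1"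
    by transfer (auto simp: fun_eq_iff intro!: exI[of _ "\<lambda>n. 1"])
  fix a b c :: operator
  show "a * b * c = a * (b * c)" "1 * a = a" "a * 1 = a" "a + b + c = a + (b + c)"
    "a + b = b + a" "0 + a = a" "- a + a = 0" "a - b = a + - b" "(a + b) * c = a * c + b * c"
    by (transfer; simp add: fun_eq_iff)+
  \<comment> \<open>This axiom uses that \<open>a\<close> is linear, hence the detour through
    \<open>app_add\<close>; the axioms above hold for arbitrary functions.\<close>
  show "a * (b + c) = a * b + a * c"
    by (rule app_inject[THEN iffD1])
      (simp add: times_operator.rep_eq plus_operator.rep_eq app_add fun_eq_iff)
qed

end

lift_definition scl :: "complex \<Rightarrow> operator \<Rightarrow> operator" (infixr "*\<^sub>C" 75)
  is "\<lambda>a f x n. a * f x n" by (simp add: algebra_simps)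

lemma scl_simps [simp]:
  "a *\<^sub>C b *\<^sub>C A = (a * b) *\<^sub>C A" "1 *\<^sub>C A = A" "0 *\<^sub>C A = 0" "a *\<^sub>C 0 = 0"
  "(a *\<^sub>C A) * B = a *\<^sub>C (A * B)"
  by (transfer; simp add: fun_eq_iff)+

lemma mult_scl [simp]: "A * (a *\<^sub>C B) = a *\<^sub>C (A * B)"
  by (rule app_inject[THEN iffD1]) (simp add: times_operator.rep_eq scl.rep_eq app_scale fun_eq_iff)

lemma scl_add_right: "a *\<^sub>C (A + B) = a *\<^sub>C A + a *\<^sub>C B"
  and scl_diff_right: "a *\<^sub>C (A - B) = a *\<^sub>C A - a *\<^sub>C B"
  and scl_add_left: "(a + b) *\<^sub>C A = a *\<^sub>C A + b *\<^sub>C A"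
  and scl_diff_left: "(a - b) *\<^sub>C A = a *\<^sub>C A - b *\<^sub>C A"
  and scl_minus_left: "(- a) *\<^sub>C A = - (a *\<^sub>C A)"
  and scl_minus_right: "a *\<^sub>C (- A) = - (a *\<^sub>C A)"
  by (transfer; simp add: fun_eq_iff algebra_simps)+

lemmas scl_distribs = scl_add_right scl_diff_right scl_add_left scl_diff_left
  scl_minus_left scl_minus_right

lemma scl_sum_right: "a *\<^sub>C (\<Sum>i\<in>I. X i) = (\<Sum>i\<in>I. a *\<^sub>C X i)"
  by (induction I rule: infinite_finite_induct) (simp_all add: scl_add_right)

lemma scl_sum_left: "(\<Sum>i\<in>I. a i) *\<^sub>C X = (\<Sum>i\<in>I. a i *\<^sub>C X)"
  by (induction I rule: infinite_finite_induct) (simp_all add: scl_add_left)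

lemma scl_eq_0_iff: "a *\<^sub>C A = 0 \<longleftrightarrow> a = 0 \<or> A = 0"
proof
  assume "a *\<^sub>C A = 0"
  then have "inverse a *\<^sub>C a *\<^sub>C A = 0" by simp
  then show "a = 0 \<or> A = 0" by (cases "a = 0") auto
qed auto

lemma prod_list_scl:
  "prod_list (map (\<lambda>x. a *\<^sub>C f x) xs) = a ^ length xs *\<^sub>C prod_list (map f xs)"
  by (induction xs) (simp_all add: mult.commute)

lemma prod_list_commute:
  fixes f :: "'b \<Rightarrow> 'a :: monoid_mult"
  assumes "\<And>x. x \<in> set xs \<Longrightarrow> A * f x = f x * A"
  shows "A * prod_list (map f xs) = prod_list (map f xs) * A"
  using assms
proof (induction xs)
  case (Cons x xs)
  have "A * (f x * prod_list (map f xs)) = f x * (A * prod_list (map f xs))"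
    using Cons.prems[of x] by (simp flip: mult.assoc)
  then show ?case using Cons by (simp add: mult.assoc)
qed simp

subsection \<open>Embedding matrices\<close>

text \<open>The space of all sequences is cut into consecutive blocks of length \<open>D\<close>, and the
  matrix acts on every block; in this way the unit matrix becomes the unit.\<close>

lift_definition emb :: "nat \<Rightarrow> complex mat \<Rightarrow> operator"
  is "\<lambda>D A x n. \<Sum>j<D. A $$ (n mod D, j) * x (n div D * D + j)"
  by (simp add: fun_eq_iff algebra_simps sum.distrib sum_distrib_left)

lemma emb_add:
  assumes "A \<in> carrier_mat D D" "B \<in> carrier_mat D D" "D > 0"
  shows "emb D (A + B) = emb D A + emb D B"
  using assms by (transfer; simp add: fun_eq_iff distrib_right sum.distrib)

lemma emb_smult:
  assumes "A \<in> carrier_mat D D" "D > 0"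
  shows "emb D (a \<cdot>\<^sub>m A) = a *\<^sub>C emb D A"
  using assms by (transfer; simp add: fun_eq_iff sum_distrib_left mult.assoc)

lemma emb_minus:
  assumes "A \<in> carrier_mat D D" "B \<in> carrier_mat D D" "D > 0"
  shows "emb D (A - B) = emb D A - emb D B"
  using assms by (transfer; simp add: fun_eq_iff left_diff_distrib sum_subtractf)

lemma emb_uminus:
  assumes "A \<in> carrier_mat D D" "D > 0"
  shows "emb D (- A) = - emb D A"
  using assms by (transfer; simp add: fun_eq_iff sum_negf)

lemma emb_zero: "D > 0 \<Longrightarrow> emb D (0\<^sub>m D D) = 0"
  by (transfer; simp add: fun_eq_iff)

lemma emb_one:
  assumes "D > 0"
  shows "emb D (1\<^sub>m D) = 1"
proof -
  have "(\<Sum>j<D. 1\<^sub>m D $$ (n mod D, j) * x (n div D * D + j)) = x n" for x :: "nat \<Rightarrow> complex" and n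
  proof -
    have "(\<Sum>j<D. 1\<^sub>m D $$ (n mod D, j) * x (n div D * D + j))
        = (\<Sum>j<D. if j = n mod D then x (n div D * D + j) else 0)"
      using assms by (intro sum.cong) auto
    then show ?thesis using assms by (simp)
  qed
  then show ?thesis using assms by (transfer; simp add: fun_eq_iff)
qed

lemma emb_mult:
  assumes "A \<in> carrier_mat D D" "B \<in> carrier_mat D D" "D > 0"
  shows "emb D (A * B) = emb D A * emb D B"
proof -
  have "(\<Sum>j<D. (A * B) $$ (n mod D, j) * x (n div D * D + j)) =
      (\<Sum>j<D. A $$ (n mod D, j) *
        (\<Sum>k<D. B $$ ((n div D * D + j) mod D, k) * x ((n div D * D + j) div D * D + k)))"
    for x :: "nat \<Rightarrow> complex" and n
  proof -
    have "(A * B) $$ (n mod D, j) = (\<Sum>k<D. A $$ (n mod D, k) * B $$ (k, j))" if "j < D" for j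
      using assms that by (simp add: scalar_prod_def atLeast0LessThan)
    then have "(\<Sum>j<D. (A * B) $$ (n mod D, j) * x (n div D * D + j)) =
        (\<Sum>j<D. \<Sum>k<D. A $$ (n mod D, k) * B $$ (k, j) * x (n div D * D + j))"
      by (simp add: sum_distrib_right)
    also have "\<dots> = (\<Sum>k<D. \<Sum>j<D. A $$ (n mod D, k) * B $$ (k, j) * x (n div D * D + j))"
      by (rule sum.swap)
    finally show ?thesis by (simp add: sum_distrib_left mult.assoc)
  qed
  then show ?thesis by (transfer; simp add: fun_eq_iff)
qed

text \<open>Applied to the sequence that is 1 at position \<open>j\<close> and 0 elsewhere, the
  operator returns column \<open>j\<close> of the matrix in the first block. This is what carries
  operator identities back to matrices.\<close>

lemma emb_inject:
  assumes A: "A \<in> carrier_mat D D" and B: "B \<in> carrier_mat D D" and eq: "emb D A = emb D B"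
  shows "A = B"
proof (rule eq_matI)
  fix i j assume "i < dim_row B" "j < dim_col B"
  then have ij: "i < D" "j < D" using B by auto
  have entry: "app (emb D C) (\<lambda>n. if n = j then 1 else 0) i = C $$ (i, j)" for C
  proof -
    have "(\<Sum>k<D. C $$ (i, k) * (if k = j then 1 else 0)) = (\<Sum>k<D. if k = j then C $$ (i, k) else 0)"
      by (intro sum.cong) auto
    then show ?thesis using ij by (simp add: emb.rep_eq)
  qed
  show "A $$ (i, j) = B $$ (i, j)" using entry[of A] entry[of B] eq by simp
qed (use A B in auto)

lemma op_prod_carrier:
  assumes "\<And>x. x \<in> set xs \<Longrightarrow> f x \<in> carrier_mat D D"
  shows "op_prod D f xs \<in> carrier_mat D D"
  using assms by (induction xs) (auto simp: op_prod_def intro!: mult_carrier_mat)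

lemma emb_op_prod:
  assumes "D > 0" "\<And>x. x \<in> set xs \<Longrightarrow> f x \<in> carrier_mat D D"
  shows "emb D (op_prod D f xs) = prod_list (map (\<lambda>x. emb D (f x)) xs)"
  using assms(2)
proof (induction xs)
  case (Cons x xs)
  have "op_prod D f (x # xs) = f x * op_prod D f xs" by (simp add: op_prod_def)
  then show ?case using Cons op_prod_carrier[of xs f D] assms(1) by (simp add: emb_mult)
qed (simp add: op_prod_def emb_one assms(1))

lemma op_sum_carrier_emb:
  assumes "D > 0" "finite X" "\<And>x. x \<in> X \<Longrightarrow> f x \<in> carrier_mat D D"
  shows "op_sum D f X \<in> carrier_mat D D \<and> emb D (op_sum D f X) = (\<Sum>x\<in>X. emb D (f x))"
  using assms(2,3)
proof (induction X)
  case empty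
  interpret abelian_group "module_mat TYPE(complex) D D" by (rule abelian_group_mat)
  show ?case using assms(1) by (simp add: op_sum_def finsum_empty) (simp add: module_mat_simps emb_zero)
next
  case (insert x X)
  interpret abelian_group "module_mat TYPE(complex) D D" by (rule abelian_group_mat)
  have "op_sum D f (insert x X) = f x + op_sum D f X"
    unfolding op_sum_def using insert
    by (subst finsum_insert) (auto simp: module_mat_simps)
  then show ?case using insert assms(1) by (simp add: emb_add)
qed

subsection \<open>Kronecker products\<close>

lemma kron_carrier [intro, simp]:
  "A \<in> carrier_mat m n \<Longrightarrow> B \<in> carrier_mat p q \<Longrightarrow> kron A B \<in> carrier_mat (m * p) (n * q)"
  by (auto simp: kron_def)

lemma kron_index:
  "A \<in> carrier_mat m n \<Longrightarrow> B \<in> carrier_mat p q \<Longrightarrow> i < m * p \<Longrightarrow> j < n * q \<Longrightarrow>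
    kron A B $$ (i, j) = A $$ (i div p, j div q) * B $$ (i mod p, j mod q)"
  by (auto simp: kron_def)

lemma div_mod_less:
  fixes i m p :: nat
  assumes "i < m * p"
  shows "i div p < m" "i mod p < p"
proof -
  have "p > 0" using assms by (cases p) auto
  then show "i div p < m" "i mod p < p" using assms by (auto simp: less_mult_imp_div_less)
qed

text \<open>Splits a Kronecker index into its two digits; in \<open>kron_mult\<close> the inner sum
  of the matrix product thereby becomes a double sum that factors.\<close>

lemma sum_lessThan_mult:
  fixes f :: "nat \<Rightarrow> nat \<Rightarrow> 'a :: comm_monoid_add"
  shows "(\<Sum>k<m * n. f (k div n) (k mod n)) = (\<Sum>i<m. \<Sum>j<n. f i j)"
proof (cases "n = 0")
  case False
  have "(\<Sum>k<m * n. f (k div n) (k mod n)) = (\<Sum>(i, j)\<in>{..<m} \<times> {..<n}. f i j)"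
  proof (rule sum.reindex_bij_witness[where i = "\<lambda>(i, j). i * n + j" and j = "\<lambda>k. (k div n, k mod n)"])
    fix x assume "x \<in> {..<m} \<times> {..<n}"
    then obtain i j where x: "x = (i, j)" "i < m" "j < n" by auto
    have "i * n + j < (i + 1) * n" using x by simp
    also have "\<dots> \<le> m * n" using x by (intro mult_right_mono) auto
    finally show "(case x of (i, j) \<Rightarrow> i * n + j) \<in> {..<m * n}" using x by simp
  qed (use False in \<open>auto simp: div_mod_less\<close>)
  then show ?thesis by (simp add: sum.cartesian_product)
qed simp

lemma kron_mult:
  assumes A: "A \<in> carrier_mat m n" and A': "A' \<in> carrier_mat n l"
    and B: "B \<in> carrier_mat p q" and B': "B' \<in> carrier_mat q r"
  shows "kron A B * kron A' B' = kron (A * A') (B * B')"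
proof (rule eq_matI)
  have AA: "A * A' \<in> carrier_mat m l" and BB: "B * B' \<in> carrier_mat p r" using assms by auto
  have K: "kron (A * A') (B * B') \<in> carrier_mat (m * p) (l * r)"
    using AA BB by (rule kron_carrier)
  have K1: "kron A B \<in> carrier_mat (m * p) (n * q)" using A B by (rule kron_carrier)
  have K2: "kron A' B' \<in> carrier_mat (n * q) (l * r)" using A' B' by (rule kron_carrier)
  fix i j assume "i < dim_row (kron (A * A') (B * B'))" "j < dim_col (kron (A * A') (B * B'))"
  then have ij: "i < m * p" "j < l * r" using K by auto
  note i = div_mod_less[OF ij(1)] and j = div_mod_less[OF ij(2)]
  have "(kron A B * kron A' B') $$ (i, j) =
      (\<Sum>k<n * q. kron A B $$ (i, k) * kron A' B' $$ (k, j))"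
    using K1 K2 ij by (simp add: scalar_prod_def atLeast0LessThan)
  also have "\<dots> = (\<Sum>k<n * q. A $$ (i div p, k div q) * B $$ (i mod p, k mod q) *
      (A' $$ (k div q, j div r) * B' $$ (k mod q, j mod r)))"
    using ij by (intro sum.cong) (simp_all add: kron_index[OF A B] kron_index[OF A' B'])
  also have "\<dots> = (\<Sum>a<n. \<Sum>b<q. A $$ (i div p, a) * B $$ (i mod p, b) *
      (A' $$ (a, j div r) * B' $$ (b, j mod r)))"
    by (rule sum_lessThan_mult)
  also have "\<dots> = (\<Sum>a<n. A $$ (i div p, a) * A' $$ (a, j div r)) *
      (\<Sum>b<q. B $$ (i mod p, b) * B' $$ (b, j mod r))"
    by (simp add: sum_product mult_ac)
  also have "\<dots> = (A * A') $$ (i div p, j div r) * (B * B') $$ (i mod p, j mod r)"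
    using A A' B B' i j by (simp add: scalar_prod_def atLeast0LessThan)
  also have "\<dots> = kron (A * A') (B * B') $$ (i, j)"
    by (rule kron_index[OF AA BB ij, symmetric])
  finally show "(kron A B * kron A' B') $$ (i, j) = kron (A * A') (B * B') $$ (i, j)" .
qed (use assms in \<open>auto simp: kron_def\<close>)

lemma kron_assoc:
  assumes A: "A \<in> carrier_mat m n" and B: "B \<in> carrier_mat p q" and C: "C \<in> carrier_mat r s"
  shows "kron (kron A B) C = kron A (kron B C)"
proof (rule eq_matI)
  have AB: "kron A B \<in> carrier_mat (m * p) (n * q)" using A B by (rule kron_carrier)
  have BC: "kron B C \<in> carrier_mat (p * r) (q * s)" using B C by (rule kron_carrier)
  have K: "kron A (kron B C) \<in> carrier_mat (m * (p * r)) (n * (q * s))"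
    using A BC by (rule kron_carrier)
  fix i j assume "i < dim_row (kron A (kron B C))" "j < dim_col (kron A (kron B C))"
  then have ij: "i < m * (p * r)" "j < n * (q * s)" using K by auto
  then have ij': "i < m * p * r" "j < n * q * s" by (simp_all add: mult.assoc)
  note d = div_mod_less[OF ij(1)] div_mod_less[OF ij(2)]
    div_mod_less[OF ij'(1)] div_mod_less[OF ij'(2)]
  have split: "i div r div p = i div (p * r)" "i mod (p * r) div r = i div r mod p"
      "i mod (p * r) mod r = i mod r" for i p r :: nat
    by (simp_all add: div_mult2_eq[symmetric] mod_mult2_eq mult.commute[of p r] mod_mod_cancel)
      (cases "r = 0"; simp)
  show "kron (kron A B) C $$ (i, j) = kron A (kron B C) $$ (i, j)"
    using d unfolding kron_index[OF AB C ij'] kron_index[OF A BC ij]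
    by (simp add: kron_index[OF A B] kron_index[OF B C] split)
qed (use assms in \<open>auto simp: kron_def\<close>)

lemma kron_one: "kron (1\<^sub>m m) (1\<^sub>m n) = 1\<^sub>m (m * n)"
proof (rule eq_matI)
  fix i j assume "i < dim_row (1\<^sub>m (m * n))" "j < dim_col (1\<^sub>m (m * n))"
  then have ij: "i < m * n" "j < m * n" by auto
  note d = div_mod_less[OF ij(1)] div_mod_less[OF ij(2)]
  have "i = j \<longleftrightarrow> i div n = j div n \<and> i mod n = j mod n"
    by (metis div_mult_mod_eq)
  then show "kron (1\<^sub>m m) (1\<^sub>m n) $$ (i, j) = 1\<^sub>m (m * n) $$ (i, j)"
    using d ij by (auto simp: kron_index[of _ m m _ n n])
qed (auto simp: kron_def)

lemma kron_add_left:
  assumes "A \<in> carrier_mat m n" "A' \<in> carrier_mat m n" "B \<in> carrier_mat p q"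
  shows "kron (A + A') B = kron A B + kron A' B"
  using assms by (intro eq_matI) (auto simp: kron_def div_mod_less algebra_simps)

lemma kron_add_right:
  assumes "A \<in> carrier_mat m n" "B \<in> carrier_mat p q" "B' \<in> carrier_mat p q"
  shows "kron A (B + B') = kron A B + kron A B'"
  using assms by (intro eq_matI) (auto simp: kron_def div_mod_less(2)[of _ m p] div_mod_less(2)[of _ n q] algebra_simps)

lemma kron_smult:
  assumes "A \<in> carrier_mat m n" "B \<in> carrier_mat p q"
  shows "kron (a \<cdot>\<^sub>m A) B = a \<cdot>\<^sub>m kron A B" "kron A (a \<cdot>\<^sub>m B) = a \<cdot>\<^sub>m kron A B"
  using assms by (auto intro!: eq_matI simp: kron_def div_mod_less(1) div_mod_less(2)[of _ m p] div_mod_less(2)[of _ n q])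

section \<open>Site matrices inside the tensor product\<close>

lemma chain_dim_split:
  assumes "i \<in> {1..N}"
  shows "(\<Prod>j = 1..<i. d j + 1) * ((d i + 1) * (\<Prod>j = i + 1..N. d j + 1)) = chain_dim N d"
proof -
  have "{1..N} = {1..<i} \<union> ({i} \<union> {i + 1..N})" using assms by auto
  then have "chain_dim N d = (\<Prod>j\<in>{1..<i} \<union> ({i} \<union> {i + 1..N}). d j + 1)"
    by (simp add: chain_dim_def)
  also have "\<dots> = (\<Prod>j = 1..<i. d j + 1) * (\<Prod>j\<in>{i} \<union> {i + 1..N}. d j + 1)"
    by (rule prod.union_disjoint) auto
  also have "(\<Prod>j\<in>{i} \<union> {i + 1..N}. d j + 1) = (d i + 1) * (\<Prod>j = i + 1..N. d j + 1)"
    by (subst prod.union_disjoint) auto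
  finally show ?thesis by simp
qed

lemma chain_dim_pos: "chain_dim N d > 0"
  by (simp add: chain_dim_def)

lemma at_site_carrier:
  assumes "i \<in> {1..N}" "A \<in> carrier_mat (d i + 1) (d i + 1)"
  shows "at_site N d i A \<in> carrier_mat (chain_dim N d) (chain_dim N d)"
  unfolding at_site_def chain_dim_split[OF assms(1), of d, symmetric]
  by (intro kron_carrier assms(2) one_carrier_mat)

lemma at_site_mult:
  assumes "i \<in> {1..N}" "A \<in> carrier_mat (d i + 1) (d i + 1)" "B \<in> carrier_mat (d i + 1) (d i + 1)"
  shows "at_site N d i (A * B) = at_site N d i A * at_site N d i B"
  unfolding at_site_def using assms
  by (simp add: kron_mult[OF one_carrier_mat one_carrier_mat kron_carrier[OF _ one_carrier_mat] kron_carrier[OF _ one_carrier_mat]]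
      kron_mult[OF _ _ one_carrier_mat one_carrier_mat])

lemma at_site_add:
  assumes "A \<in> carrier_mat (d i + 1) (d i + 1)" "B \<in> carrier_mat (d i + 1) (d i + 1)"
  shows "at_site N d i (A + B) = at_site N d i A + at_site N d i B"
  unfolding at_site_def using assms
  by (simp add: kron_add_left[OF _ _ one_carrier_mat] kron_add_right[OF one_carrier_mat kron_carrier[OF _ one_carrier_mat] kron_carrier[OF _ one_carrier_mat]])

lemma at_site_smult:
  assumes "A \<in> carrier_mat (d i + 1) (d i + 1)"
  shows "at_site N d i (a \<cdot>\<^sub>m A) = a \<cdot>\<^sub>m at_site N d i A"
  unfolding at_site_def using assms
  by (simp add: kron_smult(1)[OF _ one_carrier_mat] kron_smult(2)[OF one_carrier_mat kron_carrier[OF _ one_carrier_mat]])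

lemma at_site_one:
  assumes "i \<in> {1..N}"
  shows "at_site N d i (1\<^sub>m (d i + 1)) = 1\<^sub>m (chain_dim N d)"
  unfolding at_site_def kron_one chain_dim_split[OF assms] ..

text \<open>Both operators are written as five-fold Kronecker products: the sites left of
  \<open>i\<close>, site \<open>i\<close>, the sites between, site \<open>j\<close>, the sites right
  of \<open>j\<close>. The products are then taken factor by factor, and in each factor at least one
  of the two matrices is the unit.\<close>

lemma at_site_commute_less:
  assumes "i \<in> {1..N}" "j \<in> {1..N}" "i < j"
    and A: "A \<in> carrier_mat (d i + 1) (d i + 1)" and B: "B \<in> carrier_mat (d j + 1) (d j + 1)"
  shows "at_site N d i A * at_site N d j B = at_site N d j B * at_site N d i A"
proof -
  define a b e p q where "a = (\<Prod>k = 1..<i. d k + 1)" and "b = (\<Prod>k = i + 1..<j. d k + 1)"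
    and "e = (\<Prod>k = j + 1..N. d k + 1)" and "p = d i + 1" and "q = d j + 1"
  have s1: "(\<Prod>k = i + 1..N. d k + 1) = b * (q * e)"
  proof -
    have "{i + 1..N} = {i + 1..<j} \<union> ({j} \<union> {j + 1..N})" using assms by auto
    then have "(\<Prod>k = i + 1..N. d k + 1) = (\<Prod>k\<in>{i + 1..<j} \<union> ({j} \<union> {j + 1..N}). d k + 1)"
      by simp
    also have "\<dots> = b * (\<Prod>k\<in>{j} \<union> {j + 1..N}. d k + 1)"
      unfolding b_def by (rule prod.union_disjoint) auto
    also have "(\<Prod>k\<in>{j} \<union> {j + 1..N}. d k + 1) = q * e"
      unfolding q_def e_def by (subst prod.union_disjoint) auto
    finally show ?thesis .
  qed
  have s2: "(\<Prod>k = 1..<j. d k + 1) = a * (p * b)"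
  proof -
    have "{1..<j} = {1..<i} \<union> ({i} \<union> {i + 1..<j})" using assms by auto
    then have "(\<Prod>k = 1..<j. d k + 1) = (\<Prod>k\<in>{1..<i} \<union> ({i} \<union> {i + 1..<j}). d k + 1)"
      by simp
    also have "\<dots> = a * (\<Prod>k\<in>{i} \<union> {i + 1..<j}. d k + 1)"
      unfolding a_def by (rule prod.union_disjoint) auto
    also have "(\<Prod>k\<in>{i} \<union> {i + 1..<j}. d k + 1) = p * b"
      unfolding p_def b_def by (subst prod.union_disjoint) auto
    finally show ?thesis .
  qed
  have A': "A \<in> carrier_mat p p" and B': "B \<in> carrier_mat q q" using A B by (auto simp: p_def q_def)
  let ?I = "1\<^sub>m :: nat \<Rightarrow> complex mat"
  have A0: "at_site N d i A = kron (?I a) (kron A (kron (?I b) (kron (?I q) (?I e))))"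
    by (simp only: at_site_def s1 a_def[symmetric] kron_one)
  have "at_site N d j B = kron (kron (?I a) (kron (?I p) (?I b))) (kron B (?I e))"
    by (simp only: at_site_def s2 e_def[symmetric] kron_one)
  also have "\<dots> = kron (?I a) (kron (kron (?I p) (?I b)) (kron B (?I e)))"
    by (rule kron_assoc[OF one_carrier_mat kron_carrier[OF one_carrier_mat one_carrier_mat]
        kron_carrier[OF B' one_carrier_mat]])
  also have "kron (kron (?I p) (?I b)) (kron B (?I e)) = kron (?I p) (kron (?I b) (kron B (?I e)))"
    by (rule kron_assoc[OF one_carrier_mat one_carrier_mat kron_carrier[OF B' one_carrier_mat]])
  finally have B0: "at_site N d j B = kron (?I a) (kron (?I p) (kron (?I b) (kron B (?I e))))" .
  have c1: "kron (?I q) (?I e) \<in> carrier_mat (q * e) (q * e)" "kron B (?I e) \<in> carrier_mat (q * e) (q * e)"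
    using B' by auto
  then have c2: "kron (?I b) (kron (?I q) (?I e)) \<in> carrier_mat (b * (q * e)) (b * (q * e))"
    "kron (?I b) (kron B (?I e)) \<in> carrier_mat (b * (q * e)) (b * (q * e))" by auto
  then have c3: "kron A (kron (?I b) (kron (?I q) (?I e))) \<in> carrier_mat (p * (b * (q * e))) (p * (b * (q * e)))"
    "kron (?I p) (kron (?I b) (kron B (?I e))) \<in> carrier_mat (p * (b * (q * e))) (p * (b * (q * e)))"
    using A' by auto
  note one = one_carrier_mat
  show ?thesis
    unfolding A0 B0
    by (simp only: kron_mult[OF one one c3] kron_mult[OF one one c3(2,1)]
        kron_mult[OF A' one c2] kron_mult[OF one A' c2(2,1)]
        kron_mult[OF one one c1] kron_mult[OF one one c1(2,1)]
        kron_mult[OF one B' one one] kron_mult[OF B' one one one]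
        left_mult_one_mat[OF A'] right_mult_one_mat[OF A']
        left_mult_one_mat[OF B'] right_mult_one_mat[OF B'])
qed

lemma at_site_commute:
  assumes "i \<in> {1..N}" "j \<in> {1..N}" "i \<noteq> j"
    and "A \<in> carrier_mat (d i + 1) (d i + 1)" and "B \<in> carrier_mat (d j + 1) (d j + 1)"
  shows "at_site N d i A * at_site N d j B = at_site N d j B * at_site N d i A"
  using assms at_site_commute_less[of i N j A d B] at_site_commute_less[of j N i B d A]
  by (cases "i < j") auto

subsection \<open>Weights of spin representations\<close>

lemma spin_repD:
  assumes "spin_rep d S3 Sp Sm"
  shows "S3 \<in> carrier_mat (d + 1) (d + 1)" "Sp \<in> carrier_mat (d + 1) (d + 1)"
    "Sm \<in> carrier_mat (d + 1) (d + 1)"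
    "Sp * Sm - Sm * Sp = 2 \<cdot>\<^sub>m S3" "S3 * Sp - Sp * S3 = Sp" "S3 * Sm - Sm * S3 = - Sm"
  using assms by (auto simp: spin_rep_def)

text \<open>The span of the weight vectors will be represented as the range of the matrix that has
  them as columns. Irreducibility can then be applied to the range, and surjectivity yields an
  inverse matrix.\<close>

lemma range_subspace:
  assumes W: "(W :: complex mat) \<in> carrier_mat n n"
  shows "VectorSpace.subspace class_ring ((*\<^sub>v) W ` carrier_vec n) (module_vec TYPE(complex) n)"
proof -
  interpret V: vectorspace "class_ring :: complex ring" "module_vec TYPE(complex) n"
    by (rule vec_vs)
  have "submodule class_ring ((*\<^sub>v) W ` carrier_vec n) (module_vec TYPE(complex) n)"
  proof (unfold_locales, unfold module_vec_simps)
    show "(*\<^sub>v) W ` carrier_vec n \<subseteq> carrier_vec n" using W by auto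
    show "v + w \<in> (*\<^sub>v) W ` carrier_vec n"
      if vw: "v \<in> (*\<^sub>v) W ` carrier_vec n" "w \<in> (*\<^sub>v) W ` carrier_vec n" for v w
    proof -
      obtain x y where "x \<in> carrier_vec n" "y \<in> carrier_vec n" "v = W *\<^sub>v x" "w = W *\<^sub>v y"
        using vw by auto
      then show ?thesis
        using mult_add_distrib_mat_vec[OF W, of x y] by (auto intro!: image_eqI[of _ _ "x + y"])
    qed
    show "0\<^sub>v n \<in> (*\<^sub>v) W ` carrier_vec n"
      using W by (auto intro!: image_eqI[of _ _ "0\<^sub>v n"])
    show "c \<cdot>\<^sub>v v \<in> (*\<^sub>v) W ` carrier_vec n"
      if cv: "v \<in> (*\<^sub>v) W ` carrier_vec n" for c v
    proof -
      obtain x where "x \<in> carrier_vec n" "v = W *\<^sub>v x" using cv by auto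
      then show ?thesis
        using mult_mat_vec[OF W, of x c] by (auto intro!: image_eqI[of _ _ "c \<cdot>\<^sub>v x"])
    qed
  qed
  then show ?thesis by (simp add: VectorSpace.subspace_def V.vectorspace_axioms)
qed

lemma mult_unit_vec_col:
  assumes W: "(W :: complex mat) \<in> carrier_mat m n" and k: "k < n"
  shows "W *\<^sub>v unit_vec n k = col W k"
  using col_mult2[OF W one_carrier_mat k] right_mult_one_mat[OF W] k by simp

text \<open>Preimages of the vectors \<open>X *\<^sub>v col W k\<close> are collected as the columns
  of a matrix \<open>M\<close>; then \<open>X * W = W * M\<close>, and this carries the whole range
  into itself.\<close>

lemma range_invariant:
  assumes X: "X \<in> carrier_mat n n" and W: "W \<in> carrier_mat n n"
    and cols: "\<And>k. k < n \<Longrightarrow> X *\<^sub>v col W k \<in> (*\<^sub>v) W ` carrier_vec n"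
  shows "invariant_under X ((*\<^sub>v) W ` carrier_vec n)"
proof -
  have "\<exists>y. y \<in> carrier_vec n \<and> X *\<^sub>v col W k = W *\<^sub>v y" if "k < n" for k
    using cols[OF that] by auto
  then obtain y where y: "\<And>k. k < n \<Longrightarrow> y k \<in> carrier_vec n"
    "\<And>k. k < n \<Longrightarrow> X *\<^sub>v col W k = W *\<^sub>v y k" by metis
  define M where "M = mat_of_cols n (map y [0..<n])"
  have M: "M \<in> carrier_mat n n" using mat_of_cols_carrier(1)[of n "map y [0..<n]"] by (simp add: M_def)
  have colM: "col M k = y k" if "k < n" for k
    using that y(1)[OF that] by (simp add: M_def)
  have XW: "X * W = W * M"
  proof (rule eq_matI)
    fix i j assume "i < dim_row (W * M)" "j < dim_col (W * M)"
    then have ij: "i < n" "j < n" using W M by auto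
    have "(X * W) $$ (i, j) = col (X * W) j $ i" using ij X W by simp
    also have "col (X * W) j = col (W * M) j"
      using ij by (simp add: col_mult2[OF X W] col_mult2[OF W M] colM y(2))
    also have "col (W * M) j $ i = (W * M) $$ (i, j)" using ij W M by simp
    finally show "(X * W) $$ (i, j) = (W * M) $$ (i, j)" .
  qed (use X W M in auto)
  have "X *\<^sub>v (W *\<^sub>v x) = W *\<^sub>v (M *\<^sub>v x)" if "x \<in> carrier_vec n" for x
    using assoc_mult_mat_vec[OF X W that] assoc_mult_mat_vec[OF W M that] by (simp add: XW)
  then show ?thesis using M by (auto simp: invariant_under_def)
qed

lemma op_prod_eigenvector:
  assumes A: "A \<in> carrier_mat n n" and v: "v \<in> carrier_vec n" and ev: "A *\<^sub>v v = l \<cdot>\<^sub>v v"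
  shows "op_prod n (\<lambda>k. A - m k \<cdot>\<^sub>m 1\<^sub>m n) xs *\<^sub>v v = (\<Prod>k\<leftarrow>xs. l - m k) \<cdot>\<^sub>v v"
proof (induction xs)
  case (Cons k xs)
  have P: "op_prod n (\<lambda>k. A - m k \<cdot>\<^sub>m 1\<^sub>m n) xs \<in> carrier_mat n n"
    using A by (intro op_prod_carrier) auto
  have B: "A - m k \<cdot>\<^sub>m 1\<^sub>m n \<in> carrier_mat n n" using A by auto
  have "(A - m k \<cdot>\<^sub>m 1\<^sub>m n) *\<^sub>v v = l \<cdot>\<^sub>v v - m k \<cdot>\<^sub>v v"
    using A v by (subst minus_mult_distrib_mat_vec[of _ n n]) (auto simp: ev)
  also have "\<dots> = (l - m k) \<cdot>\<^sub>v v" using v by (auto simp: algebra_simps)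
  finally have 1: "(A - m k \<cdot>\<^sub>m 1\<^sub>m n) *\<^sub>v v = (l - m k) \<cdot>\<^sub>v v" .
  have "op_prod n (\<lambda>k. A - m k \<cdot>\<^sub>m 1\<^sub>m n) (k # xs) *\<^sub>v v =
      (A - m k \<cdot>\<^sub>m 1\<^sub>m n) *\<^sub>v (op_prod n (\<lambda>k. A - m k \<cdot>\<^sub>m 1\<^sub>m n) xs *\<^sub>v v)"
    using P B v unfolding op_prod_def by (simp add: assoc_mult_mat_vec[of _ n n])
  also have "\<dots> = (\<Prod>k\<leftarrow>xs. l - m k) \<cdot>\<^sub>v ((l - m k) \<cdot>\<^sub>v v)"
    unfolding Cons.IH using mult_mat_vec[OF B v] 1 by simp
  finally show ?case by (simp add: smult_smult_assoc mult.commute)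
qed (use v in \<open>simp add: op_prod_def\<close>)

text \<open>The columns of \<open>W\<close> are the vectors \<open>Sm\<^sup>k w\<close>, where \<open>w\<close> is a vector of highest weight.
  Their span is invariant, so it is the whole space; in particular \<open>Sm\<^sup>d w \<noteq> 0\<close>, and this
  determines the highest weight.\<close>

lemma spin_rep_weights:
  assumes rep: "spin_rep d S3 Sp Sm"
  shows "op_prod (d + 1) (\<lambda>k. S3 - (of_nat d / 2 - of_nat k) \<cdot>\<^sub>m 1\<^sub>m (d + 1)) [0..<d + 1] =
    0\<^sub>m (d + 1) (d + 1)"
proof -
  define n where "n = d + 1"
  note rep' = spin_repD[OF rep, folded n_def]
  note S3 = rep'(1) and Sp = rep'(2) and Sm = rep'(3)
  have npos: "n > 0" by (simp add: n_def)
  have move: "A *\<^sub>v (B *\<^sub>v v) = B *\<^sub>v (A *\<^sub>v v) + C *\<^sub>v v"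
    if "A * B - B * A = C" "A \<in> carrier_mat n n" "B \<in> carrier_mat n n" "v \<in> carrier_vec n"
    for A B C :: "complex mat" and v
  proof -
    have "C *\<^sub>v v = (A * B) *\<^sub>v v - (B * A) *\<^sub>v v"
      unfolding that(1)[symmetric] using that by (intro minus_mult_distrib_mat_vec[of _ n n]) auto
    also have "\<dots> = A *\<^sub>v (B *\<^sub>v v) - B *\<^sub>v (A *\<^sub>v v)" using that by simp
    finally show ?thesis using that by (auto intro!: eq_vecI)
  qed
  have raise: "S3 *\<^sub>v (Sp *\<^sub>v v) = (l + 1) \<cdot>\<^sub>v (Sp *\<^sub>v v)"
    if "v \<in> carrier_vec n" "S3 *\<^sub>v v = l \<cdot>\<^sub>v v" for v l
    using that move[OF rep'(5) S3 Sp that(1)] mult_mat_vec[OF Sp that(1)] Sp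
    by (simp add: add_smult_distrib_vec)
  have lower: "S3 *\<^sub>v (Sm *\<^sub>v v) = (l - 1) \<cdot>\<^sub>v (Sm *\<^sub>v v)"
    if "v \<in> carrier_vec n" "S3 *\<^sub>v v = l \<cdot>\<^sub>v v" for v l
  proof -
    have "S3 *\<^sub>v (Sm *\<^sub>v v) = l \<cdot>\<^sub>v (Sm *\<^sub>v v) + - (Sm *\<^sub>v v)"
      using that move[OF rep'(6) S3 Sm that(1)] mult_mat_vec[OF Sm that(1)] Sm
      by (simp add: uminus_mult_mat_vec)
    also have "\<dots> = (l - 1) \<cdot>\<^sub>v (Sm *\<^sub>v v)" by (auto simp: algebra_simps)
    finally show ?thesis .
  qed
  have double: "(2 \<cdot>\<^sub>m S3) *\<^sub>v v = (2 * l) \<cdot>\<^sub>v v"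
    if "v \<in> carrier_vec n" "S3 *\<^sub>v v = l \<cdot>\<^sub>v v" for v l
  proof -
    have "(2 \<cdot>\<^sub>m S3) *\<^sub>v v = 2 \<cdot>\<^sub>v (S3 *\<^sub>v v)"
      using S3 that(1) by (intro eq_vecI) (auto simp: smult_scalar_prod_distrib[of _ n])
    then show ?thesis using that by (simp add: smult_smult_assoc)
  qed
  have in_spectrum: "l \<in> spectrum S3"
    if "v \<in> carrier_vec n" "v \<noteq> 0\<^sub>v n" "S3 *\<^sub>v v = l \<cdot>\<^sub>v v" for v l
    using that S3 by (auto simp: spectrum_def eigenvalue_def eigenvector_def)

  \<comment> \<open>Start from any eigenvector of \<open>S3\<close> and apply \<open>Sp\<close>
    repeatedly. The eigenvalue grows by 1 each time and the spectrum is finite, so the vectors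
    eventually vanish; the last nonzero one is \<open>w\<close>.\<close>
  obtain w l where w: "w \<in> carrier_vec n" "w \<noteq> 0\<^sub>v n" "S3 *\<^sub>v w = l \<cdot>\<^sub>v w" "Sp *\<^sub>v w = 0\<^sub>v n"
  proof -
    obtain l0 where "l0 \<in> spectrum S3" using spectrum_non_empty[OF S3 npos] by auto
    then obtain v where v: "v \<in> carrier_vec n" "v \<noteq> 0\<^sub>v n" "S3 *\<^sub>v v = l0 \<cdot>\<^sub>v v"
      using S3 by (auto simp: spectrum_def eigenvalue_def eigenvector_def)
    define q where "q k = ((*\<^sub>v) Sp ^^ k) v" for k
    have q: "q k \<in> carrier_vec n \<and> S3 *\<^sub>v q k = (l0 + of_nat k) \<cdot>\<^sub>v q k" for k
    proof (induction k)
      case (Suc k)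
      have "q (Suc k) = Sp *\<^sub>v q k" by (simp add: q_def)
      then show ?case
        using Suc raise[of "q k" "l0 + of_nat k"] Sp by (simp add: algebra_simps)
    qed (simp add: q_def v)
    have "\<exists>k. q k = 0\<^sub>v n"
    proof (rule ccontr)
      assume "\<nexists>k. q k = 0\<^sub>v n"
      then have "range (\<lambda>k. l0 + of_nat k) \<subseteq> spectrum S3"
        using q in_spectrum by blast
      moreover have "inj (\<lambda>k. l0 + of_nat k :: complex)" by (auto simp: inj_def)
      ultimately show False
        using card_finite_spectrum(1)[OF S3] finite_subset range_inj_infinite by blast
    qed
    then obtain k where k: "q k = 0\<^sub>v n" "\<And>j. j < k \<Longrightarrow> q j \<noteq> 0\<^sub>v n"
      using exists_least_iff[of "\<lambda>k. q k = 0\<^sub>v n"] by blast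
    have "k \<noteq> 0" using k(1) v by (cases "k = 0") (auto simp: q_def)
    then obtain j where j: "k = Suc j" by (cases k) auto
    have "Sp *\<^sub>v q j = 0\<^sub>v n" using k(1) by (simp add: j q_def)
    then show ?thesis using that[of "q j"] q k(2)[of j] j by blast
  qed

  have smult_eq0: "a = 0" if "a \<cdot>\<^sub>v v = 0\<^sub>v n" "v \<in> carrier_vec n" "v \<noteq> 0\<^sub>v n"
    for a :: complex and v
  proof (rule ccontr)
    assume "a \<noteq> 0"
    then have "v = inverse a \<cdot>\<^sub>v (a \<cdot>\<^sub>v v)" by (simp add: smult_smult_assoc)
    moreover have "inverse a \<cdot>\<^sub>v 0\<^sub>v n = 0\<^sub>v n" by auto
    ultimately show False using that by simp
  qed
  define y where "y k = ((*\<^sub>v) Sm ^^ k) w" for k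
  have y_Suc: "y (Suc k) = Sm *\<^sub>v y k" for k by (simp add: y_def)
  have y: "y k \<in> carrier_vec n \<and> S3 *\<^sub>v y k = (l - of_nat k) \<cdot>\<^sub>v y k" for k
  proof (induction k)
    case (Suc k)
    then show ?case
      using lower[of "y k" "l - of_nat k"] Sm by (simp add: y_Suc algebra_simps)
  qed (simp add: y_def w)
  \<comment> \<open>Moving \<open>Sp\<close> through the factors \<open>Sm\<close> leaves one term
    \<open>2 * S3\<close> for each of them, so the coefficient is the sum of
    \<open>2 * (l - j)\<close> over \<open>j \<le> k\<close>.\<close>
  have up: "Sp *\<^sub>v y (Suc k) = (of_nat (k + 1) * (2 * l - of_nat k)) \<cdot>\<^sub>v y k" for k
  proof (induction k)
    case 0
    have "Sp *\<^sub>v (Sm *\<^sub>v w) = Sm *\<^sub>v (Sp *\<^sub>v w) + (2 \<cdot>\<^sub>m S3) *\<^sub>v w"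
      by (rule move[OF rep'(4) Sp Sm w(1)])
    also have "\<dots> = (2 * l) \<cdot>\<^sub>v w"
    proof -
      have "Sm *\<^sub>v 0\<^sub>v n = 0\<^sub>v n" using Sm by auto
      then show ?thesis using w double[OF w(1,3)] by simp
    qed
    finally show ?case by (simp add: y_def)
  next
    case (Suc k)
    have "Sp *\<^sub>v (Sm *\<^sub>v y (Suc k)) = Sm *\<^sub>v (Sp *\<^sub>v y (Suc k)) + (2 \<cdot>\<^sub>m S3) *\<^sub>v y (Suc k)"
      using y by (intro move[OF rep'(4) Sp Sm]) auto
    also have "Sm *\<^sub>v (Sp *\<^sub>v y (Suc k)) = (of_nat (k + 1) * (2 * l - of_nat k)) \<cdot>\<^sub>v y (Suc k)"
      unfolding Suc.IH using mult_mat_vec[OF Sm, of "y k"] y by (simp add: y_Suc)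
    also have "(2 \<cdot>\<^sub>m S3) *\<^sub>v y (Suc k) = (2 * (l - of_nat (Suc k))) \<cdot>\<^sub>v y (Suc k)"
      using y by (intro double) auto
    also have "(of_nat (k + 1) * (2 * l - of_nat k)) \<cdot>\<^sub>v y (Suc k) +
        (2 * (l - of_nat (Suc k))) \<cdot>\<^sub>v y (Suc k) =
        (of_nat (Suc k + 1) * (2 * l - of_nat (Suc k))) \<cdot>\<^sub>v y (Suc k)"
      by (simp add: add_smult_distrib_vec[symmetric], rule arg_cong2[of _ _ _ _ smult_vec])
        (simp_all add: algebra_simps)
    finally show ?case by (simp only: y_Suc[of "Suc k"])
  qed

  \<comment> \<open>Otherwise the \<open>n + 1\<close> vectors \<open>y 0\<close>, ...,
    \<open>y n\<close> would be nonzero eigenvectors for distinct eigenvalues in dimension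
    \<open>n\<close>.\<close>
  have top: "y n = 0\<^sub>v n"
  proof (rule ccontr)
    assume ne: "y n \<noteq> 0\<^sub>v n"
    have "y k \<noteq> 0\<^sub>v n" if "k \<le> n" for k
      using that
    proof (induction rule: inc_induct)
      case (step k)
      then show ?case using Sm by (auto simp: y_Suc)
    qed (rule ne)
    then have "l - of_nat k \<in> spectrum S3" if "k \<le> n" for k
      using that y[of k] in_spectrum[of "y k"] by blast
    then have "(\<lambda>k. l - of_nat k) ` {0..n} \<subseteq> spectrum S3" by auto
    then have "card ((\<lambda>k. l - of_nat k) ` {0..n}) \<le> n"
      using card_finite_spectrum[OF S3] card_mono le_trans by blast
    moreover have "card ((\<lambda>k. l - of_nat k) ` {0..n}) = n + 1"
      by (subst card_image) (auto simp: inj_on_def)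
    ultimately show False by simp
  qed

  define W where "W = mat_of_cols n (map y [0..<n])"
  have W: "W \<in> carrier_mat n n" using mat_of_cols_carrier(1)[of n "map y [0..<n]"] by (simp add: W_def)
  have colW: "col W k = y k" if "k < n" for k
    using that y[of k] by (simp add: W_def)
  let ?R = "(*\<^sub>v) W ` carrier_vec n"
  have yR: "a \<cdot>\<^sub>v y k \<in> ?R" if "k < n" for a k
  proof -
    have "W *\<^sub>v unit_vec n k = y k"
      using that W colW mult_unit_vec_col[OF W] by simp
    then have "a \<cdot>\<^sub>v y k = W *\<^sub>v (a \<cdot>\<^sub>v unit_vec n k)"
      using mult_mat_vec[OF W, of "unit_vec n k" a] by simp
    then show ?thesis by auto
  qed
  have zR: "0\<^sub>v n \<in> ?R" using W by (auto intro!: image_eqI[of _ _ "0\<^sub>v n"])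
  have "invariant_under S3 ?R"
    using S3 W by (rule range_invariant) (auto simp: colW y intro!: yR)
  moreover have "invariant_under Sm ?R"
    using Sm W
  proof (rule range_invariant)
    fix k assume k: "k < n"
    have "y (Suc k) \<in> ?R"
    proof (cases "Suc k < n")
      case True
      then show ?thesis using yR[of "Suc k" 1] by simp
    next
      case False
      then have "Suc k = n" using k by simp
      then show ?thesis using top zR by simp
    qed
    then show "Sm *\<^sub>v col W k \<in> ?R" using k by (simp add: colW y_Suc)
  qed
  moreover have "invariant_under Sp ?R"
    using Sp W
  proof (rule range_invariant)
    fix k assume k: "k < n"
    show "Sp *\<^sub>v col W k \<in> ?R"
    proof (cases k)
      case 0
      then show ?thesis using k w zR by (simp add: colW y_def)
    next
      case (Suc j)
      have "Sp *\<^sub>v y (Suc j) \<in> ?R" unfolding up by (rule yR) (use k Suc in simp)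
      then show ?thesis using k Suc by (simp add: colW)
    qed
  qed
  moreover have "VectorSpace.subspace class_ring ?R (module_vec TYPE(complex) n)"
    by (rule range_subspace[OF W])
  ultimately have "?R = {0\<^sub>v n} \<or> ?R = carrier_vec n"
    using rep unfolding spin_rep_def n_def by blast
  moreover have "w \<in> ?R" using yR[of 0 1] npos by (simp add: y_def)
  ultimately have R: "?R = carrier_vec n" using w(2) by auto
  \<comment> \<open>Since \<open>W\<close> is surjective, preimages of the unit vectors are the
    columns of a right inverse \<open>Y\<close>, which is then two-sided because \<open>W\<close> is
    square. Hence no column of \<open>W\<close> is zero, in particular not
    \<open>y d\<close>.\<close>
  have "\<exists>x. x \<in> carrier_vec n \<and> W *\<^sub>v x = unit_vec n k" for k
  proof -
    have "unit_vec n k \<in> ?R" unfolding R by simp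
    then show ?thesis by auto
  qed
  then obtain x where x: "\<And>k. x k \<in> carrier_vec n" "\<And>k. W *\<^sub>v x k = unit_vec n k" by metis
  define Y where "Y = mat_of_cols n (map x [0..<n])"
  have Y: "Y \<in> carrier_mat n n" using mat_of_cols_carrier(1)[of n "map x [0..<n]"] by (simp add: Y_def)
  have WY: "W * Y = 1\<^sub>m n"
  proof (rule eq_matI)
    fix i j assume "i < dim_row (1\<^sub>m n)" "j < dim_col (1\<^sub>m n)"
    then have ij: "i < n" "j < n" by auto
    have "(W * Y) $$ (i, j) = col (W * Y) j $ i" using ij W Y by simp
    also have "col (W * Y) j = W *\<^sub>v col Y j" using ij by (simp only: col_mult2[OF W Y])
    also have "col Y j = x j" using ij x(1)[of j] by (simp add: Y_def)
    also have "W *\<^sub>v x j = unit_vec n j" by (rule x(2))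
    finally show "(W * Y) $$ (i, j) = 1\<^sub>m n $$ (i, j)" using ij by (simp add: unit_vec_def)
  qed (use W Y in auto)
  have "y d \<noteq> 0\<^sub>v n"
  proof
    assume "y d = 0\<^sub>v n"
    then have "W *\<^sub>v unit_vec n d = 0\<^sub>v n"
      using mult_unit_vec_col[OF W, of d] colW[of d] by (simp add: n_def)
    then have "Y *\<^sub>v (W *\<^sub>v unit_vec n d) = 0\<^sub>v n" using Y by auto
    then have "unit_vec n d = (0\<^sub>v n :: complex vec)"
      using mat_mult_left_right_inverse[OF W Y WY] W Y
      assoc_mult_mat_vec[OF Y W, of "unit_vec n d"] by simp
    then have "unit_vec n d $ d = (0\<^sub>v n :: complex vec) $ d" by simp
    then show False by (simp add: n_def)
  qed
  \<comment> \<open>Apply \<open>Sp\<close> to \<open>y (d + 1) = 0\<close>: since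
    \<open>y d\<close> is nonzero, the coefficient in \<open>up\<close> must vanish, and this forces
    the highest weight \<open>l = d / 2\<close>.\<close>
  moreover have "(of_nat (d + 1) * (2 * l - of_nat d)) \<cdot>\<^sub>v y d = 0\<^sub>v n"
  proof -
    have "Sp *\<^sub>v 0\<^sub>v n = 0\<^sub>v n" using Sp by auto
    then show ?thesis using up[of d] top by (simp add: n_def)
  qed
  ultimately have "of_nat (d + 1) * (2 * l - of_nat d) = (0 :: complex)"
    using y[of d] smult_eq0[of _ "y d"] by blast
  then have "2 * l = of_nat d" by (simp del: of_nat_Suc of_nat_add)
  then have l: "l = of_nat d / 2" by (simp add: field_simps)

  define P where "P = op_prod n (\<lambda>k. S3 - (of_nat d / 2 - of_nat k) \<cdot>\<^sub>m 1\<^sub>m n) [0..<n]"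
  have P: "P \<in> carrier_mat n n" unfolding P_def using S3 by (intro op_prod_carrier) auto
  \<comment> \<open>The factor of \<open>P\<close> with index \<open>k\<close> annihilates
    \<open>y k\<close>. So \<open>P * W = 0\<close>, and the inverse of \<open>W\<close> gives
    \<open>P = 0\<close>.\<close>
  have "P *\<^sub>v y k = 0\<^sub>v n" if "k < n" for k
  proof -
    have "P *\<^sub>v y k = (\<Prod>j\<leftarrow>[0..<n]. (l - of_nat k) - (of_nat d / 2 - of_nat j)) \<cdot>\<^sub>v y k"
      unfolding P_def using y by (intro op_prod_eigenvector[OF S3]) auto
    also have "(\<Prod>j\<leftarrow>[0..<n]. (l - of_nat k) - (of_nat d / 2 - of_nat j)) = (0 :: complex)"
      using that by (auto simp: prod_list_zero_iff l)
    also have "0 \<cdot>\<^sub>v y k = 0\<^sub>v n"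
      using y[of k, THEN conjunct1] by (auto intro!: eq_vecI)
    finally show ?thesis .
  qed
  then have "col (P * W) k = col (0\<^sub>m n n) k" if "k < n" for k
    using that by (simp only: col_mult2[OF P W that] colW col_zero)
  then have "P * W = 0\<^sub>m n n"
    using P W by (intro mat_col_eqI) auto
  then have "P * (W * Y) = 0\<^sub>m n n"
    using P W Y by (simp flip: assoc_mult_mat[OF P W Y])
  then show ?thesis using P WY by (simp add: P_def n_def)
qed

subsection \<open>Rotated spin operators\<close>

text \<open>The Lie bracket of sl2 in the coordinates \<open>s\<close>, \<open>p\<close>,
  \<open>m\<close>; it reduces the commutation relations of the rotated triple to scalar
  identities.\<close>

lemma commutator_sl2:
  fixes s p m :: operator
  assumes "p * m - m * p = 2 *\<^sub>C s" "s * p - p * s = p" "s * m - m * s = - m"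
  shows "(x *\<^sub>C s + y *\<^sub>C p + z *\<^sub>C m) * (x' *\<^sub>C s + y' *\<^sub>C p + z' *\<^sub>C m)
      - (x' *\<^sub>C s + y' *\<^sub>C p + z' *\<^sub>C m) * (x *\<^sub>C s + y *\<^sub>C p + z *\<^sub>C m)
    = (2 * (y * z' - z * y')) *\<^sub>C s + (x * y' - y * x') *\<^sub>C p + (z * x' - x * z') *\<^sub>C m"
    (is "?l = _")
proof -
  have "?l = (x * y' - y * x') *\<^sub>C (s * p - p * s) + (x * z' - z * x') *\<^sub>C (s * m - m * s)
      + (y * z' - z * y') *\<^sub>C (p * m - m * p)"
    by (simp add: scl_distribs algebra_simps)
  also have "\<dots> = (2 * (y * z' - z * y')) *\<^sub>C s + (x * y' - y * x') *\<^sub>C p + (z * x' - x * z') *\<^sub>C m"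
    unfolding assms by (simp add: scl_distribs algebra_simps)
  finally show ?thesis .
qed

definition lin_comb3 :: "complex \<Rightarrow> complex \<Rightarrow> complex \<Rightarrow> complex mat \<Rightarrow> complex mat \<Rightarrow> complex mat \<Rightarrow> complex mat" where
  "lin_comb3 x y z A B C = x \<cdot>\<^sub>m A + y \<cdot>\<^sub>m B + z \<cdot>\<^sub>m C"

lemma lin_comb3_carrier [simp]:
  "A \<in> carrier_mat n n \<Longrightarrow> B \<in> carrier_mat n n \<Longrightarrow> C \<in> carrier_mat n n \<Longrightarrow>
    lin_comb3 x y z A B C \<in> carrier_mat n n"
  by (simp add: lin_comb3_def)

lemma emb_lin_comb3:
  assumes "A \<in> carrier_mat n n" "B \<in> carrier_mat n n" "C \<in> carrier_mat n n" "n > 0"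
  shows "emb n (lin_comb3 x y z A B C) = x *\<^sub>C emb n A + y *\<^sub>C emb n B + z *\<^sub>C emb n C"
  using assms by (simp add: lin_comb3_def emb_add[of _ n] emb_smult)

lemma invariant_under_lin_comb3:
  assumes sub: "VectorSpace.subspace class_ring W (module_vec TYPE(complex) n)"
    and car: "A \<in> carrier_mat n n" "B \<in> carrier_mat n n" "C \<in> carrier_mat n n"
    and inv: "invariant_under A W" "invariant_under B W" "invariant_under C W"
  shows "invariant_under (lin_comb3 x y z A B C) W"
  unfolding invariant_under_def
proof
  interpret submodule class_ring W "module_vec TYPE(complex) n"
    using sub by (simp add: VectorSpace.subspace_def)
  have add: "v + w \<in> W" if "v \<in> W" "w \<in> W" for v w
    using m_closed[OF that] by (simp add: module_vec_simps)
  have smult: "a \<cdot>\<^sub>v v \<in> W" if "v \<in> W" for a v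
    using smult_closed[of a v] that by (simp add: module_vec_simps class_ring_simps)
  fix w assume w: "w \<in> W"
  then have wc: "w \<in> carrier_vec n" using subset by (auto simp: module_vec_simps)
  have sm: "(a \<cdot>\<^sub>m M) *\<^sub>v w = a \<cdot>\<^sub>v (M *\<^sub>v w)" if "M \<in> carrier_mat n n" for a M
    using that wc by (intro eq_vecI) (auto simp: smult_scalar_prod_distrib[of _ n])
  have "lin_comb3 x y z A B C *\<^sub>v w = x \<cdot>\<^sub>v (A *\<^sub>v w) + y \<cdot>\<^sub>v (B *\<^sub>v w) + z \<cdot>\<^sub>v (C *\<^sub>v w)"
    using car wc by (simp add: lin_comb3_def add_mult_distrib_mat_vec[of _ n n] sm)
  then show "lin_comb3 x y z A B C *\<^sub>v w \<in> W"
    using inv w by (auto simp: invariant_under_def intro!: add smult)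
qed

text \<open>The entries of \<open>G M G\<^sup>-\<^sup>1\<close> for \<open>M = ((S3, Sm), (Sp, -S3))\<close> and \<open>G = ((a1, a2), (-b2, b1))\<close>.\<close>

definition rot3 where
  "rot3 a1 a2 b1 b2 = lin_comb3 ((a1 * b1 - a2 * b2) / (a1 * b1 + a2 * b2))
     (a2 * b1 / (a1 * b1 + a2 * b2)) (a1 * b2 / (a1 * b1 + a2 * b2))"

definition rotp where
  "rotp a1 a2 b1 b2 = lin_comb3 (- 2 * b1 * b2 / (a1 * b1 + a2 * b2))
     (b1\<^sup>2 / (a1 * b1 + a2 * b2)) (- b2\<^sup>2 / (a1 * b1 + a2 * b2))"

definition rotm where
  "rotm a1 a2 b1 b2 = lin_comb3 (- 2 * a1 * a2 / (a1 * b1 + a2 * b2))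
     (- a2\<^sup>2 / (a1 * b1 + a2 * b2)) (a1\<^sup>2 / (a1 * b1 + a2 * b2))"

lemma lin_comb3_lin_comb3:
  assumes "A \<in> carrier_mat n n" "B \<in> carrier_mat n n" "C \<in> carrier_mat n n"
  shows "lin_comb3 x y z (lin_comb3 x1 y1 z1 A B C) (lin_comb3 x2 y2 z2 A B C) (lin_comb3 x3 y3 z3 A B C) =
    lin_comb3 (x * x1 + y * x2 + z * x3) (x * y1 + y * y2 + z * y3) (x * z1 + y * z2 + z * z3) A B C"
  using assms by (intro eq_matI) (auto simp: lin_comb3_def algebra_simps)

lemma lin_comb3_unit:
  assumes "A \<in> carrier_mat n n" "B \<in> carrier_mat n n" "C \<in> carrier_mat n n"
  shows "lin_comb3 1 0 0 A B C = A" "lin_comb3 0 1 0 A B C = B" "lin_comb3 0 0 1 A B C = C"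
  using assms by (auto intro!: eq_matI simp: lin_comb3_def)

text \<open>Conjugation by the inverse of \<open>G\<close> is conjugation by its adjugate
  \<open>((b1, -a2), (b2, a1))\<close>, which has the same shape as \<open>G\<close> with
  \<open>b1\<close>, \<open>- a2\<close>, \<open>a1\<close>, \<open>- b2\<close> in place of
  \<open>a1\<close>, \<open>a2\<close>, \<open>b1\<close>, \<open>b2\<close>.\<close>

lemma rot_inverse:
  assumes S3: "S3 \<in> carrier_mat n n" and Sp: "Sp \<in> carrier_mat n n" and Sm: "Sm \<in> carrier_mat n n"
    and del: "a1 * b1 + a2 * b2 \<noteq> 0"
  defines "R3 \<equiv> rot3 a1 a2 b1 b2 S3 Sp Sm" and "Rp \<equiv> rotp a1 a2 b1 b2 S3 Sp Sm"
    and "Rm \<equiv> rotm a1 a2 b1 b2 S3 Sp Sm"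
  shows "S3 = rot3 b1 (- a2) a1 (- b2) R3 Rp Rm" (is ?A)
    and "Sp = rotp b1 (- a2) a1 (- b2) R3 Rp Rm" (is ?B)
    and "Sm = rotm b1 (- a2) a1 (- b2) R3 Rp Rm" (is ?C)
proof -
  define e where "e = a1 * b1 + a2 * b2"
  have e: "e \<noteq> 0" "b1 * a1 + - a2 * - b2 = e" using del by (simp_all add: e_def mult.commute)
  have eq: "x / e * (x1 / e) + y / e * (y1 / e) + z / e * (z1 / e) = (x * x1 + y * y1 + z * z1) / e\<^sup>2"
    for x x1 y y1 z z1 using e by (simp add: field_simps power2_eq_square)
  have one: "w / e\<^sup>2 = 1" if "w = e\<^sup>2" for w using that e by simp
  have zero: "w / e\<^sup>2 = 0" if "w = 0" for w using that by simp
  note unit = lin_comb3_unit[OF S3 Sp Sm, symmetric]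
  note d = R3_def Rp_def Rm_def rot3_def rotp_def rotm_def e(2) e_def[symmetric]
    lin_comb3_lin_comb3[OF S3 Sp Sm] eq
  show ?A unfolding d
    by (subst unit(1), rule arg_cong3[of _ _ _ _ _ _ "\<lambda>x y z. lin_comb3 x y z S3 Sp Sm"])
      ((rule one[symmetric] zero[symmetric], simp add: e_def power2_eq_square algebra_simps)+)
  show ?B unfolding d
    by (subst unit(2), rule arg_cong3[of _ _ _ _ _ _ "\<lambda>x y z. lin_comb3 x y z S3 Sp Sm"])
      ((rule one[symmetric] zero[symmetric], simp add: e_def power2_eq_square algebra_simps)+)
  show ?C unfolding d
    by (subst unit(3), rule arg_cong3[of _ _ _ _ _ _ "\<lambda>x y z. lin_comb3 x y z S3 Sp Sm"])
      ((rule one[symmetric] zero[symmetric], simp add: e_def power2_eq_square algebra_simps)+)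
qed

text \<open>Irreducibility survives because, by \<open>rot_inverse\<close>, the old operators are
  combinations of the new ones: a subspace invariant under the rotated triple is invariant under the
  original one.\<close>

lemma spin_rep_rot:
  assumes rep: "spin_rep d S3 Sp Sm" and del: "a1 * b1 + a2 * b2 \<noteq> 0"
  shows "spin_rep d (rot3 a1 a2 b1 b2 S3 Sp Sm) (rotp a1 a2 b1 b2 S3 Sp Sm) (rotm a1 a2 b1 b2 S3 Sp Sm)"
proof -
  define n e where "n = d + 1" and "e = a1 * b1 + a2 * b2"
  have n: "n > 0" by (simp add: n_def)
  have e: "e \<noteq> 0" using del by (simp add: e_def)
  let ?E = "emb n"
  let ?R3 = "rot3 a1 a2 b1 b2 S3 Sp Sm" and ?Rp = "rotp a1 a2 b1 b2 S3 Sp Sm"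
    and ?Rm = "rotm a1 a2 b1 b2 S3 Sp Sm"
  have car: "S3 \<in> carrier_mat n n" "Sp \<in> carrier_mat n n" "Sm \<in> carrier_mat n n"
    and rel: "Sp * Sm - Sm * Sp = 2 \<cdot>\<^sub>m S3" "S3 * Sp - Sp * S3 = Sp" "S3 * Sm - Sm * S3 = - Sm"
    and irr: "\<And>W. VectorSpace.subspace class_ring W (module_vec TYPE(complex) n) \<Longrightarrow>
        invariant_under S3 W \<Longrightarrow> invariant_under Sp W \<Longrightarrow> invariant_under Sm W \<Longrightarrow>
        W = {0\<^sub>v n} \<or> W = carrier_vec n"
    using rep unfolding spin_rep_def n_def[symmetric] by auto
  have rcar: "?R3 \<in> carrier_mat n n" "?Rp \<in> carrier_mat n n" "?Rm \<in> carrier_mat n n"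
    using car by (simp_all add: rot3_def rotp_def rotm_def)
  have sl2: "?E Sp * ?E Sm - ?E Sm * ?E Sp = 2 *\<^sub>C ?E S3" "?E S3 * ?E Sp - ?E Sp * ?E S3 = ?E Sp"
    "?E S3 * ?E Sm - ?E Sm * ?E S3 = - ?E Sm"
    using rel[THEN arg_cong[of _ _ ?E]] car n
    by (simp_all add: emb_minus[of _ n] emb_mult emb_smult emb_uminus)
  note comm = commutator_sl2[OF sl2]
  note rdef = rot3_def rotp_def rotm_def emb_lin_comb3[OF car n] e_def[symmetric]
  \<comment> \<open>It is enough to compare coefficients after multiplication by
    \<open>e\<^sup>2\<close>, which clears all denominators of a product of two rotated
    operators.\<close>
  have coeffs: "x *\<^sub>C ?E S3 + y *\<^sub>C ?E Sp + z *\<^sub>C ?E Sm = x' *\<^sub>C ?E S3 + y' *\<^sub>C ?E Sp + z' *\<^sub>C ?E Sm"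
    if "e\<^sup>2 * x = e\<^sup>2 * x'" "e\<^sup>2 * y = e\<^sup>2 * y'" "e\<^sup>2 * z = e\<^sup>2 * z'" for x y z x' y' z'
    using that e by simp
  have "?E ?Rp * ?E ?Rm - ?E ?Rm * ?E ?Rp = 2 *\<^sub>C ?E ?R3"
    unfolding rdef comm scl_add_right scl_simps
    by (rule coeffs) (use e in \<open>simp_all add: field_simps power2_eq_square\<close>,
      (simp add: e_def algebra_simps)+)
  moreover have "?E ?R3 * ?E ?Rp - ?E ?Rp * ?E ?R3 = ?E ?Rp"
    unfolding rdef comm scl_add_right scl_simps
    by (rule coeffs) (use e in \<open>simp_all add: field_simps power2_eq_square\<close>,
      (simp add: e_def algebra_simps)+)
  moreover have "?E ?R3 * ?E ?Rm - ?E ?Rm * ?E ?R3 = (- 1) *\<^sub>C ?E ?Rm"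
    unfolding rdef comm scl_add_right scl_simps
    by (rule coeffs) (use e in \<open>simp_all add: field_simps power2_eq_square\<close>,
      (simp add: e_def algebra_simps)+)
  ultimately have "?Rp * ?Rm - ?Rm * ?Rp = 2 \<cdot>\<^sub>m ?R3" "?R3 * ?Rp - ?Rp * ?R3 = ?Rp"
    "?R3 * ?Rm - ?Rm * ?R3 = - ?Rm"
    using rcar n
    by (auto intro!: emb_inject[of _ n] simp: emb_minus[of _ n] emb_mult emb_smult emb_uminus scl_minus_left)
  moreover have "W = {0\<^sub>v n} \<or> W = carrier_vec n"
    if sub: "VectorSpace.subspace class_ring W (module_vec TYPE(complex) n)"
      and inv: "invariant_under ?R3 W" "invariant_under ?Rp W" "invariant_under ?Rm W" for W
  proof -
    note inv' = invariant_under_lin_comb3[OF sub rcar inv]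
    show ?thesis
    proof (rule irr[OF sub])
      show "invariant_under S3 W"
        by (subst rot_inverse(1)[OF car del], subst rot3_def) (rule inv')
      show "invariant_under Sp W"
        by (subst rot_inverse(2)[OF car del], subst rotp_def) (rule inv')
      show "invariant_under Sm W"
        by (subst rot_inverse(3)[OF car del], subst rotm_def) (rule inv')
    qed
  qed
  ultimately show ?thesis
    unfolding spin_rep_def n_def[symmetric] using rcar by blast
qed

subsection \<open>The RTT relation\<close>

definition omult :: "(nat \<Rightarrow> nat \<Rightarrow> operator) \<Rightarrow> (nat \<Rightarrow> nat \<Rightarrow> operator) \<Rightarrow> nat \<Rightarrow> nat \<Rightarrow> operator" where
  "omult P Q a b = P a 1 * Q 1 b + P a 2 * Q 2 b"

definition olax :: "complex \<Rightarrow> operator \<Rightarrow> operator \<Rightarrow> operator \<Rightarrow> complex \<Rightarrow> nat \<Rightarrow> nat \<Rightarrow> operator" where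
  "olax c s p m u a b =
     (if a = 1 \<and> b = 1 then (u / c + 1 / 2) *\<^sub>C 1 + s
      else if a = 1 \<and> b = 2 then m
      else if a = 2 \<and> b = 1 then p
      else (u / c + 1 / 2) *\<^sub>C 1 - s)"

text \<open>The sites form an arbitrary list, so that statements about the monodromy can be proved
  by splitting off the first site.\<close>

definition omono :: "complex \<Rightarrow> (nat \<Rightarrow> complex) \<Rightarrow> (nat \<Rightarrow> operator) \<Rightarrow> (nat \<Rightarrow> operator) \<Rightarrow>
    (nat \<Rightarrow> operator) \<Rightarrow> nat list \<Rightarrow> complex \<Rightarrow> nat \<Rightarrow> nat \<Rightarrow> operator" where
  "omono c \<theta> s p m xs u =
     foldr (\<lambda>i. omult (olax c (s i) (p i) (m i) (u - \<theta> i))) xs (\<lambda>a b. if a = b then 1 else 0)"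

lemma omono_Nil: "omono c \<theta> s p m [] u a b = (if a = b then 1 else 0)"
  by (simp add: omono_def)

lemma omono_Cons:
  "omono c \<theta> s p m (i # xs) u = omult (olax c (s i) (p i) (m i) (u - \<theta> i)) (omono c \<theta> s p m xs u)"
  by (simp add: omono_def)

text \<open>The RTT relation for the rational R-matrix of Yang in components, multiplied by
  \<open>x - y\<close> so that it makes sense at coinciding points.\<close>

definition rtt :: "complex \<Rightarrow> (complex \<Rightarrow> nat \<Rightarrow> nat \<Rightarrow> operator) \<Rightarrow> bool" where
  "rtt c T \<longleftrightarrow> (\<forall>x y. \<forall>a\<in>{1, 2}. \<forall>b\<in>{1, 2}. \<forall>a'\<in>{1, 2}. \<forall>b'\<in>{1, 2}.
     (x - y) *\<^sub>C (T x a b * T y a' b' - T y a' b' * T x a b) =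
     c *\<^sub>C (T y a' b * T x a b' - T x a' b * T y a b'))"

lemma rttD:
  assumes "rtt c T" "a \<in> {1, 2}" "b \<in> {1, 2}" "a' \<in> {1, 2}" "b' \<in> {1, 2}"
  shows "(x - y) *\<^sub>C (T x a b * T y a' b' - T y a' b' * T x a b) =
     c *\<^sub>C (T y a' b * T x a b' - T x a' b * T y a b')"
  using assms unfolding rtt_def by blast

text \<open>For equal index pairs the relation says that \<open>x - y + c\<close> times the
  commutator vanishes. If this factor is zero, exchanging \<open>x\<close> and \<open>y\<close>
  turns it into \<open>2 * c\<close>.\<close>

lemma rtt_commute:
  assumes "rtt c T" "c \<noteq> 0" "a \<in> {1, 2}" "b \<in> {1, 2}"
  shows "T x a b * T y a b = T y a b * T x a b"
proof -
  have comm: "T x a b * T y a b = T y a b * T x a b" if "x - y + c \<noteq> 0" for x y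
  proof -
    have "(x - y + c) *\<^sub>C (T x a b * T y a b - T y a b * T x a b) = 0"
      using rttD[OF assms(1,3,4,3,4), of x y] by (simp add: scl_distribs algebra_simps)
    then show ?thesis using that by (simp add: scl_eq_0_iff)
  qed
  show ?thesis
  proof (cases "x - y + c = 0")
    case True
    then have "y - x + c = 2 * c" by (simp add: algebra_simps)
    then show ?thesis using comm[of y x] \<open>c \<noteq> 0\<close> by simp
  qed (rule comm)
qed

text \<open>The comultiplication property: a product of two solutions whose entries commute with
  each other is again a solution. It allows the chain to be built site by site.\<close>

lemma rtt_omult:
  assumes P: "rtt c P" and Q: "rtt c Q"
    and comm: "\<And>x y a b a' b'. a \<in> {1, 2} \<Longrightarrow> b \<in> {1, 2} \<Longrightarrow> a' \<in> {1, 2} \<Longrightarrow> b' \<in> {1, 2} \<Longrightarrow>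
      Q y a' b' * P x a b = P x a b * Q y a' b'"
  shows "rtt c (\<lambda>x. omult (P x) (Q x))"
  unfolding rtt_def
proof (intro allI ballI)
  fix x y and a b a' b' :: nat
  let ?I = "{1, 2 :: nat}"
  assume ab: "a \<in> ?I" "b \<in> ?I" "a' \<in> ?I" "b' \<in> ?I"
  have om: "omult (P x) (Q x) a b = (\<Sum>e\<in>?I. P x a e * Q x e b)" for x a b
    by (simp add: omult_def)
  have shuffle: "(P x a e * Q x e b) * (P y a' f * Q y f b') = P x a e * P y a' f * (Q x e b * Q y f b')"
    if "e \<in> ?I" "f \<in> ?I" "a \<in> ?I" "b \<in> ?I" "a' \<in> ?I" "b' \<in> ?I" for x y e f a b a' b'
  proof -
    have "(P x a e * Q x e b) * (P y a' f * Q y f b') = P x a e * (Q x e b * P y a' f) * Q y f b'"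
      by (simp add: mult.assoc)
    also have "Q x e b * P y a' f = P y a' f * Q x e b" using that by (intro comm)
    finally show ?thesis by (simp add: mult.assoc)
  qed
  have prod: "omult (P x) (Q x) a b * omult (P y) (Q y) a' b' =
      (\<Sum>e\<in>?I. \<Sum>f\<in>?I. P x a e * P y a' f * (Q x e b * Q y f b'))"
    if "a \<in> ?I" "b \<in> ?I" "a' \<in> ?I" "b' \<in> ?I" for x y a b a' b'
    unfolding om sum_product using that by (intro sum.cong refl shuffle)
  have exchange: "(x - y) *\<^sub>C (P x a e * P y a' f * (Q x e b * Q y f b') - P y a' f * P x a e * (Q y f b' * Q x e b))
      = c *\<^sub>C ((P y a' e * P x a f - P x a' e * P y a f) * (Q x e b * Q y f b'))
      + c *\<^sub>C (P y a' f * P x a e * (Q y f b * Q x e b' - Q x f b * Q y e b'))"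
    if "e \<in> ?I" "f \<in> ?I" for e f
  proof -
    have "(x - y) *\<^sub>C (P x a e * P y a' f * (Q x e b * Q y f b') - P y a' f * P x a e * (Q y f b' * Q x e b))
      = ((x - y) *\<^sub>C (P x a e * P y a' f - P y a' f * P x a e)) * (Q x e b * Q y f b')
      + P y a' f * P x a e * ((x - y) *\<^sub>C (Q x e b * Q y f b' - Q y f b' * Q x e b))"
      by (simp add: scl_distribs algebra_simps)
    also have "(x - y) *\<^sub>C (P x a e * P y a' f - P y a' f * P x a e) =
        c *\<^sub>C (P y a' e * P x a f - P x a' e * P y a f)"
      using that ab by (intro rttD[OF P])
    also have "(x - y) *\<^sub>C (Q x e b * Q y f b' - Q y f b' * Q x e b) =
        c *\<^sub>C (Q y f b * Q x e b' - Q x f b * Q y e b')"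
      using that ab by (intro rttD[OF Q])
    finally show ?thesis by simp
  qed
  have "(x - y) *\<^sub>C (omult (P x) (Q x) a b * omult (P y) (Q y) a' b' -
          omult (P y) (Q y) a' b' * omult (P x) (Q x) a b) =
      (x - y) *\<^sub>C ((\<Sum>e\<in>?I. \<Sum>f\<in>?I. P x a e * P y a' f * (Q x e b * Q y f b')) -
         (\<Sum>e\<in>?I. \<Sum>f\<in>?I. P y a' f * P x a e * (Q y f b' * Q x e b)))"
    unfolding prod[OF ab] prod[OF ab(3,4,1,2)]
    by (subst (2) sum.swap) simp
  also have "\<dots> = (\<Sum>e\<in>?I. \<Sum>f\<in>?I. c *\<^sub>C ((P y a' e * P x a f - P x a' e * P y a f) * (Q x e b * Q y f b'))
      + c *\<^sub>C (P y a' f * P x a e * (Q y f b * Q x e b' - Q x f b * Q y e b')))"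
    unfolding sum_subtractf[symmetric] scl_sum_right by (intro sum.cong refl exchange)
  \<comment> \<open>Exchanging \<open>e\<close> and \<open>f\<close> in the second half puts both
    halves over the same products of \<open>P\<close>; the mixed terms
    \<open>P y a' e * P x a f * (Q x e b * Q y f b')\<close> then cancel.\<close>
  also have "\<dots> = (\<Sum>e\<in>?I. \<Sum>f\<in>?I. c *\<^sub>C ((P y a' e * P x a f - P x a' e * P y a f) * (Q x e b * Q y f b')))
      + (\<Sum>e\<in>?I. \<Sum>f\<in>?I. c *\<^sub>C (P y a' e * P x a f * (Q y e b * Q x f b' - Q x e b * Q y f b')))"
    unfolding sum.distrib by (subst (2) sum.swap) simp
  also have "\<dots> = c *\<^sub>C ((\<Sum>e\<in>?I. \<Sum>f\<in>?I. P y a' e * P x a f * (Q y e b * Q x f b')) -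
      (\<Sum>e\<in>?I. \<Sum>f\<in>?I. P x a' e * P y a f * (Q x e b * Q y f b')))"
    unfolding sum_subtractf[symmetric] scl_sum_right sum.distrib[symmetric]
    by (intro sum.cong refl) (simp add: scl_distribs algebra_simps)
  also have "\<dots> = c *\<^sub>C (omult (P y) (Q y) a' b * omult (P x) (Q x) a b' -
      omult (P x) (Q x) a' b * omult (P y) (Q y) a b')"
    using ab by (simp only: prod)
  finally show "(x - y) *\<^sub>C (omult (P x) (Q x) a b * omult (P y) (Q y) a' b' -
          omult (P y) (Q y) a' b' * omult (P x) (Q x) a b) =
      c *\<^sub>C (omult (P y) (Q y) a' b * omult (P x) (Q x) a b' -
      omult (P x) (Q x) a' b * omult (P y) (Q y) a b')" .
qed

lemma rtt_olax:
  assumes "c \<noteq> 0" and "p * m - m * p = 2 *\<^sub>C s" "s * p - p * s = p" "s * m - m * s = - m"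
  shows "rtt c (\<lambda>u. olax c s p m (u - t))"
proof -
  have rel: "p * m = m * p + 2 *\<^sub>C s" "s * p = p * s + p" "s * m = m * s - m"
    using assms by (simp_all add: algebra_simps)
  have two: "2 *\<^sub>C s = s + s" using scl_add_left[of 1 1 s] by simp
  \<comment> \<open>The prefactor is expressed through the scalars that occur in the Lax entries.
    Each of the sixteen index cases is then an identity in the two scalars \<open>X\<close> and
    \<open>Y\<close> modulo the commutation relations.\<close>
  have X: "x - y = c * ((x - t) / c + 1 / 2) - c * ((y - t) / c + 1 / 2)" for x y
    using assms(1) by (simp add: field_simps)
  show ?thesis
    unfolding rtt_def
  proof (intro allI ballI)
    fix x y and a b a' b' :: nat
    assume ab: "a \<in> {1, 2}" "b \<in> {1, 2}" "a' \<in> {1, 2}" "b' \<in> {1, 2}"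
    define X Y where "X = (x - t) / c + 1 / 2" and "Y = (y - t) / c + 1 / 2"
    show "(x - y) *\<^sub>C (olax c s p m (x - t) a b * olax c s p m (y - t) a' b' -
           olax c s p m (y - t) a' b' * olax c s p m (x - t) a b) =
        c *\<^sub>C (olax c s p m (y - t) a' b * olax c s p m (x - t) a b' -
          olax c s p m (x - t) a' b * olax c s p m (y - t) a b')"
      unfolding X[of x y] olax_def X_def[symmetric] Y_def[symmetric]
      using ab by (elim insertE emptyE; simp add: scl_distribs distrib_left distrib_right
          left_diff_distrib right_diff_distrib rel two mult.commute)
  qed
qed

lemma commute_omult:
  fixes Z :: operator
  assumes "\<And>a b. a \<in> {1, 2} \<Longrightarrow> b \<in> {1, 2} \<Longrightarrow> Z * P a b = P a b * Z"
    and "\<And>a b. a \<in> {1, 2} \<Longrightarrow> b \<in> {1, 2} \<Longrightarrow> Z * Q a b = Q a b * Z"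
    and "a \<in> {1, 2}" "b \<in> {1, 2}"
  shows "Z * omult P Q a b = omult P Q a b * Z"
proof -
  have "Z * (P a e * Q e b) = P a e * Q e b * Z" if "e \<in> {1, 2}" for e
    using assms(1)[OF assms(3) that] assms(2)[OF that assms(4)] by (metis mult.assoc)
  then show ?thesis by (simp add: omult_def distrib_left distrib_right)
qed

lemma commute_olax:
  fixes Z :: operator
  assumes "Z * s = s * Z" "Z * p = p * Z" "Z * m = m * Z"
  shows "Z * olax c s p m u a b = olax c s p m u a b * Z"
  using assms by (simp add: olax_def algebra_simps)

lemma commute_omono:
  assumes "\<And>j. j \<in> set xs \<Longrightarrow> Z * s j = s j * Z \<and> Z * p j = p j * Z \<and> Z * m j = m j * Z"
    and "a \<in> {1, 2}" "b \<in> {1, 2}"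
  shows "Z * omono c \<theta> s p m xs u a b = omono c \<theta> s p m xs u a b * Z"
  using assms
proof (induction xs arbitrary: a b)
  case (Cons i xs)
  show ?case unfolding omono_Cons
    by (rule commute_omult) (use Cons in \<open>auto intro: commute_olax\<close>)
qed (simp add: omono_Nil)

subsection \<open>Chains of spins\<close>

text \<open>The site operators are abstract, so that the results can be used for the rotated
  spins.\<close>

locale spin_chain =
  fixes c :: complex and I :: "nat set" and s p m :: "nat \<Rightarrow> operator"
  assumes c_nonzero: "c \<noteq> 0"
    and sl2: "\<And>i. i \<in> I \<Longrightarrow> p i * m i - m i * p i = 2 *\<^sub>C s i"
      "\<And>i. i \<in> I \<Longrightarrow> s i * p i - p i * s i = p i"
      "\<And>i. i \<in> I \<Longrightarrow> s i * m i - m i * s i = - m i"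
    and local_commute: "\<And>i j X Y. i \<in> I \<Longrightarrow> j \<in> I \<Longrightarrow> i \<noteq> j \<Longrightarrow> X \<in> {s i, p i, m i} \<Longrightarrow>
      Y \<in> {s j, p j, m j} \<Longrightarrow> X * Y = Y * X"
begin

lemma rtt_omono:
  assumes "set xs \<subseteq> I" "distinct xs"
  shows "rtt c (omono c \<theta> s p m xs)"
  using assms
proof (induction xs)
  case Nil
  show ?case by (simp add: rtt_def omono_Nil)
next
  case (Cons i xs)
  have "rtt c (\<lambda>u. omult (olax c (s i) (p i) (m i) (u - \<theta> i)) (omono c \<theta> s p m xs u))"
  proof (rule rtt_omult)
    show "rtt c (\<lambda>u. olax c (s i) (p i) (m i) (u - \<theta> i))"
      using Cons.prems c_nonzero sl2 by (intro rtt_olax) auto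
    show "rtt c (omono c \<theta> s p m xs)" using Cons by simp
    fix x y and a b a' b' :: nat
    assume ab: "a \<in> {1, 2}" "b \<in> {1, 2}" "a' \<in> {1, 2}" "b' \<in> {1, 2}"
    have "X * omono c \<theta> s p m xs y a' b' = omono c \<theta> s p m xs y a' b' * X"
      if "X \<in> {s i, p i, m i}" for X
    proof (rule commute_omono[OF _ ab(3,4)])
      fix j assume "j \<in> set xs"
      then have "i \<in> I" "j \<in> I" "i \<noteq> j" using Cons.prems by auto
      then show "X * s j = s j * X \<and> X * p j = p j * X \<and> X * m j = m j * X"
        using local_commute[of i j X] that by blast
    qed
    then show "omono c \<theta> s p m xs y a' b' * olax c (s i) (p i) (m i) (x - \<theta> i) a b =
        olax c (s i) (p i) (m i) (x - \<theta> i) a b * omono c \<theta> s p m xs y a' b'"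
      by (intro commute_olax) auto
  qed
  then show ?case by (simp add: omono_Cons[abs_def])
qed

end

subsection \<open>Projections onto weight spaces\<close>

text \<open>The \<open>E k\<close> are the Lagrange basis polynomials for the nodes
  \<open>f k\<close>, evaluated at \<open>X\<close>. The full product is kept in the second clause
  because it need not vanish for the shorter lists met in the induction. The third clause records
  that \<open>E k\<close> is a polynomial in \<open>X\<close>, as far as commutation is
  concerned.\<close>

lemma spectral_resolution_aux:
  fixes X :: operator and f :: "'k \<Rightarrow> complex"
  assumes "xs \<noteq> []" "distinct xs" "inj_on f (set xs)"
  shows "\<exists>E a. (\<Sum>k\<in>set xs. E k) = 1 \<and>
     (\<forall>k\<in>set xs. (X - f k *\<^sub>C 1) * E k = a k *\<^sub>C prod_list (map (\<lambda>k. X - f k *\<^sub>C 1) xs)) \<and>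
     (\<forall>Y. X * Y = Y * X \<longrightarrow> (\<forall>k. E k * Y = Y * E k))"
  using assms
proof (induction xs rule: list_nonempty_induct)
  case (single x)
  show ?case by (rule exI[of _ "\<lambda>_. 1"], rule exI[of _ "\<lambda>_. 1"]) simp
next
  case (cons x xs)
  let ?L = "\<lambda>k. X - f k *\<^sub>C 1"
  let ?P = "prod_list (map ?L xs)"
  obtain E a where E: "(\<Sum>k\<in>set xs. E k) = 1"
    "\<And>k. k \<in> set xs \<Longrightarrow> ?L k * E k = a k *\<^sub>C ?P"
    "\<And>Y k. X * Y = Y * X \<Longrightarrow> E k * Y = Y * E k"
    using cons.IH cons.prems by auto
  define r where "r k = 1 / (f k - f x)" for k
  have r: "r k * (f k - f x) = 1" if "k \<in> set xs" for k
  proof -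
    have "f k \<noteq> f x" using cons.prems that by (auto simp: inj_on_def)
    then show ?thesis by (simp add: r_def)
  qed
  have LL: "?L k * ?L x = ?L x * ?L k" for k
    by (simp add: algebra_simps scl_distribs mult.commute)
  \<comment> \<open>A further node \<open>f x\<close> multiplies each old basis polynomial by
    \<open>(X - f x) / (f k - f x)\<close>; the polynomial for the new node is what is missing to
    the sum 1.\<close>
  define E1 where "E1 k = r k *\<^sub>C (?L x * E k)" for k
  define E2 where "E2 k = (if k = x then 1 - (\<Sum>k\<in>set xs. E1 k) else E1 k)" for k
  define b where "b k = (if k = x then - (\<Sum>k\<in>set xs. r k * a k) else r k * a k)" for k
  have x: "x \<notin> set xs" using cons.prems by auto
  have "(\<Sum>k\<in>set xs. E2 k) = (\<Sum>k\<in>set xs. E1 k)"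
    using x by (intro sum.cong) (auto simp: E2_def)
  then have 1: "(\<Sum>k\<in>set (x # xs). E2 k) = 1"
    using x by (simp add: E2_def)
  have L1: "?L k * E1 k = (r k * a k) *\<^sub>C (?L x * ?P)" if "k \<in> set xs" for k
  proof -
    have "?L k * E1 k = r k *\<^sub>C (?L x * (?L k * E k))"
      using LL[of k] by (simp add: E1_def mult.assoc[symmetric])
    then show ?thesis using E(2)[OF that] by simp
  qed
  \<comment> \<open>Since \<open>(f k - f x) - (X - f x) = - (X - f k)\<close>, each difference
    \<open>E k - E1 k\<close> contains the factor \<open>X - f k\<close> and so is a multiple of the
    product over \<open>xs\<close>.\<close>
  have "1 - (\<Sum>k\<in>set xs. E1 k) = (\<Sum>k\<in>set xs. E k - E1 k)"
    by (simp add: sum_subtractf E(1))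
  also have "\<dots> = (\<Sum>k\<in>set xs. (- (r k * a k)) *\<^sub>C ?P)"
  proof (rule sum.cong)
    fix k assume k: "k \<in> set xs"
    have "E k - E1 k = (r k * (f k - f x)) *\<^sub>C E k - E1 k" using r[OF k] by simp
    also have "\<dots> = (- r k) *\<^sub>C (?L k * E k)"
      by (simp add: E1_def algebra_simps scl_distribs)
    finally show "E k - E1 k = (- (r k * a k)) *\<^sub>C ?P" using E(2)[OF k] by simp
  qed simp
  finally have Ex: "E2 x = b x *\<^sub>C ?P"
    by (simp add: E2_def b_def scl_sum_left sum_negf scl_minus_left)
  have 2: "?L k * E2 k = b k *\<^sub>C prod_list (map ?L (x # xs))" if "k \<in> set (x # xs)" for k
    using that L1[of k] Ex by (cases "k = x") (auto simp: E2_def b_def)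
  have 3: "E2 k * Y = Y * E2 k" if Y: "X * Y = Y * X" for Y k
  proof -
    have "E1 k * Y = Y * E1 k" for k
    proof -
      have "?L x * Y = Y * ?L x" using Y by (simp add: algebra_simps)
      then have "?L x * E k * Y = Y * (?L x * E k)"
        using E(3)[OF Y, of k] by (metis mult.assoc)
      then show ?thesis by (simp add: E1_def)
    qed
    then show ?thesis
      by (simp add: E2_def left_diff_distrib right_diff_distrib sum_distrib_left sum_distrib_right)
  qed
  show ?case using 1 2 3 by blast
qed

lemma spectral_resolution:
  fixes X :: operator and f :: "'k \<Rightarrow> complex"
  assumes "xs \<noteq> []" "distinct xs" "inj_on f (set xs)"
    and "prod_list (map (\<lambda>k. X - f k *\<^sub>C 1) xs) = 0"
  shows "\<exists>E. (\<Sum>k\<in>set xs. E k) = 1 \<and> (\<forall>k\<in>set xs. X * E k = f k *\<^sub>C E k) \<and>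
     (\<forall>Y. X * Y = Y * X \<longrightarrow> (\<forall>k. E k * Y = Y * E k))"
proof -
  obtain E a where E: "(\<Sum>k\<in>set xs. E k) = 1"
    "\<forall>k\<in>set xs. (X - f k *\<^sub>C 1) * E k = a k *\<^sub>C prod_list (map (\<lambda>k. X - f k *\<^sub>C 1) xs)"
    "\<forall>Y. X * Y = Y * X \<longrightarrow> (\<forall>k. E k * Y = Y * E k)"
    using spectral_resolution_aux[OF assms(1-3), of X] by blast
  have "\<forall>k\<in>set xs. X * E k = f k *\<^sub>C E k"
    using E(2) assms(4) by (simp add: left_diff_distrib)
  then show ?thesis using E by blast
qed

text \<open>The projections are products of one-site projections, one for each choice
  \<open>\<kappa>\<close> of an eigenvalue at every site. The commutation clause allows
  \<open>s i\<close> to pass the projections of the other sites in the induction step.\<close>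

lemma joint_spectral_resolution:
  fixes s :: "nat \<Rightarrow> operator" and f :: "nat \<Rightarrow> nat \<Rightarrow> complex"
  assumes "finite I"
    and "\<And>i. i \<in> I \<Longrightarrow> inj_on (f i) {0..d i}"
    and "\<And>i. i \<in> I \<Longrightarrow> prod_list (map (\<lambda>k. s i - f i k *\<^sub>C 1) [0..<d i + 1]) = 0"
    and "\<And>i j. i \<in> I \<Longrightarrow> j \<in> I \<Longrightarrow> s i * s j = s j * s i"
  shows "\<exists>E. (\<Sum>\<kappa>\<in>PiE I (\<lambda>i. {0..d i}). E \<kappa>) = 1 \<and>
     (\<forall>\<kappa>\<in>PiE I (\<lambda>i. {0..d i}). \<forall>i\<in>I. s i * E \<kappa> = f i (\<kappa> i) *\<^sub>C E \<kappa>) \<and>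
     (\<forall>Y. (\<forall>i\<in>I. s i * Y = Y * s i) \<longrightarrow> (\<forall>\<kappa>. E \<kappa> * Y = Y * E \<kappa>))"
  using assms
proof (induction I rule: finite_induct)
  case empty
  show ?case by (rule exI[of _ "\<lambda>_. 1"]) simp
next
  case (insert i I)
  let ?K = "\<lambda>I. PiE I (\<lambda>i. {0..d i})"
  obtain E where E: "(\<Sum>\<kappa>\<in>?K I. E \<kappa>) = 1"
    "\<And>\<kappa> j. \<kappa> \<in> ?K I \<Longrightarrow> j \<in> I \<Longrightarrow> s j * E \<kappa> = f j (\<kappa> j) *\<^sub>C E \<kappa>"
    "\<And>Y \<kappa>. (\<And>j. j \<in> I \<Longrightarrow> s j * Y = Y * s j) \<Longrightarrow> E \<kappa> * Y = Y * E \<kappa>"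
    using insert.IH insert.prems by auto
  have set: "set [0..<d i + 1] = {0..d i}" by auto
  obtain e where e: "(\<Sum>k\<in>{0..d i}. e k) = 1" "\<And>k. k \<in> {0..d i} \<Longrightarrow> s i * e k = f i k *\<^sub>C e k"
    "\<And>Y k. s i * Y = Y * s i \<Longrightarrow> e k * Y = Y * e k"
    using spectral_resolution[of "[0..<d i + 1]" "f i" "s i"] insert.prems(1,2)[of i]
    unfolding set by auto
  define E' where "E' \<kappa> = E (restrict \<kappa> I) * e (\<kappa> i)" for \<kappa>
  have res: "restrict (\<kappa>(i := k)) I = \<kappa>" if "\<kappa> \<in> ?K I" for \<kappa> k
    using that insert.hyps by (auto simp: restrict_def fun_eq_iff PiE_def extensional_def)
  have "(\<Sum>\<kappa>\<in>?K (insert i I). E' \<kappa>) = (\<Sum>(k, \<kappa>)\<in>{0..d i} \<times> ?K I. E' (\<kappa>(i := k)))"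
    unfolding PiE_insert_eq
    by (subst sum.reindex[OF inj_combinator[OF insert.hyps(2)]]) (simp add: case_prod_unfold)
  also have "\<dots> = (\<Sum>(k, \<kappa>)\<in>{0..d i} \<times> ?K I. E \<kappa> * e k)"
    using res by (intro sum.cong) (auto simp: E'_def)
  also have "\<dots> = (\<Sum>\<kappa>\<in>?K I. E \<kappa>) * (\<Sum>k\<in>{0..d i}. e k)"
    unfolding sum_product by (subst sum.swap) (simp add: sum.cartesian_product)
  finally have 1: "(\<Sum>\<kappa>\<in>?K (insert i I). E' \<kappa>) = 1" using E e by simp
  have 2: "s j * E' \<kappa> = f j (\<kappa> j) *\<^sub>C E' \<kappa>" if "\<kappa> \<in> ?K (insert i I)" "j \<in> insert i I" for \<kappa> j
  proof -
    have \<kappa>: "restrict \<kappa> I \<in> ?K I" "\<kappa> i \<in> {0..d i}" using that by auto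
    show ?thesis
    proof (cases "j = i")
      case True
      have "E (restrict \<kappa> I) * s i = s i * E (restrict \<kappa> I)"
        using insert.prems(3) by (intro E(3)) auto
      then have "s i * E' \<kappa> = E (restrict \<kappa> I) * (s i * e (\<kappa> i))"
        unfolding E'_def by (metis mult.assoc)
      then show ?thesis using e(2)[OF \<kappa>(2)] True by (simp add: E'_def)
    next
      case False
      then show ?thesis using that E(2)[OF \<kappa>(1), of j]
        by (simp add: E'_def mult.assoc[symmetric])
    qed
  qed
  have 3: "E' \<kappa> * Y = Y * E' \<kappa>" if "\<And>j. j \<in> insert i I \<Longrightarrow> s j * Y = Y * s j" for Y \<kappa>
    using E(3)[of Y "restrict \<kappa> I"] e(3)[of Y "\<kappa> i"] that unfolding E'_def
    by (metis insertCI mult.assoc)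
  show ?case using 1 2 3 by blast
qed

subsection \<open>Interpolation\<close>

text \<open>A polynomial equals its interpolation in one point more than its degree; compare the top
  coefficients, the numerators of the Lagrange basis being monic.\<close>

lemma lagrange_leading_coefficient:
  fixes q :: "'a :: field poly"
  assumes A: "finite A" "card A = Suc (degree q)"
  shows "(\<Sum>x\<in>A. poly q x / (\<Prod>y\<in>A - {x}. x - y)) = lead_coeff q"
proof -
  define a where "a x = poly q x / (\<Prod>y\<in>A - {x}. x - y)" for x
  define L where "L x = (\<Prod>y\<in>A - {x}. [:- y, 1:])" for x
  define r where "r = (\<Sum>x\<in>A. Polynomial.smult (a x) (L x))"
  have degL: "degree (L x) = degree q" if "x \<in> A" for x
    unfolding L_def using A that by (subst degree_prod_eq_sum_degree) auto
  have leadL: "Polynomial.coeff (L x) (degree q) = 1" if "x \<in> A" for x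
    unfolding degL[OF that, symmetric] by (simp add: L_def lead_coeff_prod)
  have "degree r \<le> degree q"
    unfolding r_def using degL by (intro degree_sum_le[OF A(1)]) (metis degree_smult_le)
  moreover have "poly q x = poly r x" if x: "x \<in> A" for x
  proof -
    have "poly (L y) x = 0" if "y \<in> A" "y \<noteq> x" for y
      using that x A(1) by (auto simp: L_def poly_prod)
    then have "poly r x = (\<Sum>y\<in>A. if y = x then a x * poly (L x) x else 0)"
      unfolding r_def poly_sum by (intro sum.cong) auto
    also have "\<dots> = a x * (\<Prod>y\<in>A - {x}. x - y)" using x A(1) by (simp add: L_def poly_prod)
    also have "(\<Prod>y\<in>A - {x}. x - y) \<noteq> 0" using A(1) by auto
    then have "a x * (\<Prod>y\<in>A - {x}. x - y) = poly q x" by (simp add: a_def)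
    finally show ?thesis by simp
  qed
  ultimately have "q = r"
    using A by (intro poly_eqI_degree[of A]) auto
  then have "lead_coeff q = Polynomial.coeff r (degree q)" by simp
  also have "\<dots> = (\<Sum>x\<in>A. a x)"
    using leadL by (simp add: r_def coeff_sum)
  finally show ?thesis by (simp add: a_def)
qed

text \<open>Interpolation of \<open>q\<close> in the points \<open>z\<close>, \<open>u 1\<close>,
  ..., \<open>u S\<close> writes 1 as a sum of \<open>S + 1\<close> terms. Multiply by the product
  of \<open>pp\<close> over all points: in the term of a point \<open>x\<close> the factors
  \<open>pp x\<close> and \<open>poly q x\<close> combine to \<open>FF x\<close>, and
  \<open>c ^ S\<close> is absorbed by the \<open>S\<close> numerators \<open>c\<close>.\<close>

lemma lagrange_identity:
  fixes u :: "nat \<Rightarrow> complex" and q :: "complex poly" and pp FF :: "complex \<Rightarrow> complex"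
  assumes c: "c \<noteq> 0" and inj: "inj_on u {1..S}" and z: "z \<notin> u ` {1..S}"
    and q: "degree q = S" "lead_coeff q = 1"
    and FF: "\<And>x. FF x = pp x * (poly q x / c ^ S)"
  shows "pp z * (\<Prod>j = 1..S. pp (u j)) =
    FF z * (\<Prod>j = 1..S. c / (z - u j)) * (\<Prod>j = 1..S. pp (u j)) +
    (\<Sum>i = 1..S. (c / (u i - z) * FF (u i) * (\<Prod>j\<in>{1..S} - {i}. c / (u i - u j))) *
       (pp z * (\<Prod>j\<in>{1..S} - {i}. pp (u j))))"
proof -
  define A where "A = insert z (u ` {1..S})"
  define P where "P = pp z * (\<Prod>j = 1..S. pp (u j))"
  have card: "card A = Suc (degree q)" using z inj q by (simp add: A_def card_image)
  have "1 = (\<Sum>x\<in>A. poly q x / (\<Prod>y\<in>A - {x}. x - y))"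
    using lagrange_leading_coefficient[of A q] card q by (simp add: A_def)
  also have "\<dots> = poly q z / (\<Prod>y\<in>A - {z}. z - y) + (\<Sum>x\<in>u ` {1..S}. poly q x / (\<Prod>y\<in>A - {x}. x - y))"
    unfolding A_def using z by (subst sum.insert) auto
  also have "A - {z} = u ` {1..S}" using z by (auto simp: A_def)
  also have "(\<Prod>y\<in>u ` {1..S}. z - y) = (\<Prod>j = 1..S. z - u j)"
    by (subst prod.reindex[OF inj]) simp
  also have "(\<Sum>x\<in>u ` {1..S}. poly q x / (\<Prod>y\<in>A - {x}. x - y)) =
      (\<Sum>i = 1..S. poly q (u i) / (\<Prod>y\<in>A - {u i}. u i - y))"
    by (subst sum.reindex[OF inj]) simp
  also have "\<dots> = (\<Sum>i = 1..S. poly q (u i) / ((u i - z) * (\<Prod>j\<in>{1..S} - {i}. u i - u j)))"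
  proof (rule sum.cong)
    fix i assume i: "i \<in> {1..S}"
    have "A - {u i} = insert z (u ` ({1..S} - {i}))"
      using z i inj_on_image_set_diff[OF inj, of "{1..S}" "{i}"] by (auto simp: A_def)
    moreover have "z \<notin> u ` ({1..S} - {i})" using z by auto
    moreover have "inj_on u ({1..S} - {i})" using inj by (rule inj_on_subset) auto
    ultimately show "poly q (u i) / (\<Prod>y\<in>A - {u i}. u i - y) =
        poly q (u i) / ((u i - z) * (\<Prod>j\<in>{1..S} - {i}. u i - u j))"
      by (simp add: prod.reindex)
  qed simp
  finally have "P = P * (poly q z / (\<Prod>j = 1..S. z - u j) +
     (\<Sum>i = 1..S. poly q (u i) / ((u i - z) * (\<Prod>j\<in>{1..S} - {i}. u i - u j))))"
    by simp
  also have "\<dots> = P * (poly q z / (\<Prod>j = 1..S. z - u j)) +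
     (\<Sum>i = 1..S. P * (poly q (u i) / ((u i - z) * (\<Prod>j\<in>{1..S} - {i}. u i - u j))))"
    by (simp add: distrib_left sum_distrib_left)
  also have "P * (poly q z / (\<Prod>j = 1..S. z - u j)) =
      FF z * (\<Prod>j = 1..S. c / (z - u j)) * (\<Prod>j = 1..S. pp (u j))"
    using c by (simp add: P_def FF prod_dividef)
  also have "(\<Sum>i = 1..S. P * (poly q (u i) / ((u i - z) * (\<Prod>j\<in>{1..S} - {i}. u i - u j)))) =
    (\<Sum>i = 1..S. (c / (u i - z) * FF (u i) * (\<Prod>j\<in>{1..S} - {i}. c / (u i - u j))) *
       (pp z * (\<Prod>j\<in>{1..S} - {i}. pp (u j))))"
  proof (rule sum.cong)
    fix i assume i: "i \<in> {1..S}"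
    have P: "P = pp z * pp (u i) * (\<Prod>j\<in>{1..S} - {i}. pp (u j))"
      unfolding P_def using prod.remove[OF _ i, of "\<lambda>j. pp (u j)"] by simp
    have cS: "c ^ S = c * (\<Prod>j\<in>{1..S} - {i}. c)"
      using i by (simp add: power_Suc[symmetric] del: power_Suc)
    show "P * (poly q (u i) / ((u i - z) * (\<Prod>j\<in>{1..S} - {i}. u i - u j))) =
      (c / (u i - z) * FF (u i) * (\<Prod>j\<in>{1..S} - {i}. c / (u i - u j))) *
       (pp z * (\<Prod>j\<in>{1..S} - {i}. pp (u j)))"
      unfolding FF P prod_dividef cS using c by (simp add: mult_ac)
  qed simp
  finally show ?thesis by (simp add: P_def)
qed

subsection \<open>Triangular operators\<close>

text \<open>A decomposition of the space, with an integer level \<open>h\<close> for each summand.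
  Idempotence of the projections follows from the two axioms, see \<open>idem\<close>.\<close>

locale weight_grading =
  fixes K :: "'k set" and E :: "'k \<Rightarrow> operator" and h :: "'k \<Rightarrow> int"
  assumes finite_K: "finite K" and sum_E: "(\<Sum>\<kappa>\<in>K. E \<kappa>) = 1"
    and orth: "\<kappa> \<in> K \<Longrightarrow> \<eta> \<in> K \<Longrightarrow> \<kappa> \<noteq> \<eta> \<Longrightarrow> E \<kappa> * E \<eta> = 0"
begin

lemma idem: "\<kappa> \<in> K \<Longrightarrow> E \<kappa> * E \<kappa> = E \<kappa>"
proof -
  assume \<kappa>: "\<kappa> \<in> K"
  have "E \<kappa> = E \<kappa> * (\<Sum>\<eta>\<in>K. E \<eta>)" by (simp add: sum_E)
  also have "\<dots> = (\<Sum>\<eta>\<in>K. if \<eta> = \<kappa> then E \<kappa> * E \<kappa> else 0)"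
    unfolding sum_distrib_left using orth \<kappa> by (intro sum.cong) auto
  also have "\<dots> = E \<kappa> * E \<kappa>" using \<kappa> finite_K by simp
  finally show ?thesis by simp
qed

definition block :: "'k \<Rightarrow> 'k \<Rightarrow> operator \<Rightarrow> operator" where
  "block \<kappa> \<eta> X = E \<kappa> * X * E \<eta>"

lemma block_linear:
  "block \<kappa> \<eta> (X + Y) = block \<kappa> \<eta> X + block \<kappa> \<eta> Y"
  "block \<kappa> \<eta> (X - Y) = block \<kappa> \<eta> X - block \<kappa> \<eta> Y"
  "block \<kappa> \<eta> (a *\<^sub>C X) = a *\<^sub>C block \<kappa> \<eta> X" "block \<kappa> \<eta> 0 = 0"
  by (simp_all add: block_def algebra_simps)

lemma block_one: "\<kappa> \<in> K \<Longrightarrow> \<eta> \<in> K \<Longrightarrow> block \<kappa> \<eta> 1 = (if \<kappa> = \<eta> then E \<kappa> else 0)"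
  by (simp add: block_def idem orth)

lemma block_E:
  "\<kappa> \<in> K \<Longrightarrow> \<eta> \<in> K \<Longrightarrow> E \<kappa> * block \<kappa> \<eta> X = block \<kappa> \<eta> X"
  "\<kappa> \<in> K \<Longrightarrow> \<eta> \<in> K \<Longrightarrow> block \<kappa> \<eta> X * E \<eta> = block \<kappa> \<eta> X"
  using idem by (simp_all add: block_def mult.assoc) (simp add: mult.assoc[symmetric])

lemma block_mult: "block \<kappa> \<eta> (X * Y) = (\<Sum>\<nu>\<in>K. block \<kappa> \<nu> X * block \<nu> \<eta> Y)"
proof -
  have "block \<kappa> \<eta> (X * Y) = E \<kappa> * X * (\<Sum>\<nu>\<in>K. E \<nu>) * Y * E \<eta>"
    by (simp add: block_def sum_E mult.assoc)
  also have "\<dots> = (\<Sum>\<nu>\<in>K. E \<kappa> * X * E \<nu> * Y * E \<eta>)"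
    by (simp add: sum_distrib_left sum_distrib_right mult.assoc)
  also have "\<dots> = (\<Sum>\<nu>\<in>K. block \<kappa> \<nu> X * block \<nu> \<eta> Y)"
  proof (rule sum.cong)
    fix \<nu> assume "\<nu> \<in> K"
    then have "E \<nu> = E \<nu> * E \<nu>" by (simp add: idem)
    then show "E \<kappa> * X * E \<nu> * Y * E \<eta> = block \<kappa> \<nu> X * block \<nu> \<eta> Y"
      unfolding block_def by (metis mult.assoc)
  qed simp
  finally show ?thesis .
qed

lemma eq_0_if_blocks:
  assumes "\<And>\<kappa> \<eta>. \<kappa> \<in> K \<Longrightarrow> \<eta> \<in> K \<Longrightarrow> block \<kappa> \<eta> X = 0"
  shows "X = 0"
proof -
  have "X = (\<Sum>\<kappa>\<in>K. E \<kappa>) * X * (\<Sum>\<eta>\<in>K. E \<eta>)" by (simp add: sum_E)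
  also have "\<dots> = (\<Sum>\<eta>\<in>K. \<Sum>\<kappa>\<in>K. block \<kappa> \<eta> X)"
    by (simp add: block_def sum_distrib_left sum_distrib_right)
  also have "\<dots> = 0" using assms by simp
  finally show ?thesis .
qed

definition raises :: "int \<Rightarrow> operator \<Rightarrow> bool" where
  "raises n X \<longleftrightarrow> (\<forall>\<kappa>\<in>K. \<forall>\<eta>\<in>K. block \<kappa> \<eta> X \<noteq> 0 \<longrightarrow> h \<eta> + n \<le> h \<kappa>)"

text \<open>Subtracting \<open>\<chi> \<eta>\<close> affects only the diagonal block, so one
  condition says both that the diagonal blocks are scalar and that distinct summands of equal level
  are not connected; \<open>triangular_iff\<close> spells this out.\<close>

definition triangular :: "operator \<Rightarrow> ('k \<Rightarrow> complex) \<Rightarrow> bool" where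
  "triangular X \<chi> \<longleftrightarrow> (\<forall>\<kappa>\<in>K. \<forall>\<eta>\<in>K. block \<kappa> \<eta> (X - \<chi> \<eta> *\<^sub>C 1) \<noteq> 0 \<longrightarrow> h \<eta> + 1 \<le> h \<kappa>)"

lemma triangular_iff:
  "triangular X \<chi> \<longleftrightarrow> (\<forall>\<kappa>\<in>K. \<forall>\<eta>\<in>K. h \<kappa> \<le> h \<eta> \<longrightarrow>
     block \<kappa> \<eta> X = (if \<kappa> = \<eta> then \<chi> \<kappa> *\<^sub>C E \<kappa> else 0))"
  by (auto simp: triangular_def block_linear block_one; force)

lemma raises_0:  "raises n 0" by (simp add: raises_def block_linear)

lemma raises_add: "raises n X \<Longrightarrow> raises n Y \<Longrightarrow> raises n (X + Y)"
  by (fastforce simp: raises_def block_linear)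

lemma raises_scl: "raises n X \<Longrightarrow> raises n (a *\<^sub>C X)"
  by (auto simp: raises_def block_linear scl_eq_0_iff)

lemma raises_diff: "raises n X \<Longrightarrow> raises n Y \<Longrightarrow> raises n (X - Y)"
  by (fastforce simp: raises_def block_linear)

lemma raises_mono: "raises n X \<Longrightarrow> n' \<le> n \<Longrightarrow> raises n' X"
  by (fastforce simp: raises_def)

lemma raises_one: "raises 0 1"
  by (simp add: raises_def block_one)

lemma raises_mult:
  assumes "raises n X" "raises n' Y"
  shows "raises (n + n') (X * Y)"
  unfolding raises_def
proof (intro ballI impI)
  fix \<kappa> \<eta> assume K: "\<kappa> \<in> K" "\<eta> \<in> K" and "block \<kappa> \<eta> (X * Y) \<noteq> 0"
  then obtain \<nu> where "\<nu> \<in> K" "block \<kappa> \<nu> X \<noteq> 0" "block \<nu> \<eta> Y \<noteq> 0"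
    unfolding block_mult by (metis (no_types, lifting) mult_zero_left mult_zero_right sum.neutral)
  then have "h \<nu> + n \<le> h \<kappa>" "h \<eta> + n' \<le> h \<nu>"
    using assms K unfolding raises_def by blast+
  then show "h \<eta> + (n + n') \<le> h \<kappa>" by linarith
qed

lemma triangular_raises: "triangular X \<chi> \<Longrightarrow> raises 0 X"
  unfolding triangular_iff raises_def by (metis add.right_neutral linorder_le_cases order_refl)

lemma triangular_one: "triangular 1 (\<lambda>_. 1)"
  by (simp add: triangular_def block_linear)

lemma triangular_zero: "triangular 0 (\<lambda>_. 0)"
  by (simp add: triangular_def block_linear)

lemma triangular_add_raises: "triangular X \<chi> \<Longrightarrow> raises 1 Y \<Longrightarrow> triangular (X + Y) \<chi>"
  unfolding triangular_iff raises_def block_linear by (smt (verit, best) add.right_neutral)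

lemma triangular_add: "triangular X \<chi> \<Longrightarrow> triangular Y \<psi> \<Longrightarrow> triangular (X + Y) (\<lambda>\<kappa>. \<chi> \<kappa> + \<psi> \<kappa>)"
  by (simp add: triangular_iff block_linear scl_distribs)

lemma triangular_diff: "triangular X \<chi> \<Longrightarrow> triangular Y \<psi> \<Longrightarrow> triangular (X - Y) (\<lambda>\<kappa>. \<chi> \<kappa> - \<psi> \<kappa>)"
  by (simp add: triangular_iff block_linear scl_distribs)

lemma triangular_scl: "triangular X \<chi> \<Longrightarrow> triangular (a *\<^sub>C X) (\<lambda>\<kappa>. a * \<chi> \<kappa>)"
  by (simp add: triangular_iff block_linear)

lemma triangular_sum:
  "(\<And>i. i \<in> A \<Longrightarrow> triangular (X i) (\<chi> i)) \<Longrightarrow> triangular (\<Sum>i\<in>A. X i) (\<lambda>\<kappa>. \<Sum>i\<in>A. \<chi> i \<kappa>)"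
  by (induction A rule: infinite_finite_induct) (auto intro: triangular_zero triangular_add)

lemma triangular_mult:
  assumes X: "triangular X \<chi>" and Y: "triangular Y \<psi>"
  shows "triangular (X * Y) (\<lambda>\<kappa>. \<chi> \<kappa> * \<psi> \<kappa>)"
  unfolding triangular_iff
proof (intro ballI impI)
  fix \<kappa> \<eta> assume K: "\<kappa> \<in> K" "\<eta> \<in> K" and le: "h \<kappa> \<le> h \<eta>"
  have "block \<kappa> \<nu> X * block \<nu> \<eta> Y = (if \<nu> = \<kappa> then (if \<kappa> = \<eta> then (\<chi> \<kappa> * \<psi> \<kappa>) *\<^sub>C E \<kappa> else 0) else 0)"
    if \<nu>: "\<nu> \<in> K" for \<nu>
  proof (cases "h \<kappa> \<le> h \<nu>")
    case True
    then show ?thesis using X Y K le \<nu> by (auto simp: triangular_iff idem)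
  next
    case False
    then have "h \<nu> \<le> h \<eta>" "\<nu> \<noteq> \<eta>" "\<nu> \<noteq> \<kappa>" using le by auto
    then show ?thesis using Y K \<nu> by (simp add: triangular_iff)
  qed
  then have "block \<kappa> \<eta> (X * Y) =
      (\<Sum>\<nu>\<in>K. if \<nu> = \<kappa> then (if \<kappa> = \<eta> then (\<chi> \<kappa> * \<psi> \<kappa>) *\<^sub>C E \<kappa> else 0) else 0)"
    unfolding block_mult by (intro sum.cong) auto
  then show "block \<kappa> \<eta> (X * Y) = (if \<kappa> = \<eta> then (\<chi> \<kappa> * \<psi> \<kappa>) *\<^sub>C E \<kappa> else 0)"
    using K finite_K by simp
qed

lemma triangular_prod_list:
  "(\<And>x. x \<in> set xs \<Longrightarrow> triangular (X x) (\<chi> x)) \<Longrightarrow>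
    triangular (prod_list (map X xs)) (\<lambda>\<kappa>. prod_list (map (\<lambda>x. \<chi> x \<kappa>) xs))"
  by (induction xs) (auto intro: triangular_one triangular_mult)

text \<open>Induction on the distance \<open>h \<kappa> - h \<eta>\<close> of a block from the diagonal: the block \<open>(\<kappa>, \<eta>)\<close>
  of the commutator with \<open>A w\<close> is \<open>(\<chi> w \<eta> - \<chi> w \<kappa>)\<close> times that of \<open>X\<close>, plus terms that involve
  blocks of \<open>X\<close> closer to the diagonal.\<close>

lemma strictly_triangular_eq_0:
  assumes X: "triangular X (\<lambda>_. 0)"
    and A: "\<And>w. triangular (A w) (\<chi> w)" and comm: "\<And>w. X * A w = A w * X"
    and sep: "\<And>\<kappa> \<eta>. \<kappa> \<in> K \<Longrightarrow> \<eta> \<in> K \<Longrightarrow> \<kappa> \<noteq> \<eta> \<Longrightarrow> \<exists>w. \<chi> w \<kappa> \<noteq> \<chi> w \<eta>"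
  shows "X = 0"
proof (rule eq_0_if_blocks)
  fix \<kappa> \<eta> assume "\<kappa> \<in> K" "\<eta> \<in> K"
  then show "block \<kappa> \<eta> X = 0"
  proof (induction "nat (h \<kappa> - h \<eta>)" arbitrary: \<kappa> \<eta> rule: less_induct)
    case less
    note K = less.prems
    show ?case
    proof (cases "h \<kappa> \<le> h \<eta>")
      case True
      then show ?thesis using X K by (auto simp: triangular_iff)
    next
      case False
      then have gt: "h \<eta> < h \<kappa>" by simp
      then obtain w where w: "\<chi> w \<kappa> \<noteq> \<chi> w \<eta>" using sep[OF K] by fastforce
      have Adiag: "block \<nu> \<nu> (A w) = \<chi> w \<nu> *\<^sub>C E \<nu>" if "\<nu> \<in> K" for \<nu>
        using A[of w] that by (simp add: triangular_iff)
      have Alow: "block \<mu> \<nu> (A w) = 0" if "\<mu> \<in> K" "\<nu> \<in> K" "h \<mu> \<le> h \<nu>" "\<mu> \<noteq> \<nu>" for \<mu> \<nu>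
        using A[of w] that by (simp add: triangular_iff)
      have "block \<kappa> \<eta> (X * A w) = (\<Sum>\<nu>\<in>K. if \<nu> = \<eta> then \<chi> w \<eta> *\<^sub>C block \<kappa> \<eta> X else 0)"
        unfolding block_mult
      proof (rule sum.cong)
        fix \<nu> assume \<nu>: "\<nu> \<in> K"
        show "block \<kappa> \<nu> X * block \<nu> \<eta> (A w) = (if \<nu> = \<eta> then \<chi> w \<eta> *\<^sub>C block \<kappa> \<eta> X else 0)"
        proof (cases "h \<nu> \<le> h \<eta>")
          case True
          then show ?thesis using Alow[OF \<nu> K(2)] Adiag[OF K(2)] block_E[OF K] by auto
        next
          case False
          then have "block \<kappa> \<nu> X = 0" using gt K \<nu> by (intro less.hyps) auto
          then show ?thesis using False by auto
        qed
      qed simp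
      moreover have "block \<kappa> \<eta> (A w * X) = (\<Sum>\<nu>\<in>K. if \<nu> = \<kappa> then \<chi> w \<kappa> *\<^sub>C block \<kappa> \<eta> X else 0)"
        unfolding block_mult
      proof (rule sum.cong)
        fix \<nu> assume \<nu>: "\<nu> \<in> K"
        show "block \<kappa> \<nu> (A w) * block \<nu> \<eta> X = (if \<nu> = \<kappa> then \<chi> w \<kappa> *\<^sub>C block \<kappa> \<eta> X else 0)"
        proof (cases "h \<kappa> \<le> h \<nu>")
          case True
          then show ?thesis using Alow[OF K(1) \<nu>] Adiag[OF K(1)] block_E[OF K] by auto
        next
          case False
          then have "block \<nu> \<eta> X = 0" using gt K \<nu> by (intro less.hyps) auto
          then show ?thesis using False by auto
        qed
      qed simp
      ultimately have "\<chi> w \<eta> *\<^sub>C block \<kappa> \<eta> X = \<chi> w \<kappa> *\<^sub>C block \<kappa> \<eta> X"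
        using K finite_K comm[of w] by simp
      then have "(\<chi> w \<kappa> - \<chi> w \<eta>) *\<^sub>C block \<kappa> \<eta> X = 0" by (simp add: scl_distribs)
      then show ?thesis using w by (simp add: scl_eq_0_iff)
    qed
  qed
qed

text \<open>The relation \<open>[H, X] = e X\<close> means that \<open>X\<close> shifts eigenvalues
  of \<open>H\<close> by \<open>e\<close>; a nonzero block therefore fixes the difference of the two
  eigenvalues.\<close>

lemma block_shift:
  assumes K: "\<kappa> \<in> K" "\<eta> \<in> K"
    and eig: "E \<kappa> * H = a *\<^sub>C E \<kappa>" "H * E \<eta> = b *\<^sub>C E \<eta>"
    and comm: "H * X - X * H = e *\<^sub>C X" and nz: "block \<kappa> \<eta> X \<noteq> 0"
  shows "a - b = e"
proof -
  have "e *\<^sub>C block \<kappa> \<eta> X = block \<kappa> \<eta> (H * X) - block \<kappa> \<eta> (X * H)"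
    by (simp flip: block_linear comm)
  also have "block \<kappa> \<eta> (H * X) = a *\<^sub>C block \<kappa> \<eta> X"
    using eig(1) by (simp add: block_def mult.assoc[symmetric])
  also have "block \<kappa> \<eta> (X * H) = b *\<^sub>C block \<kappa> \<eta> X"
    using eig(2) by (simp add: block_def mult.assoc)
  finally have "(a - b - e) *\<^sub>C block \<kappa> \<eta> X = 0" by (simp add: scl_distribs)
  then show ?thesis using nz by (simp add: scl_eq_0_iff)
qed

end

subsection \<open>The relation for generic inhomogeneities\<close>

text \<open>The assumption \<open>weights\<close> carries the result of
  \<open>spin_rep_weights\<close> over to the whole chain.\<close>

locale weighted_spin_chain = spin_chain c "{1..N}" s p m
  for c :: complex and N :: nat and s p m :: "nat \<Rightarrow> operator" +
  fixes d :: "nat \<Rightarrow> nat"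
  assumes weights: "\<And>i. i \<in> {1..N} \<Longrightarrow>
    prod_list (map (\<lambda>k. s i - (of_nat (d i) / 2 - of_nat k) *\<^sub>C 1) [0..<d i + 1]) = 0"
begin

definition wt :: "nat \<Rightarrow> nat \<Rightarrow> complex" where
  "wt i k = of_nat (d i) / 2 - of_nat k"

definition K :: "(nat \<Rightarrow> nat) set" where
  "K = PiE {1..N} (\<lambda>i. {0..d i})"

text \<open>Here \<open>\<kappa> i\<close> counts the steps below the highest weight at site
  \<open>i\<close>. Lowering at \<open>i\<close> and raising at a later site \<open>j\<close>
  increases the level by \<open>j - i\<close>, while equal factors would give a multiple of the
  total weight up to a constant, which such a pair preserves.\<close>

definition level :: "(nat \<Rightarrow> nat) \<Rightarrow> int" where
  "level \<kappa> = - (\<Sum>i = 1..N. int i * int (\<kappa> i))"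

text \<open>The product of the eigenvalues of the upper left Lax entries: the path that never leaves
  the auxiliary index 1. Its zeros in \<open>u\<close> encode \<open>\<kappa>\<close>.\<close>

definition t11_weight :: "(nat \<Rightarrow> complex) \<Rightarrow> complex \<Rightarrow> (nat \<Rightarrow> nat) \<Rightarrow> complex" where
  "t11_weight \<theta> u \<kappa> = (\<Prod>i = 1..N. (u - \<theta> i) / c + 1 / 2 + wt i (\<kappa> i))"

lemma s_commute: "i \<in> {1..N} \<Longrightarrow> j \<in> {1..N} \<Longrightarrow> s i * s j = s j * s i"
  using local_commute[of i j "s i" "s j"] by (cases "i = j") auto

lemma weight_gradingE:
  obtains E where "weight_grading K E"
    "\<And>\<kappa> i. \<kappa> \<in> K \<Longrightarrow> i \<in> {1..N} \<Longrightarrow> s i * E \<kappa> = wt i (\<kappa> i) *\<^sub>C E \<kappa>"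
    "\<And>\<kappa> i. \<kappa> \<in> K \<Longrightarrow> i \<in> {1..N} \<Longrightarrow> E \<kappa> * s i = wt i (\<kappa> i) *\<^sub>C E \<kappa>"
proof -
  have inj: "inj_on (wt i) A" for i A by (auto simp: inj_on_def wt_def)
  obtain E where E: "(\<Sum>\<kappa>\<in>K. E \<kappa>) = 1"
    "\<And>\<kappa> i. \<kappa> \<in> K \<Longrightarrow> i \<in> {1..N} \<Longrightarrow> s i * E \<kappa> = wt i (\<kappa> i) *\<^sub>C E \<kappa>"
    "\<And>Y \<kappa>. (\<And>i. i \<in> {1..N} \<Longrightarrow> s i * Y = Y * s i) \<Longrightarrow> E \<kappa> * Y = Y * E \<kappa>"
    using joint_spectral_resolution[of "{1..N}" wt d s] inj weights s_commute
    unfolding K_def wt_def by auto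
  have E': "E \<kappa> * s i = wt i (\<kappa> i) *\<^sub>C E \<kappa>" if "\<kappa> \<in> K" "i \<in> {1..N}" for \<kappa> i
    using E(2)[OF that] E(3)[of "s i" \<kappa>] s_commute that by simp
  \<comment> \<open>At a site where the two weights differ, \<open>s i\<close> placed between the
    projections acts with one eigenvalue to the left and with another to the right.\<close>
  have "E \<kappa> * E \<eta> = 0" if K: "\<kappa> \<in> K" "\<eta> \<in> K" "\<kappa> \<noteq> \<eta>" for \<kappa> \<eta>
  proof -
    obtain i where i: "i \<in> {1..N}" "\<kappa> i \<noteq> \<eta> i"
      using K unfolding K_def by (metis PiE_ext)
    have "wt i (\<kappa> i) *\<^sub>C (E \<kappa> * E \<eta>) = wt i (\<eta> i) *\<^sub>C (E \<kappa> * E \<eta>)"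
      using E(2)[OF K(2) i(1)] E'[OF K(1) i(1)] by (metis mult.assoc mult_scl scl_simps(5))
    then have "(wt i (\<kappa> i) - wt i (\<eta> i)) *\<^sub>C (E \<kappa> * E \<eta>) = 0" by (simp add: scl_distribs)
    then show ?thesis using i by (simp add: scl_eq_0_iff wt_def)
  qed
  moreover have "finite K" unfolding K_def by (intro finite_PiE) auto
  ultimately have "weight_grading K E" using E(1) by unfold_locales auto
  then show ?thesis using that E(2) E' by blast
qed

end

text \<open>The projections are only known to exist; they are fixed here and supplied later by
  \<open>weight_gradingE\<close>.\<close>

locale graded_spin_chain = weighted_spin_chain c N s p m d + weight_grading K E level
  for c N s p m d E +
  assumes sE: "\<And>\<kappa> i. \<kappa> \<in> K \<Longrightarrow> i \<in> {1..N} \<Longrightarrow> s i * E \<kappa> = wt i (\<kappa> i) *\<^sub>C E \<kappa>"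
    and Es: "\<And>\<kappa> i. \<kappa> \<in> K \<Longrightarrow> i \<in> {1..N} \<Longrightarrow> E \<kappa> * s i = wt i (\<kappa> i) *\<^sub>C E \<kappa>"
begin

text \<open>Raising the eigenvalue of \<open>s j\<close> by \<open>e j\<close> lowers
  \<open>\<kappa> j\<close> by \<open>e j\<close>, which changes the level by
  \<open>j * e j\<close>.\<close>

lemma raises_if_shifts:
  assumes "\<And>j. j \<in> {1..N} \<Longrightarrow> s j * X - X * s j = of_int (e j) *\<^sub>C X"
  shows "raises (\<Sum>j = 1..N. int j * e j) X"
  unfolding raises_def
proof (intro ballI impI)
  fix \<kappa> \<eta> assume K: "\<kappa> \<in> K" "\<eta> \<in> K" and nz: "block \<kappa> \<eta> X \<noteq> 0"
  have "int (\<eta> j) - int (\<kappa> j) = e j" if j: "j \<in> {1..N}" for j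
  proof -
    have "wt j (\<kappa> j) - wt j (\<eta> j) = of_int (e j)"
      by (rule block_shift[OF K Es[OF K(1) j] sE[OF K(2) j] assms[OF j] nz])
    then have "(of_int (int (\<eta> j) - int (\<kappa> j)) :: complex) = of_int (e j)"
      by (simp add: wt_def)
    then show ?thesis by (simp only: of_int_eq_iff)
  qed
  then have "(\<Sum>j = 1..N. int j * e j) = (\<Sum>j = 1..N. int j * (int (\<eta> j) - int (\<kappa> j)))"
    by (intro sum.cong) auto
  also have "\<dots> = level \<kappa> - level \<eta>"
    by (simp add: level_def right_diff_distrib sum_subtractf)
  finally show "level \<eta> + (\<Sum>j = 1..N. int j * e j) \<le> level \<kappa>" by simp
qed

lemma raises_local:
  assumes i: "i \<in> {1..N}"
  shows "raises (int i) (p i)" "raises (- int i) (m i)" "raises 0 (s i)"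
proof -
  have comm: "s j * X - X * s j = 0" if "j \<in> {1..N}" "j \<noteq> i" "X \<in> {s i, p i, m i}" for j X
    using local_commute[OF that(1) i that(2), of "s j" X] that(3) by simp
  have "raises (\<Sum>j = 1..N. int j * (if j = i then 1 else 0)) (p i)"
    using comm sl2(2)[OF i] by (intro raises_if_shifts) auto
  moreover have "raises (\<Sum>j = 1..N. int j * (if j = i then - 1 else 0)) (m i)"
    using comm sl2(3)[OF i] by (intro raises_if_shifts) (auto simp: scl_minus_left)
  moreover have "raises (\<Sum>j = 1..N. int j * 0) (s i)"
    using comm by (intro raises_if_shifts) fastforce
  moreover have "(\<Sum>j = 1..N. int j * (if j = i then a else 0)) = int i * a" for a
  proof -
    have "(\<Sum>j = 1..N. int j * (if j = i then a else 0)) = (\<Sum>j = 1..N. if j = i then int i * a else 0)"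
      by (intro sum.cong) auto
    then show ?thesis using i by simp
  qed
  ultimately show "raises (int i) (p i)" "raises (- int i) (m i)" "raises 0 (s i)" by simp_all
qed

lemma triangular_s: "i \<in> {1..N} \<Longrightarrow> triangular (s i) (\<lambda>\<kappa>. wt i (\<kappa> i))"
  by (simp add: triangular_iff block_def Es idem orth)

text \<open>An entry \<open>t\<^sub>1\<^sub>1\<close> is a sum over paths: the off-diagonal steps are alternately \<open>m\<close> and \<open>p\<close>,
  beginning with \<open>m\<close>, at increasing sites, so that the level, in which the sites are weighted by
  their position, increases.\<close>

lemma triangular_omono:
  assumes "sorted_wrt (<) xs" "set xs \<subseteq> {1..N}"
  shows "triangular (omono c \<theta> s p m xs u 1 1)
      (\<lambda>\<kappa>. \<Prod>i\<leftarrow>xs. (u - \<theta> i) / c + 1 / 2 + wt i (\<kappa> i)) \<and>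
    (\<forall>j. (\<forall>i\<in>set xs. j \<le> int i) \<longrightarrow> raises j (omono c \<theta> s p m xs u 2 1))"
  using assms
proof (induction xs)
  case Nil
  then show ?case by (simp add: omono_Nil triangular_one raises_0)
next
  case (Cons i xs)
  define x where "x = (u - \<theta> i) / c + 1 / 2"
  define T where "T = omono c \<theta> s p m xs u"
  have i: "i \<in> {1..N}" using Cons.prems by auto
  have xs: "sorted_wrt (<) xs" "set xs \<subseteq> {1..N}" "\<forall>i'\<in>set xs. int i + 1 \<le> int i'"
    using Cons.prems by auto
  \<comment> \<open>All remaining sites are at least \<open>i + 1\<close>. Of this gain for the
    entry \<open>2 1\<close> the factor \<open>m i\<close> uses up \<open>i\<close>, so
    \<open>m i * T 2 1\<close> still raises the level by 1 and does not touch the diagonal.\<close>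
  have IH: "triangular (T 1 1) (\<lambda>\<kappa>. \<Prod>i\<leftarrow>xs. (u - \<theta> i) / c + 1 / 2 + wt i (\<kappa> i))"
    "raises (int i + 1) (T 2 1)"
    using Cons.IH[OF xs(1,2)] xs(3) unfolding T_def by blast+
  have t11: "omono c \<theta> s p m (i # xs) u 1 1 = (x *\<^sub>C 1 + s i) * T 1 1 + m i * T 2 1"
    and t21: "omono c \<theta> s p m (i # xs) u 2 1 = p i * T 1 1 + (x *\<^sub>C 1 - s i) * T 2 1"
    by (simp_all add: omono_Cons omult_def olax_def x_def T_def)
  have "triangular (x *\<^sub>C 1 + s i) (\<lambda>\<kappa>. x * 1 + wt i (\<kappa> i))"
    by (intro triangular_add triangular_scl triangular_one triangular_s i)
  from triangular_mult[OF this IH(1)]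
  have "triangular ((x *\<^sub>C 1 + s i) * T 1 1 + m i * T 2 1)
      (\<lambda>\<kappa>. (x * 1 + wt i (\<kappa> i)) * (\<Prod>i\<leftarrow>xs. (u - \<theta> i) / c + 1 / 2 + wt i (\<kappa> i)))"
    using raises_mult[OF raises_local(2)[OF i] IH(2)] by (intro triangular_add_raises) auto
  moreover have "raises j (p i * T 1 1 + (x *\<^sub>C 1 - s i) * T 2 1)"
    if "\<forall>i'\<in>set (i # xs). j \<le> int i'" for j
  proof (rule raises_mono[where n = "int i"])
    have "raises (int i) ((x *\<^sub>C 1 - s i) * T 2 1)"
      using raises_mult[OF raises_diff[OF raises_scl[OF raises_one] raises_local(3)[OF i]] IH(2), of x]
      by (auto intro: raises_mono)
    moreover have "raises (int i) (p i * T 1 1)"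
      using raises_mult[OF raises_local(1)[OF i] triangular_raises[OF IH(1)]] by simp
    ultimately show "raises (int i) (p i * T 1 1 + (x *\<^sub>C 1 - s i) * T 2 1)"
      by (intro raises_add)
  qed (use that in auto)
  ultimately show ?case unfolding t11 t21 by (simp add: x_def)
qed

lemma triangular_t11:
  "triangular (omono c \<theta> s p m [1..<N + 1] u 1 1) (t11_weight \<theta> u)"
proof -
  have "(\<lambda>\<kappa>. \<Prod>i\<leftarrow>[1..<N + 1]. (u - \<theta> i) / c + 1 / 2 + wt i (\<kappa> i)) = t11_weight \<theta> u"
    unfolding t11_weight_def
    by (rule ext, subst prod.distinct_set_conv_list[symmetric]) (auto intro: prod.cong)
  moreover have "set [1..<N + 1] \<subseteq> {1..N}" by auto
  ultimately show ?thesis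
    using triangular_omono[OF sorted_wrt_upt, of 1 "N + 1" \<theta> u] by metis
qed

end

text \<open>The compared numbers are the zeros of the factors of \<open>F\<close>: different sites
  share none of them.\<close>

definition generic_inhomogeneities :: "complex \<Rightarrow> nat \<Rightarrow> (nat \<Rightarrow> nat) \<Rightarrow> (nat \<Rightarrow> complex) \<Rightarrow> bool" where
  "generic_inhomogeneities c N d \<theta> \<longleftrightarrow>
     (\<forall>i\<in>{1..N}. \<forall>j\<in>{1..N}. \<forall>k\<in>{0..d i}. \<forall>l\<in>{0..d j}. i \<noteq> j \<longrightarrow>
        \<theta> i - c * (of_nat (d i) / 2 - of_nat k + 1 / 2) \<noteq> \<theta> j - c * (of_nat (d j) / 2 - of_nat l + 1 / 2))"

definition bethe_relation ::
  "complex \<Rightarrow> nat \<Rightarrow> (complex \<Rightarrow> complex) \<Rightarrow> complex \<Rightarrow> (nat \<Rightarrow> complex) \<Rightarrow> complex \<Rightarrow> (complex \<Rightarrow> operator) \<Rightarrow> bool" where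
  "bethe_relation c S FF z u \<delta> B \<longleftrightarrow>
     B z * prod_list (map (\<lambda>j. B (u j)) [1..<S + 1]) =
     \<delta> *\<^sub>C ((FF z * (\<Prod>j = 1..S. g c z (u j))) *\<^sub>C prod_list (map (\<lambda>j. B (u j)) [1..<S + 1]) +
       (\<Sum>i = 1..S. (g c (u i) z * FF (u i) * (\<Prod>j \<in> {1..S} - {i}. g c (u i) (u j))) *\<^sub>C
          (B z * prod_list (map (\<lambda>j. B (u j)) (filter (\<lambda>j. j \<noteq> i) [1..<S + 1])))))"

text \<open>The left side contains \<open>S + 1\<close> factors \<open>B\<close> and every term on
  the right contains \<open>S\<close>, so a rescaling of \<open>B\<close> is compensated by the same
  rescaling of \<open>\<delta>\<close>.\<close>

lemma bethe_relation_scl: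
  assumes "bethe_relation c S FF z u \<delta> A"
  shows "bethe_relation c S FF z u (\<eta> * \<delta>) (\<lambda>x. \<eta> *\<^sub>C A x)"
proof -
  have len: "length (filter (\<lambda>j. j \<noteq> i) [1..<S + 1]) = S - 1" if "i \<in> {1..S}" for i
  proof -
    have "length (filter (\<lambda>j. j \<noteq> i) [1..<S + 1]) = card ({1..<S + 1} - {i})"
      by (subst distinct_card[symmetric]) (auto intro!: arg_cong[of _ _ card] simp del: upt_Suc)
    then show ?thesis using that by simp
  qed
  have "(\<eta> *\<^sub>C A z) * prod_list (map (\<lambda>j. \<eta> *\<^sub>C A (u j)) [1..<S + 1]) =
      (\<eta> * \<eta> ^ S) *\<^sub>C (A z * prod_list (map (\<lambda>j. A (u j)) [1..<S + 1]))"
    by (simp add: prod_list_scl mult.commute del: upt_Suc)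
  also have "\<dots> = (\<eta> * \<delta>) *\<^sub>C ((FF z * (\<Prod>j = 1..S. g c z (u j))) *\<^sub>C (\<eta> ^ S *\<^sub>C prod_list (map (\<lambda>j. A (u j)) [1..<S + 1])) +
       (\<Sum>i = 1..S. (g c (u i) z * FF (u i) * (\<Prod>j \<in> {1..S} - {i}. g c (u i) (u j))) *\<^sub>C
          (\<eta> ^ S *\<^sub>C (A z * prod_list (map (\<lambda>j. A (u j)) (filter (\<lambda>j. j \<noteq> i) [1..<S + 1]))))))"
    unfolding assms[unfolded bethe_relation_def]
    by (simp add: scl_distribs scl_sum_right mult_ac del: upt_Suc)
  also have "(\<Sum>i = 1..S. (g c (u i) z * FF (u i) * (\<Prod>j \<in> {1..S} - {i}. g c (u i) (u j))) *\<^sub>C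
          (\<eta> ^ S *\<^sub>C (A z * prod_list (map (\<lambda>j. A (u j)) (filter (\<lambda>j. j \<noteq> i) [1..<S + 1]))))) =
     (\<Sum>i = 1..S. (g c (u i) z * FF (u i) * (\<Prod>j \<in> {1..S} - {i}. g c (u i) (u j))) *\<^sub>C
          ((\<eta> *\<^sub>C A z) * prod_list (map (\<lambda>j. \<eta> *\<^sub>C A (u j)) (filter (\<lambda>j. j \<noteq> i) [1..<S + 1]))))"
  proof (rule sum.cong)
    fix i assume i: "i \<in> {1..S}"
    then have "\<eta> ^ S = \<eta> * \<eta> ^ (S - 1)" by (cases S) auto
    then show "(g c (u i) z * FF (u i) * (\<Prod>j \<in> {1..S} - {i}. g c (u i) (u j))) *\<^sub>C
          (\<eta> ^ S *\<^sub>C (A z * prod_list (map (\<lambda>j. A (u j)) (filter (\<lambda>j. j \<noteq> i) [1..<S + 1])))) =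
       (g c (u i) z * FF (u i) * (\<Prod>j \<in> {1..S} - {i}. g c (u i) (u j))) *\<^sub>C
          ((\<eta> *\<^sub>C A z) * prod_list (map (\<lambda>j. \<eta> *\<^sub>C A (u j)) (filter (\<lambda>j. j \<noteq> i) [1..<S + 1])))"
      unfolding prod_list_scl len[OF i] by (simp add: mult_ac del: upt_Suc)
  qed simp
  also have "\<eta> ^ S *\<^sub>C prod_list (map (\<lambda>j. A (u j)) [1..<S + 1]) =
      prod_list (map (\<lambda>j. \<eta> *\<^sub>C A (u j)) [1..<S + 1])"
    unfolding prod_list_scl by (simp del: upt_Suc)
  finally show ?thesis by (simp add: bethe_relation_def)
qed

context graded_spin_chain
begin

lemma bethe_relation_t11_graded:
  assumes gen: "generic_inhomogeneities c N d \<theta>"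
    and S: "S = (\<Sum>i = 1..N. d i)" and inj: "inj_on u {1..S}" and z: "z \<notin> u ` {1..S}"
  shows "bethe_relation c S (F c N d \<theta>) z u 1 (\<lambda>x. omono c \<theta> s p m [1..<N + 1] x 1 1)"
proof -
  define A where "A x = omono c \<theta> s p m [1..<N + 1] x 1 1" for x
  let ?ul = "[1..<S + 1]"
  let ?c1 = "F c N d \<theta> z * (\<Prod>j = 1..S. g c z (u j))"
  let ?c2 = "\<lambda>i. g c (u i) z * F c N d \<theta> (u i) * (\<Prod>j \<in> {1..S} - {i}. g c (u i) (u j))"
  let ?P = "prod_list (map (\<lambda>j. A (u j)) ?ul)"
  let ?P' = "\<lambda>i. prod_list (map (\<lambda>j. A (u j)) (filter (\<lambda>j. j \<noteq> i) ?ul))"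
  define X where "X = A z * ?P - (?c1 *\<^sub>C ?P + (\<Sum>i = 1..S. ?c2 i *\<^sub>C (A z * ?P' i)))"
  have tri: "triangular (A x) (t11_weight \<theta> x)" for x
    unfolding A_def by (rule triangular_t11)
  have AA: "A x * A y = A y * A x" for x y
    unfolding A_def by (rule rtt_commute[OF rtt_omono]) (auto simp: c_nonzero simp del: upt_Suc)

  have diag: "t11_weight \<theta> z \<kappa> * prod_list (map (\<lambda>j. t11_weight \<theta> (u j) \<kappa>) ?ul) -
      (?c1 * prod_list (map (\<lambda>j. t11_weight \<theta> (u j) \<kappa>) ?ul) +
       (\<Sum>i = 1..S. ?c2 i * (t11_weight \<theta> z \<kappa> *
          prod_list (map (\<lambda>j. t11_weight \<theta> (u j) \<kappa>) (filter (\<lambda>j. j \<noteq> i) ?ul))))) = 0"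
    if \<kappa>: "\<kappa> \<in> K" for \<kappa>
  proof -
    \<comment> \<open>The factor of \<open>F\<close> with indices \<open>i\<close>, \<open>k\<close>
      is \<open>(x + r i k) / c\<close>. Those with \<open>k = \<kappa> i\<close> make up
      \<open>t11_weight\<close>; the other \<open>d i\<close> factors at each site form the monic
      polynomial \<open>q\<close> of degree \<open>S\<close>, over \<open>c ^ S\<close>.\<close>
    define r where "r i k = - \<theta> i + c * (of_nat (d i) / 2 - of_nat k + 1 / 2)" for i k
    define q where "q = (\<Prod>i = 1..N. \<Prod>k\<in>{0..d i} - {\<kappa> i}. [:r i k, 1:])"
    have \<kappa>i: "\<kappa> i \<in> {0..d i}" if "i \<in> {1..N}" for i using \<kappa> that by (auto simp: K_def)
    have "degree (\<Prod>k\<in>{0..d i} - {\<kappa> i}. [:r i k, 1:]) = d i" if "i \<in> {1..N}" for i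
      using \<kappa>i[OF that] by (subst degree_prod_eq_sum_degree) auto
    then have degq: "degree q = S"
      unfolding q_def S by (subst degree_prod_eq_sum_degree) auto
    have leadq: "lead_coeff q = 1" by (simp add: q_def lead_coeff_prod)
    have "F c N d \<theta> x = t11_weight \<theta> x \<kappa> * (poly q x / c ^ S)" for x
    proof -
      have "F c N d \<theta> x = (\<Prod>i = 1..N. ((x - \<theta> i) / c + 1 / 2 + wt i (\<kappa> i)) *
          (\<Prod>k\<in>{0..d i} - {\<kappa> i}. poly [:r i k, 1:] x / c))"
        unfolding F_def
      proof (rule prod.cong)
        fix i assume i: "i \<in> {1..N}"
        have "(x - \<theta> i + c * (of_nat (d i) / 2 - of_nat k + 1 / 2)) / c = poly [:r i k, 1:] x / c" for k
          by (simp add: r_def algebra_simps)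
        moreover have "(x - \<theta> i + c * (of_nat (d i) / 2 - of_nat (\<kappa> i) + 1 / 2)) / c =
            (x - \<theta> i) / c + 1 / 2 + wt i (\<kappa> i)"
          using c_nonzero by (simp add: wt_def field_simps)
        ultimately show "(\<Prod>k = 0..d i. (x - \<theta> i + c * (of_nat (d i) / 2 - of_nat k + 1 / 2)) / c) =
            ((x - \<theta> i) / c + 1 / 2 + wt i (\<kappa> i)) * (\<Prod>k\<in>{0..d i} - {\<kappa> i}. poly [:r i k, 1:] x / c)"
          using prod.remove[OF _ \<kappa>i[OF i],
            of "\<lambda>k. (x - \<theta> i + c * (of_nat (d i) / 2 - of_nat k + 1 / 2)) / c"]
          by (simp only: finite_atLeastAtMost)
      qed simp
      also have "\<dots> = t11_weight \<theta> x \<kappa> * (\<Prod>i = 1..N. \<Prod>k\<in>{0..d i} - {\<kappa> i}. poly [:r i k, 1:] x / c)"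
        by (simp add: t11_weight_def prod.distrib)
      also have "(\<Prod>i = 1..N. \<Prod>k\<in>{0..d i} - {\<kappa> i}. poly [:r i k, 1:] x / c) =
          poly q x / (\<Prod>i = 1..N. \<Prod>k\<in>{0..d i} - {\<kappa> i}. c)"
        by (simp add: q_def poly_prod prod_dividef)
      also have "(\<Prod>i = 1..N. \<Prod>k\<in>{0..d i} - {\<kappa> i}. c) = (\<Prod>i = 1..N. c ^ d i)"
        using \<kappa>i by (intro prod.cong) auto
      also have "\<dots> = c ^ S" by (simp add: S power_sum)
      finally show ?thesis .
    qed
    from lagrange_identity[where pp = "\<lambda>x. t11_weight \<theta> x \<kappa>", OF c_nonzero inj z degq leadq this]
    have "t11_weight \<theta> z \<kappa> * (\<Prod>j = 1..S. t11_weight \<theta> (u j) \<kappa>) =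
      ?c1 * (\<Prod>j = 1..S. t11_weight \<theta> (u j) \<kappa>) +
      (\<Sum>i = 1..S. ?c2 i * (t11_weight \<theta> z \<kappa> * (\<Prod>j\<in>{1..S} - {i}. t11_weight \<theta> (u j) \<kappa>)))"
      by (simp only: g_def)
    moreover have "prod_list (map f ?ul) = (\<Prod>j = 1..S. f j)" for f :: "nat \<Rightarrow> complex"
      by (subst prod.distinct_set_conv_list[symmetric]) (auto intro: prod.cong)
    moreover have "prod_list (map f (filter (\<lambda>j. j \<noteq> i) ?ul)) = (\<Prod>j\<in>{1..S} - {i}. f j)"
      for f :: "nat \<Rightarrow> complex" and i
      by (subst prod.distinct_set_conv_list[symmetric]) (auto intro!: prod.cong simp del: upt_Suc)
    ultimately show ?thesis by (simp only: cancel_comm_monoid_add_class.diff_cancel)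
  qed
  have "X = 0"
  proof (rule strictly_triangular_eq_0[where A = A and \<chi> = "t11_weight \<theta>"])
    have "triangular X (\<lambda>\<kappa>. t11_weight \<theta> z \<kappa> * prod_list (map (\<lambda>j. t11_weight \<theta> (u j) \<kappa>) ?ul) -
      (?c1 * prod_list (map (\<lambda>j. t11_weight \<theta> (u j) \<kappa>) ?ul) +
       (\<Sum>i = 1..S. ?c2 i * (t11_weight \<theta> z \<kappa> *
          prod_list (map (\<lambda>j. t11_weight \<theta> (u j) \<kappa>) (filter (\<lambda>j. j \<noteq> i) ?ul))))))"
      unfolding X_def
      by (intro triangular_diff triangular_add triangular_sum triangular_scl triangular_mult
          triangular_prod_list tri)
    then show "triangular X (\<lambda>_. 0)"
      using diag by (simp add: triangular_def)
    show "triangular (A w) (t11_weight \<theta> w)" for w by (rule tri)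
    show "X * A w = A w * X" for w
    proof -
      have P: "A w * prod_list (map (\<lambda>j. A (u j)) xs) = prod_list (map (\<lambda>j. A (u j)) xs) * A w" for xs
        by (intro prod_list_commute AA)
      have P2: "A w * (A z * prod_list (map (\<lambda>j. A (u j)) xs)) = A z * prod_list (map (\<lambda>j. A (u j)) xs) * A w" for xs
        using P[of xs] AA[of w z] by (metis mult.assoc)
      show ?thesis
        unfolding X_def
        by (simp add: left_diff_distrib right_diff_distrib distrib_left distrib_right
            sum_distrib_left sum_distrib_right P P2 del: upt_Suc)
    qed
    fix \<kappa> \<eta> assume K: "\<kappa> \<in> K" "\<eta> \<in> K" "\<kappa> \<noteq> \<eta>"
    obtain i where i: "i \<in> {1..N}" "\<kappa> i \<noteq> \<eta> i"
      using K unfolding K_def by (metis PiE_ext)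
    \<comment> \<open>The zero of the factor of \<open>t11_weight \<theta> w \<kappa>\<close> at a
      site \<open>i\<close> where the weights differ. A zero of
      \<open>t11_weight \<theta> w \<eta>\<close> at the same point would come from site
      \<open>i\<close>, giving \<open>\<kappa> i = \<eta> i\<close>, or from another site, against
      genericity.\<close>
    define w where "w = \<theta> i - c * (of_nat (d i) / 2 - of_nat (\<kappa> i) + 1 / 2)"
    have "(w - \<theta> i) / c + 1 / 2 + wt i (\<kappa> i) = 0"
      using c_nonzero by (simp add: w_def wt_def field_simps)
    then have "t11_weight \<theta> w \<kappa> = 0" using i by (auto simp: t11_weight_def)
    moreover have "(w - \<theta> j) / c + 1 / 2 + wt j (\<eta> j) \<noteq> 0" if j: "j \<in> {1..N}" for j
    proof
      assume "(w - \<theta> j) / c + 1 / 2 + wt j (\<eta> j) = 0"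
      then have w': "w = \<theta> j - c * (of_nat (d j) / 2 - of_nat (\<eta> j) + 1 / 2)"
      proof -
        have "w - \<theta> j = c * ((w - \<theta> j) / c)" using c_nonzero by simp
        also have "(w - \<theta> j) / c = - (1 / 2 + wt j (\<eta> j))"
          using \<open>(w - \<theta> j) / c + 1 / 2 + wt j (\<eta> j) = 0\<close>
          by (simp only: eq_neg_iff_add_eq_0 add.assoc)
        finally show ?thesis by (simp add: wt_def algebra_simps)
      qed
      show False
      proof (cases "j = i")
        case True
        then show False using w' i c_nonzero by (simp add: w_def)
      next
        case False
        have k: "\<kappa> i \<in> {0..d i}" and l: "\<eta> j \<in> {0..d j}" using K i j by (auto simp: K_def)
        show False
          using gen[unfolded generic_inhomogeneities_def, THEN bspec, OF i(1), THEN bspec, OF j,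
              THEN bspec, OF k, THEN bspec, OF l] False w' unfolding w_def by simp
      qed
    qed
    then have "t11_weight \<theta> w \<eta> \<noteq> 0" by (simp add: t11_weight_def)
    ultimately show "\<exists>w. t11_weight \<theta> w \<kappa> \<noteq> t11_weight \<theta> w \<eta>" by metis
  qed
  then show ?thesis by (simp add: X_def bethe_relation_def A_def)
qed

end

lemma (in weighted_spin_chain) bethe_relation_t11:
  assumes "generic_inhomogeneities c N d \<theta>"
    and "S = (\<Sum>i = 1..N. d i)" "inj_on u {1..S}" "z \<notin> u ` {1..S}"
  shows "bethe_relation c S (F c N d \<theta>) z u 1 (\<lambda>x. omono c \<theta> s p m [1..<N + 1] x 1 1)"
proof -
  obtain E where E: "weight_grading K E"
    "\<And>\<kappa> i. \<kappa> \<in> K \<Longrightarrow> i \<in> {1..N} \<Longrightarrow> s i * E \<kappa> = wt i (\<kappa> i) *\<^sub>C E \<kappa>"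
    "\<And>\<kappa> i. \<kappa> \<in> K \<Longrightarrow> i \<in> {1..N} \<Longrightarrow> E \<kappa> * s i = wt i (\<kappa> i) *\<^sub>C E \<kappa>"
    by (rule weight_gradingE) blast
  interpret weight_grading K E level by (rule E(1))
  interpret graded_spin_chain c N s p m d E
    using E(2,3) by unfold_locales
  show ?thesis using assms by (rule bethe_relation_t11_graded)
qed

subsection \<open>Operators at one site\<close>

definition site :: "nat \<Rightarrow> (nat \<Rightarrow> nat) \<Rightarrow> nat \<Rightarrow> complex mat \<Rightarrow> operator" where
  "site N d i A = emb (chain_dim N d) (at_site N d i A)"

lemma site_add:
  assumes "i \<in> {1..N}" "A \<in> carrier_mat (d i + 1) (d i + 1)" "B \<in> carrier_mat (d i + 1) (d i + 1)"
  shows "site N d i (A + B) = site N d i A + site N d i B"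
  using assms at_site_carrier[of i N _ d, OF assms(1)]
  by (simp add: site_def at_site_add emb_add[OF _ _ chain_dim_pos])

lemma site_mult:
  assumes "i \<in> {1..N}" "A \<in> carrier_mat (d i + 1) (d i + 1)" "B \<in> carrier_mat (d i + 1) (d i + 1)"
  shows "site N d i (A * B) = site N d i A * site N d i B"
  using assms at_site_carrier[of i N _ d, OF assms(1)]
  by (simp add: site_def at_site_mult emb_mult[OF _ _ chain_dim_pos])

lemma site_smult:
  assumes "i \<in> {1..N}" "A \<in> carrier_mat (d i + 1) (d i + 1)"
  shows "site N d i (a \<cdot>\<^sub>m A) = a *\<^sub>C site N d i A"
  using assms at_site_carrier[of i N _ d, OF assms(1)]
  by (simp add: site_def at_site_smult emb_smult[OF _ chain_dim_pos])

lemma site_uminus: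
  assumes "i \<in> {1..N}" "A \<in> carrier_mat (d i + 1) (d i + 1)"
  shows "site N d i (- A) = - site N d i A"
proof -
  have "- A = (- 1) \<cdot>\<^sub>m A" by (auto intro!: eq_matI)
  then show ?thesis using site_smult[of i N A d "- 1"] assms by (simp add: scl_minus_left)
qed

lemma site_minus:
  assumes "i \<in> {1..N}" "A \<in> carrier_mat (d i + 1) (d i + 1)" "B \<in> carrier_mat (d i + 1) (d i + 1)"
  shows "site N d i (A - B) = site N d i A - site N d i B"
proof -
  have "A - B = A + - B" using assms by (auto intro!: eq_matI)
  then show ?thesis
    using site_add[of i N A d "- B"] site_uminus[of i N B d] assms by simp
qed

lemma site_one: "i \<in> {1..N} \<Longrightarrow> site N d i (1\<^sub>m (d i + 1)) = 1"
  unfolding site_def by (simp only: at_site_one emb_one[OF chain_dim_pos])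

lemma site_zero: "i \<in> {1..N} \<Longrightarrow> site N d i (0\<^sub>m (d i + 1) (d i + 1)) = 0"
  using site_smult[of i N "0\<^sub>m (d i + 1) (d i + 1)" d 0] by simp

lemma site_op_prod:
  assumes i: "i \<in> {1..N}" and f: "\<And>x. x \<in> set xs \<Longrightarrow> f x \<in> carrier_mat (d i + 1) (d i + 1)"
  shows "site N d i (op_prod (d i + 1) f xs) = prod_list (map (\<lambda>x. site N d i (f x)) xs)"
  using f
proof (induction xs)
  case Nil
  then show ?case using site_one[OF i] by (simp add: op_prod_def)
next
  case (Cons x xs)
  have "op_prod (d i + 1) f (x # xs) = f x * op_prod (d i + 1) f xs" by (simp add: op_prod_def)
  then show ?case
    using Cons site_mult[OF i, of "f x" d "op_prod (d i + 1) f xs"] op_prod_carrier[of xs f "d i + 1"]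
    by simp
qed

lemma site_commute:
  assumes "i \<in> {1..N}" "j \<in> {1..N}" "i \<noteq> j"
    and "A \<in> carrier_mat (d i + 1) (d i + 1)" and "B \<in> carrier_mat (d j + 1) (d j + 1)"
  shows "site N d i A * site N d j B = site N d j B * site N d i A"
  using at_site_commute[of i N j A d B] at_site_carrier[of i N A d] at_site_carrier[of j N B d] assms
  unfolding site_def by (metis chain_dim_pos emb_mult)

lemma site_lin_comb3:
  assumes "i \<in> {1..N}" "A \<in> carrier_mat (d i + 1) (d i + 1)" "B \<in> carrier_mat (d i + 1) (d i + 1)"
    "C \<in> carrier_mat (d i + 1) (d i + 1)"
  shows "site N d i (lin_comb3 x y z A B C) = x *\<^sub>C site N d i A + y *\<^sub>C site N d i B + z *\<^sub>C site N d i C"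
  using assms unfolding lin_comb3_def
  by (simp add: site_add site_smult)

lemma weighted_spin_chain_of_reps:
  assumes c: "c \<noteq> 0" and rep: "\<And>i. i \<in> {1..N} \<Longrightarrow> spin_rep (d i) (S3 i) (Sp i) (Sm i)"
  shows "weighted_spin_chain c N (\<lambda>i. site N d i (S3 i)) (\<lambda>i. site N d i (Sp i)) (\<lambda>i. site N d i (Sm i)) d"
proof
  show "c \<noteq> 0" by (rule c)
  fix i assume i: "i \<in> {1..N}"
  note r = spin_repD[OF rep[OF i]]
  note hom = site_add[of i N _ d, OF i] site_mult[of i N _ d, OF i] site_smult[of i N _ d, OF i]
    site_minus[of i N _ d, OF i] site_uminus[of i N _ d, OF i]
  show "site N d i (Sp i) * site N d i (Sm i) - site N d i (Sm i) * site N d i (Sp i) = 2 *\<^sub>C site N d i (S3 i)"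
    using r(1-3) r(4)[THEN arg_cong[of _ _ "site N d i"]]
    by (simp add: hom)
  show "site N d i (S3 i) * site N d i (Sp i) - site N d i (Sp i) * site N d i (S3 i) = site N d i (Sp i)"
    using r(1-3) r(5)[THEN arg_cong[of _ _ "site N d i"]]
    by (simp add: hom)
  show "site N d i (S3 i) * site N d i (Sm i) - site N d i (Sm i) * site N d i (S3 i) = - site N d i (Sm i)"
    using r(1-3) r(6)[THEN arg_cong[of _ _ "site N d i"]]
    by (simp add: hom)
  let ?f = "\<lambda>k. S3 i - (of_nat (d i) / 2 - of_nat k) \<cdot>\<^sub>m 1\<^sub>m (d i + 1)"
  have f: "site N d i (?f k) = site N d i (S3 i) - (of_nat (d i) / 2 - of_nat k) *\<^sub>C 1" for k
    using r(1) site_one[OF i, of d] by (simp add: hom)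
  have "site N d i (op_prod (d i + 1) ?f [0..<d i + 1]) = prod_list (map (\<lambda>k. site N d i (?f k)) [0..<d i + 1])"
    using r(1) by (intro site_op_prod[OF i]) auto
  then show "prod_list (map (\<lambda>k. site N d i (S3 i) - (of_nat (d i) / 2 - of_nat k) *\<^sub>C 1) [0..<d i + 1]) = 0"
    unfolding spin_rep_weights[OF rep[OF i]] f site_zero[OF i] by simp
next
  fix i j X Y
  assume i: "i \<in> {1..N}" and j: "j \<in> {1..N}" and ij: "i \<noteq> j"
    and X: "X \<in> {site N d i (S3 i), site N d i (Sp i), site N d i (Sm i)}"
    and Y: "Y \<in> {site N d j (S3 j), site N d j (Sp j), site N d j (Sm j)}"
  obtain A B where "X = site N d i A" "A \<in> carrier_mat (d i + 1) (d i + 1)"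
    "Y = site N d j B" "B \<in> carrier_mat (d j + 1) (d j + 1)"
    using X Y spin_repD(1-3)[OF rep[OF i]] spin_repD(1-3)[OF rep[OF j]] by blast
  then show "X * Y = Y * X" using site_commute[OF i j ij] by simp
qed

subsection \<open>Rotating the auxiliary space\<close>

text \<open>The matrix \<open>G\<close> has first row \<open>a\<close>, and its second row
  annihilates the column \<open>b\<close>. Hence \<open>G b = \<delta> e\<close> with
  \<open>e\<close> the first unit vector, and \<open>G T = T' G\<close> gives
  \<open>a T b = \<delta> T' 1 1\<close>.\<close>

definition gauge :: "complex \<Rightarrow> complex \<Rightarrow> complex \<Rightarrow> complex \<Rightarrow> nat \<Rightarrow> nat \<Rightarrow> complex" where
  "gauge a1 a2 b1 b2 e f =
     (if e = 1 \<and> f = 1 then a1 else if e = 1 then a2 else if f = 1 then - b2 else b1)"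

text \<open>The intertwining relation \<open>G L = L' G\<close> in components, which avoids the
  inverse of \<open>G\<close>. The identities \<open>11\<close>, \<open>12\<close>,
  \<open>21\<close>, \<open>22\<close> in the proof are its entries, up to sign and the order of
  terms, without the scalar part, which commutes with \<open>G\<close>.\<close>

lemma gauge_olax:
  fixes s p m :: operator and a1 a2 b1 b2 :: complex
  defines "\<delta> \<equiv> a1 * b1 + a2 * b2"
  defines "s' \<equiv> ((a1 * b1 - a2 * b2) / \<delta>) *\<^sub>C s + (a2 * b1 / \<delta>) *\<^sub>C p + (a1 * b2 / \<delta>) *\<^sub>C m"
    and "p' \<equiv> (- 2 * b1 * b2 / \<delta>) *\<^sub>C s + (b1\<^sup>2 / \<delta>) *\<^sub>C p + (- b2\<^sup>2 / \<delta>) *\<^sub>C m"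
    and "m' \<equiv> (- 2 * a1 * a2 / \<delta>) *\<^sub>C s + (- a2\<^sup>2 / \<delta>) *\<^sub>C p + (a1\<^sup>2 / \<delta>) *\<^sub>C m"
  assumes \<delta>: "\<delta> \<noteq> 0" and ef: "e \<in> {1, 2}" "f \<in> {1, 2}"
  shows "gauge a1 a2 b1 b2 e 1 *\<^sub>C olax c s p m x 1 f + gauge a1 a2 b1 b2 e 2 *\<^sub>C olax c s p m x 2 f =
    gauge a1 a2 b1 b2 1 f *\<^sub>C olax c s' p' m' x e 1 + gauge a1 a2 b1 b2 2 f *\<^sub>C olax c s' p' m' x e 2"
proof -
  define y where "y = x / c + 1 / 2"
  have comb: "a *\<^sub>C (x1 *\<^sub>C s + y1 *\<^sub>C p + z1 *\<^sub>C m) + b *\<^sub>C (x2 *\<^sub>C s + y2 *\<^sub>C p + z2 *\<^sub>C m) =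
      (a * x1 + b * x2) *\<^sub>C s + (a * y1 + b * y2) *\<^sub>C p + (a * z1 + b * z2) *\<^sub>C m" for a b x1 x2 y1 y2 z1 z2
    by (simp add: scl_distribs algebra_simps)
  have coeffs: "x1 *\<^sub>C s + y1 *\<^sub>C p + z1 *\<^sub>C m = x2 *\<^sub>C s + y2 *\<^sub>C p + z2 *\<^sub>C m"
    if "\<delta> * x1 = \<delta> * x2" "\<delta> * y1 = \<delta> * y2" "\<delta> * z1 = \<delta> * z2" for x1 x2 y1 y2 z1 z2
    using that \<delta> by simp
  have 11: "a1 *\<^sub>C s + a2 *\<^sub>C p = a1 *\<^sub>C s' + (- b2) *\<^sub>C m'" unfolding s'_def m'_def comb
  proof -
    have "a1 *\<^sub>C s + a2 *\<^sub>C p = a1 *\<^sub>C s + a2 *\<^sub>C p + 0 *\<^sub>C m" by simp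
    also have "\<dots> = (a1 * ((a1 * b1 - a2 * b2) / \<delta>) + - b2 * (- 2 * a1 * a2 / \<delta>)) *\<^sub>C s +
      (a1 * (a2 * b1 / \<delta>) + - b2 * (- a2\<^sup>2 / \<delta>)) *\<^sub>C p +
      (a1 * (a1 * b2 / \<delta>) + - b2 * (a1\<^sup>2 / \<delta>)) *\<^sub>C m"
      by (rule coeffs) (use \<delta> in \<open>simp_all add: field_simps power2_eq_square\<close>,
        (simp add: \<delta>_def algebra_simps)+)
    finally show "a1 *\<^sub>C s + a2 *\<^sub>C p = \<dots>" .
  qed
  have 12: "a1 *\<^sub>C m - a2 *\<^sub>C s = a2 *\<^sub>C s' + b1 *\<^sub>C m'" unfolding s'_def m'_def comb
  proof -
    have "a1 *\<^sub>C m - a2 *\<^sub>C s = (- a2) *\<^sub>C s + 0 *\<^sub>C p + a1 *\<^sub>C m" by (simp add: scl_minus_left)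
    also have "\<dots> = (a2 * ((a1 * b1 - a2 * b2) / \<delta>) + b1 * (- 2 * a1 * a2 / \<delta>)) *\<^sub>C s +
      (a2 * (a2 * b1 / \<delta>) + b1 * (- a2\<^sup>2 / \<delta>)) *\<^sub>C p +
      (a2 * (a1 * b2 / \<delta>) + b1 * (a1\<^sup>2 / \<delta>)) *\<^sub>C m"
      by (rule coeffs) (use \<delta> in \<open>simp_all add: field_simps power2_eq_square\<close>,
        (simp add: \<delta>_def algebra_simps)+)
    finally show "a1 *\<^sub>C m - a2 *\<^sub>C s = \<dots>" .
  qed
  have 21: "b1 *\<^sub>C p - b2 *\<^sub>C s = a1 *\<^sub>C p' + b2 *\<^sub>C s'" unfolding s'_def p'_def comb
  proof -
    have "b1 *\<^sub>C p - b2 *\<^sub>C s = (- b2) *\<^sub>C s + b1 *\<^sub>C p + 0 *\<^sub>C m" by (simp add: scl_minus_left)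
    also have "\<dots> = (a1 * (- 2 * b1 * b2 / \<delta>) + b2 * ((a1 * b1 - a2 * b2) / \<delta>)) *\<^sub>C s +
      (a1 * (b1\<^sup>2 / \<delta>) + b2 * (a2 * b1 / \<delta>)) *\<^sub>C p +
      (a1 * (- b2\<^sup>2 / \<delta>) + b2 * (a1 * b2 / \<delta>)) *\<^sub>C m"
      by (rule coeffs) (use \<delta> in \<open>simp_all add: field_simps power2_eq_square\<close>,
        (simp add: \<delta>_def algebra_simps)+)
    finally show "b1 *\<^sub>C p - b2 *\<^sub>C s = \<dots>" .
  qed
  have 22: "b2 *\<^sub>C m + b1 *\<^sub>C s = b1 *\<^sub>C s' + (- a2) *\<^sub>C p'" unfolding s'_def p'_def comb
  proof -
    have "b2 *\<^sub>C m + b1 *\<^sub>C s = b1 *\<^sub>C s + 0 *\<^sub>C p + b2 *\<^sub>C m" by simp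
    also have "\<dots> = (b1 * ((a1 * b1 - a2 * b2) / \<delta>) + - a2 * (- 2 * b1 * b2 / \<delta>)) *\<^sub>C s +
      (b1 * (a2 * b1 / \<delta>) + - a2 * (b1\<^sup>2 / \<delta>)) *\<^sub>C p +
      (b1 * (a1 * b2 / \<delta>) + - a2 * (- b2\<^sup>2 / \<delta>)) *\<^sub>C m"
      by (rule coeffs) (use \<delta> in \<open>simp_all add: field_simps power2_eq_square\<close>,
        (simp add: \<delta>_def algebra_simps)+)
    finally show "b2 *\<^sub>C m + b1 *\<^sub>C s = \<dots>" .
  qed
  have eqs': "a2 *\<^sub>C p = a1 *\<^sub>C s' - b2 *\<^sub>C m' - a1 *\<^sub>C s" "a1 *\<^sub>C m = a2 *\<^sub>C s' + b1 *\<^sub>C m' + a2 *\<^sub>C s"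
    "b1 *\<^sub>C p = a1 *\<^sub>C p' + b2 *\<^sub>C s' + b2 *\<^sub>C s" "b2 *\<^sub>C m = b1 *\<^sub>C s' - a2 *\<^sub>C p' - b1 *\<^sub>C s"
    using 11 12 21 22 by (simp_all add: algebra_simps scl_minus_left)
  show ?thesis
    using ef unfolding olax_def y_def[symmetric]
    by (elim insertE emptyE; simp add: gauge_def scl_distribs eqs')
qed

text \<open>The matrix \<open>G\<close> moves through the product one site at a time:
  \<open>G L T = L' G T = L' T' G\<close>.\<close>

lemma gauge_omono:
  fixes G :: "nat \<Rightarrow> nat \<Rightarrow> complex"
  assumes lax: "\<And>i x e f. i \<in> set xs \<Longrightarrow> e \<in> {1, 2} \<Longrightarrow> f \<in> {1, 2} \<Longrightarrow>
      G e 1 *\<^sub>C olax c (s i) (p i) (m i) x 1 f + G e 2 *\<^sub>C olax c (s i) (p i) (m i) x 2 f =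
      G 1 f *\<^sub>C olax c (s' i) (p' i) (m' i) x e 1 + G 2 f *\<^sub>C olax c (s' i) (p' i) (m' i) x e 2"
    and "e \<in> {1, 2}" "f \<in> {1, 2}"
  shows "G e 1 *\<^sub>C omono c \<theta> s p m xs x 1 f + G e 2 *\<^sub>C omono c \<theta> s p m xs x 2 f =
      G 1 f *\<^sub>C omono c \<theta> s' p' m' xs x e 1 + G 2 f *\<^sub>C omono c \<theta> s' p' m' xs x e 2"
  using assms
proof (induction xs arbitrary: e f)
  case Nil
  then show ?case by (auto simp: omono_Nil)
next
  case (Cons i xs)
  let ?L = "olax c (s i) (p i) (m i) (x - \<theta> i)" and ?L' = "olax c (s' i) (p' i) (m' i) (x - \<theta> i)"
  let ?T = "omono c \<theta> s p m xs x" and ?T' = "omono c \<theta> s' p' m' xs x"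
  have L: "G e 1 *\<^sub>C ?L 1 h + G e 2 *\<^sub>C ?L 2 h = G 1 h *\<^sub>C ?L' e 1 + G 2 h *\<^sub>C ?L' e 2"
    if "h \<in> {1, 2}" for h
    using Cons.prems that by simp
  have T: "G h 1 *\<^sub>C ?T 1 f + G h 2 *\<^sub>C ?T 2 f = G 1 f *\<^sub>C ?T' h 1 + G 2 f *\<^sub>C ?T' h 2"
    if "h \<in> {1, 2}" for h
    using Cons.prems that by (intro Cons.IH) auto
  have "G e 1 *\<^sub>C omult ?L ?T 1 f + G e 2 *\<^sub>C omult ?L ?T 2 f =
      (G e 1 *\<^sub>C ?L 1 1 + G e 2 *\<^sub>C ?L 2 1) * ?T 1 f + (G e 1 *\<^sub>C ?L 1 2 + G e 2 *\<^sub>C ?L 2 2) * ?T 2 f"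
    by (simp add: omult_def scl_distribs algebra_simps)
  also have "\<dots> = ?L' e 1 * (G 1 1 *\<^sub>C ?T 1 f + G 1 2 *\<^sub>C ?T 2 f) + ?L' e 2 * (G 2 1 *\<^sub>C ?T 1 f + G 2 2 *\<^sub>C ?T 2 f)"
    using L[of 1] L[of 2] by (simp add: scl_distribs algebra_simps)
  also have "\<dots> = G 1 f *\<^sub>C omult ?L' ?T' e 1 + G 2 f *\<^sub>C omult ?L' ?T' e 2"
    using T[of 1] T[of 2] by (simp add: omult_def scl_distribs algebra_simps)
  finally show ?case unfolding omono_Cons .
qed

definition sandwich :: "complex \<Rightarrow> complex \<Rightarrow> complex \<Rightarrow> complex \<Rightarrow> (nat \<Rightarrow> nat \<Rightarrow> operator) \<Rightarrow> operator" where
  "sandwich a1 a2 b1 b2 T =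
     (a1 * b1) *\<^sub>C T 1 1 + (a1 * b2) *\<^sub>C T 1 2 + (a2 * b1) *\<^sub>C T 2 1 + (a2 * b2) *\<^sub>C T 2 2"

lemma bethe_relation_generic:
  assumes c: "c \<noteq> 0" and rep: "\<And>i. i \<in> {1..N} \<Longrightarrow> spin_rep (d i) (S3 i) (Sp i) (Sm i)"
    and del: "a1 * b1 + a2 * b2 \<noteq> 0" and gen: "generic_inhomogeneities c N d \<theta>"
    and S: "S = (\<Sum>i = 1..N. d i)" and inj: "inj_on u {1..S}" and z: "z \<notin> u ` {1..S}"
  shows "bethe_relation c S (F c N d \<theta>) z u (a1 * b1 + a2 * b2)
    (\<lambda>x. sandwich a1 a2 b1 b2 (omono c \<theta> (\<lambda>i. site N d i (S3 i)) (\<lambda>i. site N d i (Sp i))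
       (\<lambda>i. site N d i (Sm i)) [1..<N + 1] x))"
proof -
  define R3 Rp Rm where "R3 i = rot3 a1 a2 b1 b2 (S3 i) (Sp i) (Sm i)"
    and "Rp i = rotp a1 a2 b1 b2 (S3 i) (Sp i) (Sm i)"
    and "Rm i = rotm a1 a2 b1 b2 (S3 i) (Sp i) (Sm i)" for i
  have rot: "spin_rep (d i) (R3 i) (Rp i) (Rm i)" if "i \<in> {1..N}" for i
    unfolding R3_def Rp_def Rm_def using rep[OF that] del by (rule spin_rep_rot)
  interpret R: weighted_spin_chain c N "\<lambda>i. site N d i (R3 i)" "\<lambda>i. site N d i (Rp i)" "\<lambda>i. site N d i (Rm i)" d
    using c rot by (rule weighted_spin_chain_of_reps)
  define T where "T x = omono c \<theta> (\<lambda>i. site N d i (S3 i)) (\<lambda>i. site N d i (Sp i))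
       (\<lambda>i. site N d i (Sm i)) [1..<N + 1] x" for x
  define T' where "T' x = omono c \<theta> (\<lambda>i. site N d i (R3 i)) (\<lambda>i. site N d i (Rp i))
       (\<lambda>i. site N d i (Rm i)) [1..<N + 1] x" for x
  let ?G = "gauge a1 a2 b1 b2"
  have GT: "?G e 1 *\<^sub>C T x 1 f + ?G e 2 *\<^sub>C T x 2 f = ?G 1 f *\<^sub>C T' x e 1 + ?G 2 f *\<^sub>C T' x e 2"
    if "e \<in> {1, 2}" "f \<in> {1, 2}" for x e f
    unfolding T_def T'_def
  proof (rule gauge_omono[OF _ that])
    fix i y and e f :: nat
    assume i: "i \<in> set [1..<N + 1]" and ef: "e \<in> {1, 2}" "f \<in> {1, 2}"
    then have i': "i \<in> {1..N}" by auto
    note car = spin_repD(1-3)[OF rep[OF i']]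
    show "?G e 1 *\<^sub>C olax c (site N d i (S3 i)) (site N d i (Sp i)) (site N d i (Sm i)) y 1 f +
        ?G e 2 *\<^sub>C olax c (site N d i (S3 i)) (site N d i (Sp i)) (site N d i (Sm i)) y 2 f =
        ?G 1 f *\<^sub>C olax c (site N d i (R3 i)) (site N d i (Rp i)) (site N d i (Rm i)) y e 1 +
        ?G 2 f *\<^sub>C olax c (site N d i (R3 i)) (site N d i (Rp i)) (site N d i (Rm i)) y e 2"
      unfolding R3_def Rp_def Rm_def rot3_def rotp_def rotm_def site_lin_comb3[of i N _ d, OF i' car]
      by (rule gauge_olax[OF del ef])
  qed
  have "sandwich a1 a2 b1 b2 (T x) = (a1 * b1 + a2 * b2) *\<^sub>C T' x 1 1" for x
  proof -
    have "sandwich a1 a2 b1 b2 (T x) = b1 *\<^sub>C (a1 *\<^sub>C T x 1 1 + a2 *\<^sub>C T x 2 1) + b2 *\<^sub>C (a1 *\<^sub>C T x 1 2 + a2 *\<^sub>C T x 2 2)"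
      by (simp add: sandwich_def scl_distribs algebra_simps)
    \<comment> \<open>The first row of \<open>G T = T' G\<close>; on multiplication with
      \<open>b\<close> the terms with \<open>T' x 1 2\<close> cancel.\<close>
    also have "\<dots> = b1 *\<^sub>C (a1 *\<^sub>C T' x 1 1 - b2 *\<^sub>C T' x 1 2) + b2 *\<^sub>C (a2 *\<^sub>C T' x 1 1 + b1 *\<^sub>C T' x 1 2)"
      using GT[of 1 1 x] GT[of 1 2 x] by (simp add: gauge_def scl_minus_left)
    also have "\<dots> = (a1 * b1 + a2 * b2) *\<^sub>C T' x 1 1"
      by (simp add: scl_distribs algebra_simps)
    finally show ?thesis .
  qed
  moreover have "bethe_relation c S (F c N d \<theta>) z u 1 (\<lambda>x. T' x 1 1)"
    unfolding T'_def using gen S inj z by (rule R.bethe_relation_t11)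
  ultimately show ?thesis
    unfolding T_def[symmetric] using bethe_relation_scl[of c S _ z u 1] by simp
qed

subsection \<open>Polynomial families of operators\<close>

text \<open>The coefficients lie in a noncommutative ring, so a polynomial is given by its
  coefficient sequence; the variable is a scalar and commutes with everything.\<close>

definition polynomial_family :: "(complex \<Rightarrow> operator) \<Rightarrow> bool" where
  "polynomial_family f \<longleftrightarrow> (\<exists>n a. \<forall>\<epsilon>. f \<epsilon> = (\<Sum>k<n. \<epsilon> ^ k *\<^sub>C a k))"

lemma polynomial_family_const: "polynomial_family (\<lambda>_. X)"
  unfolding polynomial_family_def by (intro exI[of _ 1] exI[of _ "\<lambda>_. X"]) simp

lemma polynomial_family_add:
  assumes "polynomial_family f" "polynomial_family h"
  shows "polynomial_family (\<lambda>\<epsilon>. f \<epsilon> + h \<epsilon>)"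
proof -
  obtain n a n' a' where f: "\<And>\<epsilon>. f \<epsilon> = (\<Sum>k<n. \<epsilon> ^ k *\<^sub>C a k)" and h: "\<And>\<epsilon>. h \<epsilon> = (\<Sum>k<n'. \<epsilon> ^ k *\<^sub>C a' k)"
    using assms unfolding polynomial_family_def by blast
  have pad: "(\<Sum>k<n. \<epsilon> ^ k *\<^sub>C a k) = (\<Sum>k<n + n'. \<epsilon> ^ k *\<^sub>C (if k < n then a k else 0))"
    for n n' and a :: "nat \<Rightarrow> operator" and \<epsilon>
    by (rule sum.mono_neutral_cong_left) auto
  have "f \<epsilon> + h \<epsilon> = (\<Sum>k<n + n'. \<epsilon> ^ k *\<^sub>C ((if k < n then a k else 0) + (if k < n' then a' k else 0)))" for \<epsilon>
    unfolding f h pad[of \<epsilon> a n n'] pad[of \<epsilon> a' n' n] by (simp add: scl_distribs sum.distrib add.commute)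
  then show ?thesis
    unfolding polynomial_family_def
    by (intro exI[of _ "n + n'"] exI[of _ "\<lambda>k. (if k < n then a k else 0) + (if k < n' then a' k else 0)"] allI)
qed

lemma polynomial_family_mult_left:
  assumes "polynomial_family f"
  shows "polynomial_family (\<lambda>\<epsilon>. X * f \<epsilon>)"
proof -
  obtain n a where "\<And>\<epsilon>. f \<epsilon> = (\<Sum>k<n. \<epsilon> ^ k *\<^sub>C a k)"
    using assms unfolding polynomial_family_def by blast
  then have "X * f \<epsilon> = (\<Sum>k<n. \<epsilon> ^ k *\<^sub>C (X * a k))" for \<epsilon>
    by (simp add: sum_distrib_left)
  then show ?thesis
    unfolding polynomial_family_def by (intro exI[of _ n] exI[of _ "\<lambda>k. X * a k"] allI)
qed

lemma polynomial_family_shift: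
  assumes "polynomial_family f"
  shows "polynomial_family (\<lambda>\<epsilon>. \<epsilon> *\<^sub>C f \<epsilon>)"
proof -
  obtain n a where f: "\<And>\<epsilon>. f \<epsilon> = (\<Sum>k<n. \<epsilon> ^ k *\<^sub>C a k)"
    using assms unfolding polynomial_family_def by blast
  have "\<epsilon> *\<^sub>C f \<epsilon> = (\<Sum>k<Suc n. \<epsilon> ^ k *\<^sub>C (case k of 0 \<Rightarrow> 0 | Suc j \<Rightarrow> a j))" for \<epsilon>
    unfolding sum.lessThan_Suc_shift by (simp add: f scl_sum_right)
  then show ?thesis
    unfolding polynomial_family_def
    by (intro exI[of _ "Suc n"] exI[of _ "\<lambda>k. case k of 0 \<Rightarrow> 0 | Suc j \<Rightarrow> a j"] allI)
qed

lemma polynomial_family_scl: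
  assumes "polynomial_family f"
  shows "polynomial_family (\<lambda>\<epsilon>. poly q \<epsilon> *\<^sub>C f \<epsilon>)"
proof (induction q)
  case 0
  show ?case using polynomial_family_const[of 0] by simp
next
  case (pCons a q)
  have "polynomial_family (\<lambda>\<epsilon>. (a *\<^sub>C 1) * f \<epsilon> + \<epsilon> *\<^sub>C (poly q \<epsilon> *\<^sub>C f \<epsilon>))"
    by (intro polynomial_family_add polynomial_family_mult_left polynomial_family_shift assms pCons.IH)
  then show ?case by (simp add: scl_add_left)
qed

lemma polynomial_family_sum:
  "(\<And>i. i \<in> A \<Longrightarrow> polynomial_family (f i)) \<Longrightarrow> polynomial_family (\<lambda>\<epsilon>. \<Sum>i\<in>A. f i \<epsilon>)"
  by (induction A rule: infinite_finite_induct) (auto intro: polynomial_family_const polynomial_family_add)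

lemma polynomial_family_mult:
  assumes "polynomial_family f" "polynomial_family h"
  shows "polynomial_family (\<lambda>\<epsilon>. f \<epsilon> * h \<epsilon>)"
proof -
  obtain n a where "\<And>\<epsilon>. f \<epsilon> = (\<Sum>k<n. \<epsilon> ^ k *\<^sub>C a k)"
    using assms unfolding polynomial_family_def by blast
  then have eq: "f \<epsilon> * h \<epsilon> = (\<Sum>k<n. poly (monom 1 k) \<epsilon> *\<^sub>C (a k * h \<epsilon>))" for \<epsilon>
    by (simp add: sum_distrib_right poly_monom)
  show ?thesis
    unfolding eq
    by (intro polynomial_family_sum polynomial_family_scl polynomial_family_mult_left assms(2))
qed

lemma polynomial_family_diff:
  assumes "polynomial_family f" "polynomial_family h"
  shows "polynomial_family (\<lambda>\<epsilon>. f \<epsilon> - h \<epsilon>)"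
  using polynomial_family_add[OF assms(1) polynomial_family_mult_left[OF assms(2), of "- 1"]] by simp

lemma polynomial_family_prod_list:
  "(\<And>x. x \<in> set xs \<Longrightarrow> polynomial_family (f x)) \<Longrightarrow>
    polynomial_family (\<lambda>\<epsilon>. prod_list (map (\<lambda>x. f x \<epsilon>) xs))"
  by (induction xs) (auto intro: polynomial_family_const polynomial_family_mult)

text \<open>Each number \<open>app (f \<epsilon>) x j\<close> is an ordinary complex polynomial in
  \<open>\<epsilon>\<close> with infinitely many roots.\<close>

lemma polynomial_family_zero:
  assumes f: "polynomial_family f" and fin: "finite {\<epsilon>. f \<epsilon> \<noteq> 0}"
  shows "f \<epsilon> = 0"
proof -
  obtain n a where f: "\<And>\<epsilon>. f \<epsilon> = (\<Sum>k<n. \<epsilon> ^ k *\<^sub>C a k)"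
    using f unfolding polynomial_family_def by blast
  have app_sum: "app (\<Sum>k\<in>A. X k) x j = (\<Sum>k\<in>A. app (X k) x j)"
    for A :: "nat set" and X :: "nat \<Rightarrow> operator" and x j
    by (induction A rule: infinite_finite_induct) (simp_all add: zero_operator.rep_eq plus_operator.rep_eq)
  have "app (f \<epsilon>) x j = app 0 x j" for x j
  proof -
    define q where "q = (\<Sum>k<n. monom (app (a k) x j) k)"
    have q: "app (f \<epsilon>) x j = poly q \<epsilon>" for \<epsilon>
      by (simp add: f q_def app_sum scl.rep_eq poly_sum poly_monom mult.commute)
    have "- {\<epsilon>. f \<epsilon> \<noteq> 0} \<subseteq> {\<epsilon>. poly q \<epsilon> = 0}"
    proof
      fix \<epsilon> assume "\<epsilon> \<in> - {\<epsilon>. f \<epsilon> \<noteq> 0}"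
      then show "\<epsilon> \<in> {\<epsilon>. poly q \<epsilon> = 0}" using q[of \<epsilon>] by (simp add: zero_operator.rep_eq)
    qed
    moreover have "infinite (- {\<epsilon>. f \<epsilon> \<noteq> 0})"
      using fin finite_compl infinite_UNIV_char_0 by auto
    ultimately have "q = 0" using poly_roots_finite finite_subset by blast
    then show ?thesis by (simp add: q zero_operator.rep_eq)
  qed
  then show ?thesis by (intro app_inject[THEN iffD1] ext)
qed

lemma polynomial_family_olax:
  assumes "\<And>\<epsilon>. (x \<epsilon>) / c = poly q \<epsilon>"
  shows "polynomial_family (\<lambda>\<epsilon>. olax c s p m (x \<epsilon>) a b)"
proof -
  have "polynomial_family (\<lambda>\<epsilon>. poly (q + [:1 / 2:]) \<epsilon> *\<^sub>C 1)"
    by (intro polynomial_family_scl polynomial_family_const)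
  then have "polynomial_family (\<lambda>\<epsilon>. (x \<epsilon> / c + 1 / 2) *\<^sub>C 1)"
    by (simp add: assms)
  then show ?thesis
    unfolding olax_def
    by (cases "a = 1"; cases "b = 1"; cases "a = 2"; cases "b = 2";
      simp add: polynomial_family_const polynomial_family_add polynomial_family_diff)
qed

lemma polynomial_family_omono:
  assumes c: "c \<noteq> 0"
  shows "polynomial_family (\<lambda>\<epsilon>. omono c (\<lambda>i. \<theta> i + \<epsilon> * (of_nat i * c)) s p m xs x a b)"
proof (induction xs arbitrary: a b)
  case Nil
  then show ?case by (simp add: omono_Nil polynomial_family_const)
next
  case (Cons i xs)
  have "(x - (\<theta> i + \<epsilon> * (of_nat i * c))) / c = poly [:(x - \<theta> i) / c, - of_nat i:] \<epsilon>" for \<epsilon>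
    using c by (simp add: field_simps)
  note lax = polynomial_family_olax[OF this]
  show ?case
    unfolding omono_Cons omult_def
    by (intro polynomial_family_add polynomial_family_mult lax Cons.IH)
qed

section \<open>Perturbation of the inhomogeneities and of the column vector\<close>

lemma F_perturbed:
  assumes c: "c \<noteq> 0"
  shows "\<exists>q. \<forall>\<epsilon>. F c N d (\<lambda>i. \<theta> i + \<epsilon> * (of_nat i * c)) x = poly q \<epsilon>"
proof (intro exI allI)
  fix \<epsilon>
  show "F c N d (\<lambda>i. \<theta> i + \<epsilon> * (of_nat i * c)) x =
    poly (\<Prod>i = 1..N. \<Prod>k = 0..d i. [:(x - \<theta> i + c * (of_nat (d i) / 2 - of_nat k + 1 / 2)) / c, - of_nat i:]) \<epsilon>"
    unfolding F_def poly_prod using c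
    by (intro prod.cong refl) (simp add: field_simps)
qed

lemma finite_affine_root: "\<beta> \<noteq> 0 \<Longrightarrow> finite {\<epsilon> :: complex. \<alpha> + \<epsilon> * \<beta> = 0}"
  by (rule finite_subset[of _ "{- \<alpha> / \<beta>}"]) (auto simp: field_simps eq_neg_iff_add_eq_0)

text \<open>Site \<open>i\<close> is moved with speed \<open>i * c\<close>. The speeds are distinct,
  so each of the finitely many pairs of zeros at different sites coincides for exactly one
  \<open>\<epsilon>\<close>.\<close>

lemma finite_nongeneric:
  assumes c: "c \<noteq> 0"
  shows "finite {\<epsilon>. \<not> generic_inhomogeneities c N d (\<lambda>i. \<theta> i + \<epsilon> * (of_nat i * c))}"
proof -
  let ?bad = "\<lambda>i j k l. {\<epsilon>. \<theta> i - c * (of_nat (d i) / 2 - of_nat k + 1 / 2) -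
     (\<theta> j - c * (of_nat (d j) / 2 - of_nat l + 1 / 2)) + \<epsilon> * ((of_nat i - of_nat j) * c) = 0}"
  have "finite (\<Union>i\<in>{1..N}. \<Union>j\<in>{1..N} - {i}. \<Union>k\<in>{0..d i}. \<Union>l\<in>{0..d j}. ?bad i j k l)"
    using c by (intro finite_UN_I finite_affine_root) auto
  then show ?thesis
    by (rule finite_subset[rotated]) (auto simp: generic_inhomogeneities_def algebra_simps; force)
qed

text \<open>The vector \<open>e\<close> is a direction along which \<open>\<delta>\<close> changes:
  \<open>a \<cdot> (b + \<epsilon> * e)\<close> is affine in \<open>\<epsilon>\<close> with nonzero
  slope and vanishes at most once. The difference \<open>X \<epsilon>\<close> of the two sides is
  polynomial and zero for all but finitely many \<open>\<epsilon>\<close>, hence also at 0.\<close>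

lemma bethe_relation_sandwich:
  assumes c: "c \<noteq> 0" and rep: "\<And>i. i \<in> {1..N} \<Longrightarrow> spin_rep (d i) (S3 i) (Sp i) (Sm i)"
    and nz: "a1 * e1 + a2 * e2 \<noteq> 0"
    and S: "S = (\<Sum>i = 1..N. d i)" and inj: "inj_on u {1..S}" and z: "z \<notin> u ` {1..S}"
  shows "bethe_relation c S (F c N d \<theta>) z u (a1 * b1 + a2 * b2)
    (\<lambda>x. sandwich a1 a2 b1 b2 (omono c \<theta> (\<lambda>i. site N d i (S3 i)) (\<lambda>i. site N d i (Sp i))
       (\<lambda>i. site N d i (Sm i)) [1..<N + 1] x))"
proof -
  define \<theta>' where "\<theta>' \<epsilon> i = \<theta> i + \<epsilon> * (of_nat i * c)" for \<epsilon> i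
  define B where "B \<epsilon> x = sandwich a1 a2 (b1 + \<epsilon> * e1) (b2 + \<epsilon> * e2)
      (omono c (\<theta>' \<epsilon>) (\<lambda>i. site N d i (S3 i)) (\<lambda>i. site N d i (Sp i))
       (\<lambda>i. site N d i (Sm i)) [1..<N + 1] x)" for \<epsilon> x
  define \<delta> where "\<delta> \<epsilon> = a1 * (b1 + \<epsilon> * e1) + a2 * (b2 + \<epsilon> * e2)" for \<epsilon>
  define X where "X \<epsilon> = B \<epsilon> z * prod_list (map (\<lambda>j. B \<epsilon> (u j)) [1..<S + 1]) -
     \<delta> \<epsilon> *\<^sub>C ((F c N d (\<theta>' \<epsilon>) z * (\<Prod>j = 1..S. g c z (u j))) *\<^sub>C prod_list (map (\<lambda>j. B \<epsilon> (u j)) [1..<S + 1]) +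
       (\<Sum>i = 1..S. (g c (u i) z * F c N d (\<theta>' \<epsilon>) (u i) * (\<Prod>j \<in> {1..S} - {i}. g c (u i) (u j))) *\<^sub>C
          (B \<epsilon> z * prod_list (map (\<lambda>j. B \<epsilon> (u j)) (filter (\<lambda>j. j \<noteq> i) [1..<S + 1])))))" for \<epsilon>
  have X0_iff: "X \<epsilon> = 0 \<longleftrightarrow> bethe_relation c S (F c N d (\<theta>' \<epsilon>)) z u (\<delta> \<epsilon>) (B \<epsilon>)" for \<epsilon>
    unfolding X_def bethe_relation_def by simp
  have B: "polynomial_family (\<lambda>\<epsilon>. B \<epsilon> x)" for x
  proof -
    have eq: "B \<epsilon> x = poly [:a1 * b1, a1 * e1:] \<epsilon> *\<^sub>C T \<epsilon> 1 1 + poly [:a1 * b2, a1 * e2:] \<epsilon> *\<^sub>C T \<epsilon> 1 2 +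
        poly [:a2 * b1, a2 * e1:] \<epsilon> *\<^sub>C T \<epsilon> 2 1 + poly [:a2 * b2, a2 * e2:] \<epsilon> *\<^sub>C T \<epsilon> 2 2"
      if "T = (\<lambda>\<epsilon>. omono c (\<lambda>i. \<theta> i + \<epsilon> * (of_nat i * c)) (\<lambda>i. site N d i (S3 i)) (\<lambda>i. site N d i (Sp i))
       (\<lambda>i. site N d i (Sm i)) [1..<N + 1] x)" for T \<epsilon>
      unfolding that B_def sandwich_def \<theta>'_def by (simp add: algebra_simps)
    show ?thesis
      unfolding eq[OF refl]
      by (intro polynomial_family_add polynomial_family_scl polynomial_family_omono c)
  qed
  have \<delta>: "polynomial_family (\<lambda>\<epsilon>. \<delta> \<epsilon> *\<^sub>C f \<epsilon>)" if "polynomial_family f" for f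
  proof -
    have "\<delta> \<epsilon> = poly [:a1 * b1 + a2 * b2, a1 * e1 + a2 * e2:] \<epsilon>" for \<epsilon>
      by (simp add: \<delta>_def algebra_simps)
    then show ?thesis using that by (simp only: polynomial_family_scl)
  qed
  have F: "polynomial_family (\<lambda>\<epsilon>. (a * F c N d (\<theta>' \<epsilon>) x * b) *\<^sub>C f \<epsilon>)" if f: "polynomial_family f" for f a b x
  proof -
    obtain q where q: "\<And>\<epsilon>. F c N d (\<theta>' \<epsilon>) x = poly q \<epsilon>"
      using F_perturbed[OF c] unfolding \<theta>'_def by blast
    have "a * F c N d (\<theta>' \<epsilon>) x * b = poly (Polynomial.smult (a * b) q) \<epsilon>" for \<epsilon>
      by (simp add: q)
    then show ?thesis using f by (simp only: polynomial_family_scl)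
  qed
  have F1: "polynomial_family (\<lambda>\<epsilon>. (F c N d (\<theta>' \<epsilon>) x * b) *\<^sub>C f \<epsilon>)" if "polynomial_family f" for f b x
    using F[OF that, of 1 x b] by simp
  have "polynomial_family X"
    unfolding X_def
    by (intro polynomial_family_diff polynomial_family_mult polynomial_family_add polynomial_family_sum
        polynomial_family_prod_list B \<delta> F F1)
  moreover have "finite {\<epsilon>. X \<epsilon> \<noteq> 0}"
  proof (rule finite_subset)
    show "finite ({\<epsilon>. (a1 * b1 + a2 * b2) + \<epsilon> * (a1 * e1 + a2 * e2) = 0} \<union>
        {\<epsilon>. \<not> generic_inhomogeneities c N d (\<theta>' \<epsilon>)})"
      using finite_affine_root[OF nz] finite_nongeneric[OF c] unfolding \<theta>'_def by blast
    have "X \<epsilon> = 0" if "(a1 * b1 + a2 * b2) + \<epsilon> * (a1 * e1 + a2 * e2) \<noteq> 0"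
      "generic_inhomogeneities c N d (\<theta>' \<epsilon>)" for \<epsilon>
    proof -
      have "a1 * (b1 + \<epsilon> * e1) + a2 * (b2 + \<epsilon> * e2) \<noteq> 0" using that(1) by (simp add: algebra_simps)
      from bethe_relation_generic[OF c rep this that(2) S inj z]
      show ?thesis unfolding X0_iff \<delta>_def B_def by simp
    qed
    then show "{\<epsilon>. X \<epsilon> \<noteq> 0} \<subseteq> {\<epsilon>. (a1 * b1 + a2 * b2) + \<epsilon> * (a1 * e1 + a2 * e2) = 0} \<union>
        {\<epsilon>. \<not> generic_inhomogeneities c N d (\<theta>' \<epsilon>)}" by blast
  qed
  ultimately have "X 0 = 0" by (rule polynomial_family_zero)
  moreover have "\<theta>' 0 = \<theta>" by (simp add: \<theta>'_def fun_eq_iff)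
  ultimately show ?thesis unfolding X0_iff by (simp add: B_def[abs_def] \<delta>_def del: upt_Suc)
qed

subsection \<open>The relation for matrices\<close>

lemma monodromy_omono:
  fixes \<theta> u
  assumes rep: "\<And>i. i \<in> {1..N} \<Longrightarrow> spin_rep (d i) (S3 i) (Sp i) (Sm i)"
  defines "D \<equiv> chain_dim N d"
  shows "monodromy c N d \<theta> S3 Sp Sm u a b \<in> carrier_mat D D"
    and "emb D (monodromy c N d \<theta> S3 Sp Sm u a b) =
      omono c \<theta> (\<lambda>i. site N d i (S3 i)) (\<lambda>i. site N d i (Sp i)) (\<lambda>i. site N d i (Sm i)) [1..<N + 1] u a b"
proof -
  have D: "D > 0" unfolding D_def by (rule chain_dim_pos)
  have lax: "lax c N d S3 Sp Sm i x a b \<in> carrier_mat D D \<and>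
      emb D (lax c N d S3 Sp Sm i x a b) = olax c (site N d i (S3 i)) (site N d i (Sp i)) (site N d i (Sm i)) x a b"
    if i: "i \<in> {1..N}" for i x a b
  proof -
    have car: "at_site N d i (S3 i) \<in> carrier_mat D D" "at_site N d i (Sp i) \<in> carrier_mat D D"
      "at_site N d i (Sm i) \<in> carrier_mat D D"
      unfolding D_def using spin_repD(1-3)[OF rep[OF i]] by (auto intro!: at_site_carrier[OF i])
    then show ?thesis
      using D unfolding lax_def olax_def site_def D_def[symmetric] Let_def
      by (auto simp: emb_add[of _ D] emb_minus[of _ D] emb_smult emb_one)
  qed
  have "foldr (\<lambda>i. aux_mult (lax c N d S3 Sp Sm i (u - \<theta> i))) xs (aux_one D) a b \<in> carrier_mat D D \<and>
      emb D (foldr (\<lambda>i. aux_mult (lax c N d S3 Sp Sm i (u - \<theta> i))) xs (aux_one D) a b) =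
      omono c \<theta> (\<lambda>i. site N d i (S3 i)) (\<lambda>i. site N d i (Sp i)) (\<lambda>i. site N d i (Sm i)) xs u a b"
    if "set xs \<subseteq> {1..N}" for xs
    using that
  proof (induction xs arbitrary: a b)
    case Nil
    then show ?case using D by (auto simp: aux_one_def omono_Nil emb_one emb_zero)
  next
    case (Cons i xs)
    have i: "i \<in> {1..N}" and xs: "set xs \<subseteq> {1..N}" using Cons.prems by auto
    define T where "T = foldr (\<lambda>i. aux_mult (lax c N d S3 Sp Sm i (u - \<theta> i))) xs (aux_one D)"
    have T_Cons: "foldr (\<lambda>i. aux_mult (lax c N d S3 Sp Sm i (u - \<theta> i))) (i # xs) (aux_one D) =
        aux_mult (lax c N d S3 Sp Sm i (u - \<theta> i)) T"
      by (simp add: T_def)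
    note L = lax[OF i, of "u - \<theta> i"] and IH = Cons.IH[OF xs, folded T_def]
    have M: "lax c N d S3 Sp Sm i (u - \<theta> i) a e * T e b \<in> carrier_mat D D" for a e b
      using L IH by (blast intro: mult_carrier_mat)
    show ?case
      unfolding T_Cons using D M L[THEN conjunct1] IH[THEN conjunct1]
      by (simp add: aux_mult_def omono_Cons omult_def emb_add[of _ D] emb_mult[of _ D]
          L[THEN conjunct2] IH[THEN conjunct2])
  qed
  moreover have "set [1..<N + 1] \<subseteq> {1..N}" by auto
  ultimately show "monodromy c N d \<theta> S3 Sp Sm u a b \<in> carrier_mat D D"
    and "emb D (monodromy c N d \<theta> S3 Sp Sm u a b) =
      omono c \<theta> (\<lambda>i. site N d i (S3 i)) (\<lambda>i. site N d i (Sp i)) (\<lambda>i. site N d i (Sm i)) [1..<N + 1] u a b"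
    unfolding monodromy_def D_def by blast+
qed

lemma matrix_relation_of_bethe_relation:
  fixes \<nu> :: "complex \<Rightarrow> complex mat"
  assumes D: "D > 0" and \<nu>: "\<And>x. \<nu> x \<in> carrier_mat D D"
    and rel: "bethe_relation c S FF z u \<delta> (\<lambda>x. emb D (\<nu> x))" and r: "k * \<delta> = r"
  shows "k \<cdot>\<^sub>m (\<nu> z * op_prod D (\<lambda>j. \<nu> (u j)) [1..<S + 1]) =
      r \<cdot>\<^sub>m
        ((FF z * (\<Prod>j = 1..S. g c z (u j))) \<cdot>\<^sub>m op_prod D (\<lambda>j. \<nu> (u j)) [1..<S + 1]
         + op_sum D
             (\<lambda>i. (g c (u i) z * FF (u i) * (\<Prod>j \<in> {1..S} - {i}. g c (u i) (u j))) \<cdot>\<^sub>m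
                (\<nu> z * op_prod D (\<lambda>j. \<nu> (u j)) (filter (\<lambda>j. j \<noteq> i) [1..<S + 1])))
             {1..S})"
proof -
  have P: "op_prod D (\<lambda>j. \<nu> (u j)) xs \<in> carrier_mat D D" for xs
    using \<nu> by (intro op_prod_carrier)
  have Q: "\<nu> z * op_prod D (\<lambda>j. \<nu> (u j)) xs \<in> carrier_mat D D" for xs
    using \<nu> P by (rule mult_carrier_mat)
  define f where "f i = (g c (u i) z * FF (u i) * (\<Prod>j \<in> {1..S} - {i}. g c (u i) (u j))) \<cdot>\<^sub>m
      (\<nu> z * op_prod D (\<lambda>j. \<nu> (u j)) (filter (\<lambda>j. j \<noteq> i) [1..<S + 1]))" for i
  have f: "f i \<in> carrier_mat D D" for i unfolding f_def using Q by (rule smult_carrier_mat)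
  have sum: "op_sum D f {1..S} \<in> carrier_mat D D" "emb D (op_sum D f {1..S}) = (\<Sum>i = 1..S. emb D (f i))"
    using op_sum_carrier_emb[OF D, of "{1..S}" f] f by auto
  have eP: "emb D (op_prod D (\<lambda>j. \<nu> (u j)) xs) = prod_list (map (\<lambda>j. emb D (\<nu> (u j))) xs)" for xs
    using D \<nu> by (intro emb_op_prod)
  have eQ: "emb D (\<nu> z * op_prod D (\<lambda>j. \<nu> (u j)) xs) =
      emb D (\<nu> z) * prod_list (map (\<lambda>j. emb D (\<nu> (u j))) xs)" for xs
    by (simp only: emb_mult[OF \<nu> P D] eP)
  have ef: "emb D (f i) = (g c (u i) z * FF (u i) * (\<Prod>j \<in> {1..S} - {i}. g c (u i) (u j))) *\<^sub>C
      (emb D (\<nu> z) * prod_list (map (\<lambda>j. emb D (\<nu> (u j))) (filter (\<lambda>j. j \<noteq> i) [1..<S + 1])))" for i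
    unfolding f_def by (simp only: emb_smult[OF Q D] eQ)
  show ?thesis
    unfolding f_def[symmetric]
  proof (rule emb_inject)
    show "k \<cdot>\<^sub>m (\<nu> z * op_prod D (\<lambda>j. \<nu> (u j)) [1..<S + 1]) \<in> carrier_mat D D"
      using Q by (rule smult_carrier_mat)
    have R: "(FF z * (\<Prod>j = 1..S. g c z (u j))) \<cdot>\<^sub>m op_prod D (\<lambda>j. \<nu> (u j)) [1..<S + 1] \<in> carrier_mat D D"
      using P by (rule smult_carrier_mat)
    have R': "(FF z * (\<Prod>j = 1..S. g c z (u j))) \<cdot>\<^sub>m op_prod D (\<lambda>j. \<nu> (u j)) [1..<S + 1] +
        op_sum D f {1..S} \<in> carrier_mat D D" using sum(1) by (rule add_carrier_mat)
    then show "r \<cdot>\<^sub>m ((FF z * (\<Prod>j = 1..S. g c z (u j))) \<cdot>\<^sub>m op_prod D (\<lambda>j. \<nu> (u j)) [1..<S + 1] +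
        op_sum D f {1..S}) \<in> carrier_mat D D" by (rule smult_carrier_mat)
    show "emb D (k \<cdot>\<^sub>m (\<nu> z * op_prod D (\<lambda>j. \<nu> (u j)) [1..<S + 1])) =
      emb D (r \<cdot>\<^sub>m ((FF z * (\<Prod>j = 1..S. g c z (u j))) \<cdot>\<^sub>m op_prod D (\<lambda>j. \<nu> (u j)) [1..<S + 1] +
        op_sum D f {1..S}))"
      unfolding emb_smult[OF Q D] emb_smult[OF R' D] emb_add[OF R sum(1) D] emb_smult[OF P D] sum(2) ef eP eQ
        rel[unfolded bethe_relation_def] r[symmetric] by (simp only: scl_simps)
  qed
qed

text \<open>Here \<open>\<nu>\<close> is \<open>\<mu>\<close> times a sandwich, so its relation has
  the factor \<open>\<mu> * (a1 * b1 + a2 * b2)\<close>; the prefactor \<open>k / \<mu>\<close>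
  removes \<open>\<mu>\<close> and leaves \<open>r\<close>.\<close>

lemma twisted_relation:
  assumes c: "c \<noteq> 0" and rep: "\<And>i. i \<in> {1..N} \<Longrightarrow> spin_rep (d i) (S3 i) (Sp i) (Sm i)"
    and nz: "a1 * e1 + a2 * e2 \<noteq> 0"
    and inj: "inj_on u {1..S}" and z: "z \<notin> u ` {1..S}" and S: "S = (\<Sum>i = 1..N. d i)"
    and t: "t = monodromy c N d \<theta> S3 Sp Sm" and D: "D = chain_dim N d"
    and \<nu>: "\<And>x. \<nu> x = \<mu> \<cdot>\<^sub>m ((a1 * b1) \<cdot>\<^sub>m t x 1 1 + (a1 * b2) \<cdot>\<^sub>m t x 1 2 +
      (a2 * b1) \<cdot>\<^sub>m t x 2 1 + (a2 * b2) \<cdot>\<^sub>m t x 2 2)"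
    and \<mu>: "\<mu> \<noteq> 0" and r: "k * (a1 * b1 + a2 * b2) = r"
  shows "(k / \<mu>) \<cdot>\<^sub>m (\<nu> z * op_prod D (\<lambda>j. \<nu> (u j)) [1..<S + 1]) =
      r \<cdot>\<^sub>m
        ((F c N d \<theta> z * (\<Prod>j = 1..S. g c z (u j))) \<cdot>\<^sub>m op_prod D (\<lambda>j. \<nu> (u j)) [1..<S + 1]
         + op_sum D
             (\<lambda>i. (g c (u i) z * F c N d \<theta> (u i) * (\<Prod>j \<in> {1..S} - {i}. g c (u i) (u j))) \<cdot>\<^sub>m
                (\<nu> z * op_prod D (\<lambda>j. \<nu> (u j)) (filter (\<lambda>j. j \<noteq> i) [1..<S + 1])))
             {1..S})"
proof (rule matrix_relation_of_bethe_relation)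
  show D0: "D > 0" unfolding D by (rule chain_dim_pos)
  have T: "t x a b \<in> carrier_mat D D" "emb D (t x a b) =
      omono c \<theta> (\<lambda>i. site N d i (S3 i)) (\<lambda>i. site N d i (Sp i)) (\<lambda>i. site N d i (Sm i)) [1..<N + 1] x a b"
    for x a b
    unfolding t D using monodromy_omono[OF rep] by simp_all
  show "\<nu> x \<in> carrier_mat D D" for x unfolding \<nu> using T(1) by simp
  have "emb D (\<nu> x) = \<mu> *\<^sub>C sandwich a1 a2 b1 b2
      (omono c \<theta> (\<lambda>i. site N d i (S3 i)) (\<lambda>i. site N d i (Sp i)) (\<lambda>i. site N d i (Sm i)) [1..<N + 1] x)" for x
    unfolding \<nu> sandwich_def using D0 T(1)
    by (simp add: emb_smult[of _ D] emb_add[of _ D] T(2) del: upt_Suc)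
  then show "bethe_relation c S (F c N d \<theta>) z u (\<mu> * (a1 * b1 + a2 * b2)) (\<lambda>x. emb D (\<nu> x))"
    using bethe_relation_scl[OF bethe_relation_sandwich[OF c rep nz S inj z]] by simp
  show "k / \<mu> * (\<mu> * (a1 * b1 + a2 * b2)) = r" using \<mu> r by simp
qed

theorem corollary4p6:
  fixes c z \<kappa>t \<kappa> \<kappa>p \<kappa>m \<rho>1 \<rho>2 \<mu> :: complex
    and N S D :: nat
    and d :: "nat \<Rightarrow> nat"
    and \<theta> u v :: "nat \<Rightarrow> complex"
    and S3 Sp Sm :: "nat \<Rightarrow> complex mat"
    and t :: "complex \<Rightarrow> nat \<Rightarrow> nat \<Rightarrow> complex mat"
    and \<nu>12 \<nu>21 :: "complex \<Rightarrow> complex mat"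
  assumes "c \<noteq> 0" and "N \<ge> 1"
    and "\<And>i. i \<in> {1..N} \<Longrightarrow> d i \<ge> 1"
    and "\<And>i. i \<in> {1..N} \<Longrightarrow> spin_rep (d i) (S3 i) (Sp i) (Sm i)"
    and "\<kappa>p \<noteq> 0" and "\<kappa>m \<noteq> 0"
    and "\<kappa>p * \<kappa>m - (\<rho>1 * \<kappa> + \<rho>2 * \<kappa>t) + \<rho>1 * \<rho>2 = 0"
    and "\<rho>1 * \<rho>2 \<noteq> \<kappa>p * \<kappa>m"
    and "\<mu> = twist_mu \<rho>1 \<rho>2 \<kappa>p \<kappa>m"
    and "t = monodromy c N d \<theta> S3 Sp Sm"
    and "\<nu>12 = nu12 \<rho>1 \<rho>2 \<kappa>p \<kappa>m t"
    and "\<nu>21 = nu21 \<rho>1 \<rho>2 \<kappa>p \<kappa>m t"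
    and "D = chain_dim N d"
    and "S = (\<Sum>i = 1..N. d i)"
    and "inj_on u {1..S}" and "inj_on v {1..S}"
    and "z \<notin> u ` {1..S} \<union> v ` {1..S}"
  shows "(\<kappa>m / \<mu>) \<cdot>\<^sub>m (\<nu>12 z * op_prod D (\<lambda>j. \<nu>12 (u j)) [1..<S + 1]) =
      (\<rho>1 + \<rho>2) \<cdot>\<^sub>m
        ((F c N d \<theta> z * (\<Prod>j = 1..S. g c z (u j))) \<cdot>\<^sub>m op_prod D (\<lambda>j. \<nu>12 (u j)) [1..<S + 1]
         + op_sum D
             (\<lambda>i. (g c (u i) z * F c N d \<theta> (u i) * (\<Prod>j \<in> {1..S} - {i}. g c (u i) (u j))) \<cdot>\<^sub>m
                (\<nu>12 z * op_prod D (\<lambda>j. \<nu>12 (u j)) (filter (\<lambda>j. j \<noteq> i) [1..<S + 1])))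
             {1..S})
    \<and> (\<kappa>p / \<mu>) \<cdot>\<^sub>m (\<nu>21 z * op_prod D (\<lambda>j. \<nu>21 (v j)) [1..<S + 1]) =
      (\<rho>1 + \<rho>2) \<cdot>\<^sub>m
        ((F c N d \<theta> z * (\<Prod>j = 1..S. g c z (v j))) \<cdot>\<^sub>m op_prod D (\<lambda>j. \<nu>21 (v j)) [1..<S + 1]
         + op_sum D
             (\<lambda>i. (g c (v i) z * F c N d \<theta> (v i) * (\<Prod>j \<in> {1..S} - {i}. g c (v i) (v j))) \<cdot>\<^sub>m
                (\<nu>21 z * op_prod D (\<lambda>j. \<nu>21 (v j)) (filter (\<lambda>j. j \<noteq> i) [1..<S + 1])))
             {1..S})"
proof -
  note rep = assms(4) and t = assms(10)
  have \<mu>: "\<mu> \<noteq> 0"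
    using assms(5,6,8) by (simp add: assms(9) twist_mu_def field_simps)
  have T: "t x a b \<in> carrier_mat D D" for x a b
    unfolding t assms(13) using rep by (rule monodromy_omono(1))
  note T4 = T[of _ 1 1] T[of _ 1 2] T[of _ 2 1] T[of _ 2 2]
  \<comment> \<open>The four coefficients form a matrix of rank one:
    \<open>a = (1, \<rho>2 / \<kappa>m)\<close> and
    \<open>b = (\<rho>1 / \<kappa>m, 1)\<close>.\<close>
  have 12: "\<nu>12 x = \<mu> \<cdot>\<^sub>m ((1 * (\<rho>1 / \<kappa>m)) \<cdot>\<^sub>m t x 1 1 + (1 * 1) \<cdot>\<^sub>m t x 1 2 +
      (\<rho>2 / \<kappa>m * (\<rho>1 / \<kappa>m)) \<cdot>\<^sub>m t x 2 1 + (\<rho>2 / \<kappa>m * 1) \<cdot>\<^sub>m t x 2 2)" for x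
    unfolding assms(9,11) nu12_def
    by (rule eq_matI) (use T4[of x] in \<open>auto simp: power2_eq_square mult.commute algebra_simps\<close>)
  \<comment> \<open>Here \<open>a = (\<rho>1 / \<kappa>p, 1)\<close> and
    \<open>b = (1, \<rho>2 / \<kappa>p)\<close>.\<close>
  have 21: "\<nu>21 x = \<mu> \<cdot>\<^sub>m ((\<rho>1 / \<kappa>p * 1) \<cdot>\<^sub>m t x 1 1 + (\<rho>1 / \<kappa>p * (\<rho>2 / \<kappa>p)) \<cdot>\<^sub>m t x 1 2 +
      (1 * 1) \<cdot>\<^sub>m t x 2 1 + (1 * (\<rho>2 / \<kappa>p)) \<cdot>\<^sub>m t x 2 2)" for x
    unfolding assms(9,12) nu21_def
    by (rule eq_matI) (use T4[of x] in \<open>auto simp: power2_eq_square mult.commute algebra_simps\<close>)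
  have z: "z \<notin> u ` {1..S}" "z \<notin> v ` {1..S}" using assms(17) by auto
  \<comment> \<open>The direction of perturbation is the unit vector at the position where
    \<open>a\<close> has the entry 1.\<close>
  have nz: "1 * 1 + \<rho>2 / \<kappa>m * 0 \<noteq> 0" "\<rho>1 / \<kappa>p * 0 + 1 * 1 \<noteq> 0" by simp_all
  have r: "\<kappa>m * (1 * (\<rho>1 / \<kappa>m) + \<rho>2 / \<kappa>m * 1) = \<rho>1 + \<rho>2"
    "\<kappa>p * (\<rho>1 / \<kappa>p * 1 + 1 * (\<rho>2 / \<kappa>p)) = \<rho>1 + \<rho>2"
    using assms(5,6) by (simp_all add: field_simps)
  show ?thesis
    using twisted_relation[OF assms(1) rep nz(1) assms(15) z(1) assms(14) t assms(13) 12 \<mu> r(1)]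
      twisted_relation[OF assms(1) rep nz(2) assms(16) z(2) assms(14) t assms(13) 21 \<mu> r(2)]
    by blast
qed

end
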